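(* Let $n\ge1$ and let $S\subset\mathbb{R}^{n+1}$ be a compact $C^2$ hypersurface bounding a convex domain $S_0$ containing the origin. Suppose that for some $0<\alpha<1$ and some $C>0$ one has $|a(v,t)|\le C|t|^{-\alpha}$ for all directions $v$ and all real $t\ne0$. Then there is a constant $C'$ such that for all $k>1$, $$|N(k)-k^{n+1}m(S_0)|\le C'\,k^{\,n-\frac{\alpha}{n+1-\alpha}} .$$
   Context: A direction is a vector $v\in\mathbb{R}^{n+1}$ with $|v|=1$. With $\nu$ denoting Euclidean surface measure on $S$, for a direction $v$ and real $t\ne0$, $$a(v,t)=\sup_{s\in\mathbb{R}}\nu\big(\{x\in S: s\le x\cdot v\le s+|t|^{-1}\}\big).$$ "$S$ bounds the convex domain $S_0$" means that $S_0$ is a bounded open convex subset of $\mathbb{R}^{n+1}$ with boundary $S$. $m(S_0)$ denotes the $(n+1)$-dimensional Lebesgue measure of $S_0$. For $k>1$, $N(k)$ denotes the number of lattice points (points of $\mathbb{Z}^{n+1}$) on or inside the dilated surface $\{kx:x\in S\}$, i.e. the number of points of $\mathbb{Z}^{n+1}$ in $\{kx: x\in S_0\cup S\}$. *)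

theory Defs
  imports "HOL-Analysis.Analysis"
begin

text \<open>
  The outer Hausdorff measure of integer dimension \<open>d\<close>, with the normalisation that makes it
  agree with Lebesgue measure on \<open>d\<close>-dimensional subspaces.  The empty set must be treated
  separately only because \<open>0 ^ 0 = 1\<close>; boundedness is required because \<open>diameter\<close> is
  meaningless on unbounded sets.
\<close>

definition hausdorff_content :: "nat \<Rightarrow> real \<Rightarrow> 'a::metric_space set \<Rightarrow> ennreal" where
  "hausdorff_content d \<delta> A =
     (INF U \<in> {U :: nat \<Rightarrow> 'a set. A \<subseteq> (\<Union>i. U i) \<and> (\<forall>i. bounded (U i) \<and> diameter (U i) \<le> \<delta>)}.
        \<Sum>i. ennreal (if U i = {} then 0 else unit_ball_vol (real d) * (diameter (U i) / 2) ^ d))"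

definition hausdorff_measure :: "nat \<Rightarrow> 'a::metric_space set \<Rightarrow> ennreal" where
  "hausdorff_measure d A = (SUP \<delta> \<in> {0<..}. hausdorff_content d \<delta> A)"

text \<open>
  Euclidean surface measure \<open>\<nu>\<close> of (Borel) pieces of a hypersurface: the Hausdorff measure of
  codimension one.
\<close>

definition surface_measure :: "'a::euclidean_space set \<Rightarrow> ennreal" where
  "surface_measure A = hausdorff_measure (DIM('a) - 1) A"

definition C2_on :: "('a::real_normed_vector \<Rightarrow> 'b::real_normed_vector) \<Rightarrow> 'a set \<Rightarrow> bool" where
  "C2_on f W \<longleftrightarrow>
     (\<exists>f' :: 'a \<Rightarrow> 'a \<Rightarrow>\<^sub>L 'b. \<exists>f'' :: 'a \<Rightarrow> 'a \<Rightarrow>\<^sub>L ('a \<Rightarrow>\<^sub>L 'b).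
        (\<forall>x\<in>W. (f has_derivative blinfun_apply (f' x)) (at x) \<and>
               (f' has_derivative blinfun_apply (f'' x)) (at x)) \<and>
        continuous_on W f'')"

text \<open>Embedded hypersurfaces without boundary, as local zero sets of \<open>C\<^sup>2\<close> submersions.\<close>

definition C2_hypersurface :: "'a::euclidean_space set \<Rightarrow> bool" where
  "C2_hypersurface S \<longleftrightarrow>
     (\<forall>p\<in>S. \<exists>W. \<exists>f :: 'a \<Rightarrow> real.
        open W \<and> p \<in> W \<and> C2_on f W \<and>
        (\<forall>x\<in>W. frechet_derivative f (at x) \<noteq> (\<lambda>h. 0)) \<and>
        S \<inter> W = {x\<in>W. f x = 0})"

definition bounds_convex_domain :: "'a::euclidean_space set \<Rightarrow> 'a set \<Rightarrow> bool" where
  "bounds_convex_domain S S0 \<longleftrightarrow> bounded S0 \<and> open S0 \<and> convex S0 \<and> frontier S0 = S"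

text \<open>
  The function \<open>a(v,t)\<close>.  It is kept in \<open>ennreal\<close>, so that the supremum needs no boundedness
  side condition and the absolute value around it is redundant.
\<close>

definition max_slab_measure :: "'a::euclidean_space set \<Rightarrow> 'a \<Rightarrow> real \<Rightarrow> ennreal" where
  "max_slab_measure S v t =
     (SUP s::real. surface_measure {x\<in>S. s \<le> x \<bullet> v \<and> x \<bullet> v \<le> s + inverse \<bar>t\<bar>})"

definition integer_lattice :: "(real ^ 'n) set" where
  "integer_lattice = {z. \<forall>i. z $ i \<in> \<int>}"

definition lattice_count :: "(real ^ 'n) set \<Rightarrow> (real ^ 'n) set \<Rightarrow> real \<Rightarrow> nat" where
  "lattice_count S S0 k = card (integer_lattice \<inter> (\<lambda>x. k *\<^sub>R x) ` (S0 \<union> S))"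

end

theory Submission
  imports Defs
begin

text \<open>
  Let \<open>K\<close> be the closure of \<open>S0\<close> and \<open>d = n + 1\<close>.  The hypothesis enters only through caps: pushing a
  thin slab of \<open>K\<close> along a coordinate axis into the boundary of the cap below it bounds the volume
  \<open>W(s)\<close> of the slab of thickness \<open>h\<close> at height \<open>s\<close> by \<open>h u powr \<alpha>\<close>, where \<open>u\<close> is the distance to the
  supporting hyperplane.  Comparing radial functions of neighbouring slabs, the second difference of
  \<open>W\<close> with step \<open>h\<close> is at most of order \<open>(h / u)\<^sup>2\<close> times \<open>W\<close>; integrating against \<open>1 - cos\<close> with
  \<open>h = pi / t\<close> gives the decay \<open>t powr (- 1 - \<alpha>)\<close> of the Fourier transform of the indicator of \<open>K\<close>.

  The counting function of the translates of \<open>k K\<close> is averaged against a nonnegative trigonometric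
  polynomial of degree \<open>L\<close> concentrated at scale \<open>1 / L\<close>, so that only finitely many frequencies
  occur and Poisson summation is not needed.  The average is off by at most a multiple of
  \<open>(k L) powr (d - 1 - \<alpha>)\<close>, changing \<open>k\<close> by order \<open>1 / L\<close> costs \<open>k powr (d - 1) / L\<close>, and the choice
  \<open>L = k powr (\<alpha> / (d - \<alpha>))\<close> balances the two.  The tail of the kernel contributes a third of
  the error at a nearby \<open>k\<close>, uniformly over translates, and is removed by iteration.
\<close>

subsection \<open>Slab volumes and cap measures\<close>

text \<open>The exponent comes from three scalings. A slab of thickness \<open>h\<close> at depth
  \<open>u\<close> has volume of order at most \<open>h * u powr \<alpha>\<close>, and
  \<open>(h / u)^2\<close> times this bounds its second difference from above. Since \<alpha> < 1,
  the resulting \<open>u powr (\<alpha> - 2)\<close> is integrable at infinity, so depths of order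
  \<open>h\<close> decide, and this gives the decay. Summing
  \<open>norm m powr (- 1 - \<alpha>)\<close> over frequencies up to \<open>L\<close> gives
  \<open>L powr (d - 1 - \<alpha>)\<close>. With \<open>L = k powr \<delta>\<close> and
  \<open>\<delta> = \<alpha> / (d - \<alpha>)\<close> both errors have the same order because
  \<open>(d - 1 - \<alpha>) * (1 + \<delta>) = d - 1 - \<delta>\<close>. The obstacle is that a
  nonzero trigonometric polynomial cannot vanish outside a small ball of the unit cube, so its
  averages do not sandwich the count between those of two nearby dilates. The tail sees the body at
  arbitrary translates, which is why every error bound is carried for all translates. One comparison
  returns a third of the error at dilations enlarged by a factor of at most
  \<open>1 + \<eta>\<close>; the power \<open>d\<close> of that factor is at most
  \<open>3/2\<close>, so each round still gains \<open>1/2\<close>.\<close>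

lemma exists_large_coordinate:
  fixes v :: "'a::euclidean_space"
  assumes "norm v = 1"
  obtains b where "b \<in> Basis" "1 / real DIM('a) \<le> \<bar>v \<bullet> b\<bar>"
proof (rule ccontr)
  assume "\<not> thesis"
  then have "\<And>b. b \<in> Basis \<Longrightarrow> \<bar>v \<bullet> b\<bar> < 1 / real DIM('a)"
    using that by force
  then have "(\<Sum>b\<in>Basis. \<bar>v \<bullet> b\<bar>) < (\<Sum>b\<in>(Basis::'a set). 1 / real DIM('a))"
    by (intro sum_strict_mono) auto
  with norm_le_l1[of v] assms show False by simp
qed

text \<open>Averaging over translations along the axis \<open>b0\<close> replaces a rotation to coordinates
  adapted to \<open>v\<close>.\<close>

lemma emeasure_slab_cylinder_le:
  fixes v z b0 :: "'a::euclidean_space" and Z :: "'a set"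
  assumes b0: "b0 \<in> Basis" "1 / real DIM('a) \<le> \<bar>v \<bullet> b0\<bar>"
    and Z: "Z \<in> sets borel" "bounded Z" and "0 \<le> h" "0 \<le> D"
    and slab: "\<And>x. x \<in> Z \<Longrightarrow> \<bar>x \<bullet> v - s\<bar> \<le> h / 2"
    and cyl: "\<And>x b. x \<in> Z \<Longrightarrow> b \<in> Basis \<Longrightarrow> b \<noteq> b0 \<Longrightarrow> \<bar>(x - z) \<bullet> b\<bar> \<le> D"
  shows "emeasure lborel Z \<le> ennreal (2 * real DIM('a) * h * (2 * D) ^ (DIM('a) - 1))"
proof -
  obtain M where M: "M > 0" "\<And>x. x \<in> Z \<Longrightarrow> norm (x - z) \<le> M"
  proof -
    have "bounded ((\<lambda>x. x - z) ` Z)"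
      using Z(2) bounded_translation_minus by blast
    then show thesis using that unfolding bounded_pos by auto
  qed
  have vb: "v \<bullet> b0 \<noteq> 0" and dpos: "0 < real DIM('a)"
    using b0 DIM_positive[where 'a='a] by (auto simp: field_simps)
  \<comment> \<open>A line parallel to \<open>b0\<close> crosses the slab in length at most
    \<open>h / |v \<bullet> b0|\<close>, hence at most \<open>w\<close>.\<close>
  define w where "w = real DIM('a) * h"
  have w0: "0 \<le> w" using assms by (simp add: w_def)
  \<comment> \<open>Translations by \<open>\<tau>\<close> with \<open>|\<tau>| \<le> M\<close> are
    averaged and \<open>Z\<close> lies within \<open>M\<close> of \<open>z\<close>, so along
    \<open>b0\<close> only points within \<open>2 * M\<close> of \<open>z\<close> can be
    hit.\<close>
  define B where "B = cbox (z - (\<Sum>b\<in>Basis. (if b = b0 then 2 * M else D) *\<^sub>R b))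
                           (z + (\<Sum>b\<in>Basis. (if b = b0 then 2 * M else D) *\<^sub>R b))"
  have memB: "x \<in> B \<longleftrightarrow> (\<forall>b\<in>Basis. \<bar>(x - z) \<bullet> b\<bar> \<le> (if b = b0 then 2 * M else D))" for x
    unfolding B_def mem_box
    by (intro ball_cong refl)
       (auto simp: inner_diff_left inner_add_left inner_sum_left_Basis abs_le_iff algebra_simps)
  have eB: "emeasure lborel B = ennreal (4 * M * (2 * D) ^ (DIM('a) - 1))"
  proof -
    have "emeasure lborel B = ennreal (\<Prod>b\<in>Basis. 2 * (if b = b0 then 2 * M else D))"
      unfolding B_def using M(1) \<open>0 \<le> D\<close>
      by (subst emeasure_lborel_cbox)
         (auto simp: inner_diff_left inner_add_left inner_sum_left_Basis algebra_simps)
    also have "(\<Prod>b\<in>(Basis::'a set). 2 * (if b = b0 then 2 * M else D))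
       = 4 * M * (\<Prod>b\<in>Basis - {b0}. 2 * D)"
      using b0(1) by (subst prod.remove[of _ b0]) (auto intro!: prod.cong)
    finally show ?thesis using b0(1) by simp
  qed
  have [measurable]: "Z \<in> sets borel" by fact
  have line: "(\<integral>\<^sup>+\<tau>. indicator {-M..M} \<tau> * indicator Z (x + \<tau> *\<^sub>R b0) \<partial>lborel)
      \<le> ennreal w * indicator B x" for x
  proof (cases "\<exists>\<tau>\<in>{-M..M}. x + \<tau> *\<^sub>R b0 \<in> Z")
    case False
    then have "(\<lambda>\<tau>. indicator {-M..M} \<tau> * indicator Z (x + \<tau> *\<^sub>R b0) :: ennreal) = (\<lambda>_. 0)"
      by (auto simp: indicator_def fun_eq_iff)
    then show ?thesis by simp
  next
    case True
    then obtain \<tau>0 where \<tau>0: "\<bar>\<tau>0\<bar> \<le> M" "x + \<tau>0 *\<^sub>R b0 \<in> Z" by (force simp: abs_le_iff)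
    have "x \<in> B" unfolding memB
    proof
      fix b :: 'a assume b: "b \<in> Basis"
      show "\<bar>(x - z) \<bullet> b\<bar> \<le> (if b = b0 then 2 * M else D)"
      proof (cases "b = b0")
        case True
        have "\<bar>(x + \<tau>0 *\<^sub>R b0 - z) \<bullet> b0\<bar> \<le> M"
          using Basis_le_norm[OF b0(1)] M(2)[OF \<tau>0(2)] order_trans by blast
        then show ?thesis using True \<tau>0(1) b0(1)
          by (simp add: algebra_simps inner_add_left inner_diff_left)
      next
        case False
        then show ?thesis using cyl[OF \<tau>0(2) b False] b b0(1)
          by (simp add: inner_add_left inner_diff_left inner_not_same_Basis)
      qed
    qed
    define c where "c = (s - x \<bullet> v) / (v \<bullet> b0)"
    have "(\<integral>\<^sup>+\<tau>. indicator {-M..M} \<tau> * indicator Z (x + \<tau> *\<^sub>R b0) \<partial>lborel)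
       \<le> (\<integral>\<^sup>+\<tau>. indicator {c - w/2..c + w/2} \<tau> \<partial>lborel)"
    proof (intro nn_integral_mono)
      fix \<tau> :: real
      have "\<tau> \<in> {c - w/2..c + w/2}" if "x + \<tau> *\<^sub>R b0 \<in> Z"
      proof -
        have "\<bar>(x + \<tau> *\<^sub>R b0) \<bullet> v - s\<bar> \<le> h / 2" using slab that by blast
        also have "(x + \<tau> *\<^sub>R b0) \<bullet> v - s = (v \<bullet> b0) * (\<tau> - c)"
          using vb by (simp add: c_def inner_add_left inner_commute[of b0] field_simps)
        finally have "\<bar>v \<bullet> b0\<bar> * \<bar>\<tau> - c\<bar> \<le> h / 2" by (simp add: abs_mult)
        moreover have "(1 / real DIM('a)) * \<bar>\<tau> - c\<bar> \<le> \<bar>v \<bullet> b0\<bar> * \<bar>\<tau> - c\<bar>"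
          using b0(2) by (intro mult_right_mono) auto
        ultimately have "(1 / real DIM('a)) * \<bar>\<tau> - c\<bar> \<le> h / 2" by linarith
        then have "\<bar>\<tau> - c\<bar> \<le> w / 2" using dpos unfolding w_def by (simp add: field_simps)
        then show ?thesis unfolding atLeastAtMost_iff by linarith
      qed
      then show "indicator {-M..M} \<tau> * indicator Z (x + \<tau> *\<^sub>R b0)
          \<le> (indicator {c - w/2..c + w/2} \<tau> :: ennreal)"
        by (auto simp: indicator_def)
    qed
    also have "\<dots> = ennreal w" using w0 by (simp add: emeasure_lborel_Icc)
    finally show ?thesis using \<open>x \<in> B\<close> by simp
  qed
  have tr: "(\<integral>\<^sup>+x. indicator Z (x + \<tau> *\<^sub>R b0) \<partial>lborel) = emeasure lborel Z" for \<tau>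
  proof -
    have "emeasure lborel Z = emeasure (distr lborel borel (\<lambda>x. \<tau> *\<^sub>R b0 + x)) Z"
      using lborel_distr_plus[of "\<tau> *\<^sub>R b0"] by simp
    also have "\<dots> = (\<integral>\<^sup>+x. indicator Z x \<partial>(distr lborel borel (\<lambda>x. \<tau> *\<^sub>R b0 + x)))" by simp
    also have "\<dots> = (\<integral>\<^sup>+x. indicator Z (\<tau> *\<^sub>R b0 + x) \<partial>lborel)"
      by (subst nn_integral_distr) auto
    finally show ?thesis by (simp add: add.commute)
  qed
  \<comment> \<open>Every translate of \<open>Z\<close> has the same volume, so the double integral
    is \<open>2 * M\<close> times that volume. In the other order it is at most \<open>w\<close>
    times the volume of \<open>B\<close>, and \<open>M\<close> cancels.\<close>
  have "ennreal (2 * M) * emeasure lborel Z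
      = (\<integral>\<^sup>+\<tau>. indicator {-M..M} \<tau> * (\<integral>\<^sup>+x. indicator Z (x + \<tau> *\<^sub>R b0) \<partial>lborel) \<partial>lborel)"
    unfolding tr using M(1) by (subst nn_integral_multc) (auto simp: emeasure_lborel_Icc)
  also have "\<dots> = (\<integral>\<^sup>+\<tau>. (\<integral>\<^sup>+x. indicator {-M..M} \<tau> * indicator Z (x + \<tau> *\<^sub>R b0) \<partial>lborel) \<partial>lborel)"
    by (intro nn_integral_cong) (simp add: nn_integral_cmult)
  also have "\<dots> = (\<integral>\<^sup>+x. (\<integral>\<^sup>+\<tau>. indicator {-M..M} \<tau> * indicator Z (x + \<tau> *\<^sub>R b0) \<partial>lborel) \<partial>lborel)"
    by (subst lborel_pair.Fubini') (auto simp: split_beta')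
  also have "\<dots> \<le> (\<integral>\<^sup>+x. ennreal w * indicator B x \<partial>lborel)"
    by (intro nn_integral_mono line)
  also have "\<dots> = ennreal w * emeasure lborel B"
    by (subst nn_integral_cmult_indicator) (auto simp: B_def)
  also have "\<dots> = ennreal (w * (4 * M * (2 * D) ^ (DIM('a) - 1)))"
    unfolding eB using w0 by (simp add: ennreal_mult')
  also have "\<dots> = ennreal (2 * M) * ennreal (2 * real DIM('a) * h * (2 * D) ^ (DIM('a) - 1))"
    using M(1) by (subst ennreal_mult'[symmetric]) (auto simp: w_def algebra_simps)
  finally show ?thesis
    using M(1) by (simp add: ennreal_mult_le_mult_iff)
qed

text \<open>Compactness gives a last parameter at which the ray is in \<open>K\<close>; from an
  interior point the ray could be continued, so the last point lies on the frontier.\<close>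

lemma exit_point_in_frontier:
  fixes K :: "'a::euclidean_space set"
  assumes K: "compact K" and x: "x \<in> K" and w: "w \<noteq> 0"
  obtains \<tau> where "0 \<le> \<tau>" "x + \<tau> *\<^sub>R w \<in> frontier K"
proof -
  define J where "J = {\<tau>. 0 \<le> \<tau> \<and> x + \<tau> *\<^sub>R w \<in> K}"
  have "closed J"
  proof -
    have "J = {0..} \<inter> (\<lambda>\<tau>. x + \<tau> *\<^sub>R w) -` K" by (auto simp: J_def)
    then show ?thesis using compact_imp_closed[OF K]
      by (auto intro!: closed_Int closed_vimage continuous_intros)
  qed
  moreover have "bounded J"
  proof -
    obtain B where B: "\<And>y. y \<in> K \<Longrightarrow> norm y \<le> B"
      using compact_imp_bounded[OF K] unfolding bounded_iff by auto
    have "norm \<tau> \<le> (B + norm x) / norm w" if "\<tau> \<in> J" for \<tau>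
    proof -
      have "norm (\<tau> *\<^sub>R w) \<le> norm (x + \<tau> *\<^sub>R w) + norm x"
        using norm_triangle_ineq4[of "x + \<tau> *\<^sub>R w" x] by simp
      also have "\<dots> \<le> B + norm x" using B that by (simp add: J_def)
      finally show ?thesis using w by (simp add: field_simps)
    qed
    then show ?thesis unfolding bounded_iff by blast
  qed
  moreover have "0 \<in> J" using x by (simp add: J_def)
  ultimately obtain \<tau> where \<tau>: "\<tau> \<in> J" "\<And>t. t \<in> J \<Longrightarrow> t \<le> \<tau>"
    using compact_attains_sup[of J] compact_eq_bounded_closed[of J] by blast
  have "x + \<tau> *\<^sub>R w \<notin> interior K"
  proof
    assume "x + \<tau> *\<^sub>R w \<in> interior K"
    then obtain e where e: "e > 0" "ball (x + \<tau> *\<^sub>R w) e \<subseteq> K"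
      unfolding mem_interior by blast
    define \<delta> where "\<delta> = e / (2 * norm w)"
    have \<delta>: "\<delta> > 0" using e w by (simp add: \<delta>_def)
    have "x + (\<tau> + \<delta>) *\<^sub>R w \<in> ball (x + \<tau> *\<^sub>R w) e"
      using e w by (simp add: dist_norm algebra_simps \<delta>_def)
    then have "\<tau> + \<delta> \<in> J" using e \<tau>(1) \<delta> by (auto simp: J_def)
    then show False using \<tau>(2) \<delta> by force
  qed
  moreover have "x + \<tau> *\<^sub>R w \<in> K" using \<tau>(1) by (simp add: J_def)
  ultimately show thesis
    using that \<tau>(1) closure_subset by (fastforce simp: J_def frontier_def)
qed

text \<open>Every point of a slab of \<open>K\<close> projects, along a coordinate axis, to a boundary point of the
  cap below it; so the slab lies in cylinders over a Hausdorff cover of that cap.\<close>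

lemma slab_volume_le_cap_measure:
  fixes K T :: "'a::euclidean_space set" and v :: 'a
  assumes K: "compact K" and v: "norm v = 1"
    and low: "\<And>x. x \<in> K \<Longrightarrow> a \<le> x \<bullet> v"
    and m: "surface_measure {x \<in> frontier K. a \<le> x \<bullet> v \<and> x \<bullet> v \<le> a + u} \<le> ennreal m" "0 \<le> m"
    and T: "T \<in> sets borel" "T \<subseteq> K" and "0 \<le> h"
    and slab: "\<And>x. x \<in> T \<Longrightarrow> \<bar>x \<bullet> v - s\<bar> \<le> h / 2"
    and cap: "\<And>x. x \<in> T \<Longrightarrow> x \<bullet> v \<le> a + u"
    and dim: "DIM('a) \<ge> 2"
  shows "emeasure lborel T \<le> ennreal (2 * real DIM('a) * 4 ^ (DIM('a) - 1)
           / unit_ball_vol (real (DIM('a) - 1)) * h * m)"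
proof -
  define n where "n = DIM('a) - 1"
  have n: "n \<ge> 1" using dim by (simp add: n_def)
  define \<omega> where "\<omega> = unit_ball_vol (real n)"
  have \<omega>: "\<omega> > 0" unfolding \<omega>_def by simp
  \<comment> \<open>The factor \<open>4 ^ n / \<omega>\<close> converts the cross-section
    \<open>(2 * diameter) ^ n\<close> of a cylinder into the cost
    \<open>\<omega> * (diameter / 2) ^ n\<close> of the covering set.\<close>
  define c where "c = 2 * real DIM('a) * 4 ^ n / \<omega> * h"
  have c0: "0 \<le> c" using \<omega> \<open>0 \<le> h\<close> by (simp add: c_def)
  define A where "A = {x \<in> frontier K. a \<le> x \<bullet> v \<and> x \<bullet> v \<le> a + u}"
  obtain b0 :: 'a where b0: "b0 \<in> Basis" "1 / real DIM('a) \<le> \<bar>v \<bullet> b0\<bar>"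
    using exists_large_coordinate[OF v] by blast
  \<comment> \<open>The slack \<open>\<eta>\<close> is there because the infimum in the Hausdorff
    content need not be attained.\<close>
  have main: "emeasure lborel T \<le> ennreal (c * (m + \<eta>))" if \<eta>: "\<eta> > 0" for \<eta>
  proof -
    have "hausdorff_content n 1 A \<le> hausdorff_measure n A"
      unfolding hausdorff_measure_def by (intro SUP_upper) auto
    also have "\<dots> \<le> ennreal m" using m(1) by (simp add: surface_measure_def A_def n_def)
    also have "\<dots> < ennreal (m + \<eta>)" using \<eta> m(2) by (simp add: ennreal_lessI)
    finally obtain U where U: "A \<subseteq> (\<Union>i. U i)" "\<And>i. bounded (U i)"
      "(\<Sum>i. ennreal (if U i = {} then 0 else \<omega> * (diameter (U i) / 2) ^ n)) < ennreal (m + \<eta>)"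
      unfolding hausdorff_content_def \<omega>_def by (auto simp: INF_less_iff)
    define p where "p i = (SOME x. x \<in> U i)" for i :: nat
    \<comment> \<open>An empty covering set costs nothing, so its cylinder is empty as well; this
      also makes the arbitrary value of \<open>p i\<close> harmless in that case.\<close>
    define Z where "Z i = (if U i = {} then {} else {x\<in>K. \<bar>x \<bullet> v - s\<bar> \<le> h / 2 \<and>
        (\<forall>b\<in>Basis - {b0}. \<bar>(x - p i) \<bullet> b\<bar> \<le> diameter (U i))})" for i
    have clZ: "closed (Z i)" for i
    proof -
      have eq: "{x\<in>K. \<bar>x \<bullet> v - s\<bar> \<le> h / 2 \<and>
        (\<forall>b\<in>Basis - {b0}. \<bar>(x - p i) \<bullet> b\<bar> \<le> diameter (U i))} =
        K \<inter> {x. \<bar>x \<bullet> v - s\<bar> \<le> h / 2} \<inter>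
         (\<Inter>b\<in>Basis - {b0}. {x. \<bar>(x - p i) \<bullet> b\<bar> \<le> diameter (U i)})" by auto
      show ?thesis unfolding Z_def eq using compact_imp_closed[OF K]
        by (auto intro!: closed_Int closed_INT closed_Collect_le continuous_intros)
    qed
    have eZ: "emeasure lborel (Z i) \<le> ennreal c *
        ennreal (if U i = {} then 0 else \<omega> * (diameter (U i) / 2) ^ n)" for i
    proof (cases "U i = {}")
      case True then show ?thesis by (simp add: Z_def)
    next
      case False
      have D0: "0 \<le> diameter (U i)" using U(2) by (rule diameter_ge_0)
      have "emeasure lborel (Z i) \<le> ennreal (2 * real DIM('a) * h * (2 * diameter (U i)) ^ (DIM('a) - 1))"
      proof (rule emeasure_slab_cylinder_le[OF b0, where s = s and z = "p i"])
        show "Z i \<in> sets borel" using clZ by simp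
        show "bounded (Z i)"
          using compact_imp_bounded[OF K] by (rule bounded_subset) (auto simp: Z_def)
      qed (use D0 \<open>0 \<le> h\<close> False in \<open>auto simp: Z_def\<close>)
      also have "2 * real DIM('a) * h * (2 * diameter (U i)) ^ (DIM('a) - 1)
          = c * (\<omega> * (diameter (U i) / 2) ^ n)"
      proof -
        have "(2 * diameter (U i)) ^ n = (4 * (diameter (U i) / 2)) ^ n" by simp
        also have "\<dots> = 4 ^ n * (diameter (U i) / 2) ^ n" by (rule power_mult_distrib)
        finally show ?thesis unfolding c_def n_def[symmetric] using \<omega> by simp
      qed
      finally show ?thesis using False c0 by (simp add: ennreal_mult')
    qed
    have "T \<subseteq> (\<Union>i. Z i)"
    proof
      fix x assume x: "x \<in> T"
      have nz: "v \<bullet> b0 \<noteq> 0" using b0(2) DIM_positive[where 'a='a] by (auto simp: field_simps)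
      \<comment> \<open>With this sign, moving by \<open>\<tau>\<close> lowers the height by
        \<open>\<tau> * (v \<bullet> b0)^2\<close>, so the exit point stays in the cap; being
        parallel to \<open>b0\<close>, the move keeps all other coordinates.\<close>
      define w where "w = - (v \<bullet> b0) *\<^sub>R b0"
      have "w \<noteq> 0" using nz b0(1) by (auto simp: w_def)
      with exit_point_in_frontier[OF K, of x w] x T obtain \<tau> where
        \<tau>: "0 \<le> \<tau>" "x + \<tau> *\<^sub>R w \<in> frontier K" by blast
      define y where "y = x + \<tau> *\<^sub>R w"
      have yK: "y \<in> K" using \<tau>(2) frontier_subset_closed[OF compact_imp_closed[OF K]]
        by (auto simp: y_def)
      have "y \<bullet> v = x \<bullet> v - \<tau> * (v \<bullet> b0)\<^sup>2"
        by (simp add: y_def w_def inner_diff_left inner_commute[of b0] power2_eq_square)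
      then have "y \<bullet> v \<le> x \<bullet> v" using \<tau>(1) by simp
      with cap[OF x] low[OF yK] have "y \<in> A" using \<tau>(2) by (simp add: A_def y_def)
      then obtain i where i: "y \<in> U i" using U(1) by blast
      then have "p i \<in> U i" unfolding p_def by (rule someI)
      with i U(2) have dia: "dist y (p i) \<le> diameter (U i)" by (intro diameter_bounded_bound) auto
      have "\<bar>(x - p i) \<bullet> b\<bar> \<le> diameter (U i)" if b: "b \<in> Basis" "b \<noteq> b0" for b
      proof -
        have "(x - p i) \<bullet> b = (y - p i) \<bullet> b"
          using b b0(1) by (simp add: y_def w_def inner_add_left inner_diff_left inner_not_same_Basis)
        also have "\<bar>\<dots>\<bar> \<le> norm (y - p i)" using b(1) by (rule Basis_le_norm)
        finally show ?thesis using dia by (simp add: dist_norm)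
      qed
      then have "x \<in> Z i" using i x T slab by (auto simp: Z_def)
      then show "x \<in> (\<Union>i. Z i)" by blast
    qed
    then have "emeasure lborel T \<le> emeasure lborel (\<Union>i. Z i)"
      using clZ by (intro emeasure_mono) auto
    also have "\<dots> \<le> (\<Sum>i. emeasure lborel (Z i))"
      using clZ by (intro emeasure_subadditive_countably) auto
    also have "\<dots> \<le> (\<Sum>i. ennreal c * ennreal (if U i = {} then 0 else \<omega> * (diameter (U i) / 2) ^ n))"
      by (intro suminf_le eZ) auto
    also have "\<dots> = ennreal c * (\<Sum>i. ennreal (if U i = {} then 0 else \<omega> * (diameter (U i) / 2) ^ n))"
      by (rule ennreal_suminf_cmult)
    also have "\<dots> \<le> ennreal c * ennreal (m + \<eta>)"
      using U(3) by (intro mult_left_mono) auto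
    finally show ?thesis using c0 by (simp add: ennreal_mult')
  qed
  have "emeasure lborel T \<le> ennreal (c * m)"
  proof (rule ennreal_le_epsilon)
    fix e :: real assume e: "0 < e"
    \<comment> \<open>The divisor is \<open>c + 1\<close> because \<open>c\<close> vanishes when
      \<open>h = 0\<close>.\<close>
    have "emeasure lborel T \<le> ennreal (c * (m + e / (c + 1)))"
      using main c0 e by simp
    also have "\<dots> \<le> ennreal (c * m + e)"
      using c0 e by (intro ennreal_leI) (simp add: field_simps)
    also have "\<dots> = ennreal (c * m) + ennreal e"
      using c0 m(2) e by (intro ennreal_plus) auto
    finally show "emeasure lborel T \<le> ennreal (c * m) + ennreal e" .
  qed
  then show ?thesis by (simp add: c_def n_def \<omega>_def)
qed

subsection \<open>Second differences of slab volumes\<close>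

text \<open>A substitute for polar coordinates: averaging the ray integrals over a shell.\<close>

lemma shell_average_of_ray_integrals:
  fixes D :: "'a::euclidean_space set"
  assumes D[measurable]: "D \<in> sets borel"
  shows "(\<integral>\<^sup>+x. indicator {x. 1 \<le> norm x \<and> norm x \<le> 2} x *
            (\<integral>\<^sup>+r. indicator {0<..} r * ennreal (r ^ (DIM('a) - 1)) * indicator D (r *\<^sub>R x) \<partial>lborel) \<partial>lborel)
         = ennreal (ln 2) * emeasure lborel D"
proof -
  define d where "d = DIM('a)"
  have d: "d > 0" by (simp add: d_def)
  define E where "E = {x::'a. 1 \<le> norm x \<and> norm x \<le> 2}"
  have E[measurable]: "E \<in> sets borel" unfolding E_def by measurable
  \<comment> \<open>Substituting \<open>y = r x\<close> costs \<open>r powr (- d)\<close>, which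
    turns \<open>r ^ (d - 1)\<close> into the scale-invariant density \<open>1 / r\<close>.\<close>
  have scale: "indicator {0<..} r * ennreal (r ^ (d - 1)) * (\<integral>\<^sup>+x. indicator E x * indicator D (r *\<^sub>R x) \<partial>lborel)
      = (\<integral>\<^sup>+y. indicator {0<..} r * ennreal (1 / r) * indicator E ((1 / r) *\<^sub>R y) * indicator D y \<partial>lborel)" for r :: real
  proof (cases "r > 0")
    case True
    have "(\<integral>\<^sup>+x. indicator E x * indicator D (r *\<^sub>R x) \<partial>lborel)
       = (\<integral>\<^sup>+x. indicator E x * indicator D (r *\<^sub>R x)
            \<partial>(density (distr lborel borel (\<lambda>x. 0 + (1 / r) *\<^sub>R x)) (\<lambda>_. ennreal (\<bar>1 / r\<bar> ^ d))))"
      unfolding d_def using True by (subst lborel_affine[of "1 / r" 0]) auto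
    also have "\<dots> = ennreal (\<bar>1 / r\<bar> ^ d) *
        (\<integral>\<^sup>+y. indicator E ((1 / r) *\<^sub>R y) * indicator D y \<partial>lborel)"
      using True by (simp add: nn_integral_density nn_integral_distr nn_integral_cmult)
    finally have "ennreal (r ^ (d - 1)) * (\<integral>\<^sup>+x. indicator E x * indicator D (r *\<^sub>R x) \<partial>lborel)
        = ennreal (r ^ (d - 1) * (1 / r) ^ d) * (\<integral>\<^sup>+y. indicator E ((1 / r) *\<^sub>R y) * indicator D y \<partial>lborel)"
      using True by (simp add: ennreal_mult mult.assoc)
    also have "r ^ (d - 1) * (1 / r) ^ d = 1 / r"
      using True d by (cases d) (auto simp: field_simps)
    finally show ?thesis using True
      by (simp add: nn_integral_cmult mult.assoc)
  qed simp
  \<comment> \<open>For fixed \<open>y\<close> the admissible \<open>r\<close> run from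
    \<open>norm y / 2\<close> to \<open>norm y\<close>. The mass \<open>ln 2\<close> is the same for
    all \<open>y\<close>, so integrating over \<open>y\<close> returns the volume of
    \<open>D\<close>.\<close>
  have ray: "(\<integral>\<^sup>+r. indicator {0<..} r * ennreal (1 / r) * indicator E ((1 / r) *\<^sub>R y) \<partial>lborel) = ennreal (ln 2)"
    if "y \<noteq> 0" for y
  proof -
    have "(\<integral>\<^sup>+r. indicator {0<..} r * ennreal (1 / r) * indicator E ((1 / r) *\<^sub>R y) \<partial>lborel)
        = (\<integral>\<^sup>+r. ennreal (1 / r) * indicator {norm y / 2 .. norm y} r \<partial>lborel)"
    proof (intro nn_integral_cong)
      fix r :: real
      have "norm y / 2 \<le> r \<Longrightarrow> r > 0" using that by (smt (verit) half_gt_zero zero_less_norm_iff)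
      then show "indicator {0<..} r * ennreal (1 / r) * indicator E ((1 / r) *\<^sub>R y)
         = ennreal (1 / r) * indicator {norm y / 2 .. norm y} r"
        by (auto simp: indicator_def E_def field_simps)
    qed
    also have "\<dots> = ennreal (ln (norm y) - ln (norm y / 2))"
    proof (rule nn_integral_FTC_Icc)
      fix x assume "x \<in> {norm y / 2..norm y}"
      then have x: "norm y / 2 \<le> x" "x \<le> norm y" by auto
      then have "x > 0" using that by (smt (verit) half_gt_zero zero_less_norm_iff)
      then show "DERIV ln x :> 1 / x" "0 \<le> 1 / x"
        by (auto intro!: derivative_eq_intros)
    qed auto
    also have "ln (norm y) - ln (norm y / 2) = ln 2" using that by (simp add: ln_div)
    finally show ?thesis .
  qed
  have "(\<integral>\<^sup>+x. indicator E x *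
            (\<integral>\<^sup>+r. indicator {0<..} r * ennreal (r ^ (d - 1)) * indicator D (r *\<^sub>R x) \<partial>lborel) \<partial>lborel)
      = (\<integral>\<^sup>+x. (\<integral>\<^sup>+r. indicator {0<..} r * ennreal (r ^ (d - 1)) * (indicator E x * indicator D (r *\<^sub>R x)) \<partial>lborel) \<partial>lborel)"
    by (subst nn_integral_cmult[symmetric]) (auto intro!: nn_integral_cong simp: ac_simps)
  also have "\<dots> = (\<integral>\<^sup>+r. (\<integral>\<^sup>+x. indicator {0<..} r * ennreal (r ^ (d - 1)) * (indicator E x * indicator D (r *\<^sub>R x)) \<partial>lborel) \<partial>lborel)"
    by (subst lborel_pair.Fubini') (auto simp: split_beta')
  also have "\<dots> = (\<integral>\<^sup>+r. indicator {0<..} r * ennreal (r ^ (d - 1)) * (\<integral>\<^sup>+x. (indicator E x * indicator D (r *\<^sub>R x)) \<partial>lborel) \<partial>lborel)"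
    by (intro nn_integral_cong nn_integral_cmult) auto
  also have "\<dots> = (\<integral>\<^sup>+r. (\<integral>\<^sup>+y. indicator {0<..} r * ennreal (1 / r) * indicator E ((1 / r) *\<^sub>R y) * indicator D y \<partial>lborel) \<partial>lborel)"
    unfolding scale ..
  also have "\<dots> = (\<integral>\<^sup>+y. (\<integral>\<^sup>+r. indicator {0<..} r * ennreal (1 / r) * indicator E ((1 / r) *\<^sub>R y) * indicator D y \<partial>lborel) \<partial>lborel)"
    by (subst lborel_pair.Fubini') (auto simp: split_beta')
  also have "\<dots> = (\<integral>\<^sup>+y. (\<integral>\<^sup>+r. indicator {0<..} r * ennreal (1 / r) * indicator E ((1 / r) *\<^sub>R y) \<partial>lborel) * indicator D y \<partial>lborel)"
    by (intro nn_integral_cong nn_integral_multc) auto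
  also have "\<dots> = (\<integral>\<^sup>+y. ennreal (ln 2) * indicator D y \<partial>lborel)"
    using AE_lborel_singleton[of "0::'a"]
    by (intro nn_integral_cong_AE) (auto elim!: eventually_mono simp: ray)
  also have "\<dots> = ennreal (ln 2) * emeasure lborel D"
    by (intro nn_integral_cmult_indicator) auto
  finally show ?thesis by (simp add: E_def d_def)
qed

text \<open>Compactness makes the largest admissible \<open>r\<close> attained, and convexity
  together with \<open>0 \<in> D\<close> fills in everything below it. The number
  \<open>\<rho>\<close> is the radial function of \<open>D\<close> in direction
  \<open>x\<close>.\<close>

lemma ray_section_convex:
  fixes D :: "'a::real_normed_vector set"
  assumes D: "compact D" "convex D" "0 \<in> D" and x: "x \<noteq> 0"
  obtains \<rho> where "0 \<le> \<rho>" "\<And>r. 0 \<le> r \<Longrightarrow> r *\<^sub>R x \<in> D \<longleftrightarrow> r \<le> \<rho>"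
proof -
  define J where "J = {r. 0 \<le> r \<and> r *\<^sub>R x \<in> D}"
  have "J = {0..} \<inter> (\<lambda>r. r *\<^sub>R x) -` D" by (auto simp: J_def)
  then have "closed J" using compact_imp_closed[OF D(1)]
    by (auto intro!: closed_Int closed_vimage continuous_intros)
  moreover have "bounded J"
  proof -
    obtain B where B: "\<And>y. y \<in> D \<Longrightarrow> norm y \<le> B"
      using compact_imp_bounded[OF D(1)] unfolding bounded_iff by auto
    have "norm r \<le> B / norm x" if "r \<in> J" for r
    proof -
      have "norm (r *\<^sub>R x) \<le> B" using B that by (simp only: J_def mem_Collect_eq)
      then show ?thesis using x by (simp add: field_simps)
    qed
    then show ?thesis unfolding bounded_iff by blast
  qed
  moreover have "0 \<in> J" using D(3) by (simp add: J_def)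
  ultimately obtain \<rho> where \<rho>: "\<rho> \<in> J" "\<And>t. t \<in> J \<Longrightarrow> t \<le> \<rho>"
    using compact_attains_sup[of J] compact_eq_bounded_closed[of J] by blast
  have "r *\<^sub>R x \<in> D" if r: "0 \<le> r" "r \<le> \<rho>" for r
  proof (cases "\<rho> = 0")
    case True then show ?thesis using r D(3) by simp
  next
    case False
    then have "\<rho> > 0" using \<rho>(1) by (simp add: J_def)
    have "(r / \<rho>) *\<^sub>R (\<rho> *\<^sub>R x) + (1 - r / \<rho>) *\<^sub>R 0 \<in> D"
      using r \<open>\<rho> > 0\<close> \<rho>(1) D by (intro convexD[OF D(2)]) (auto simp: J_def)
    then show ?thesis using \<open>\<rho> > 0\<close> by simp
  qed
  moreover have "r \<le> \<rho>" if "0 \<le> r" "r *\<^sub>R x \<in> D" for r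
    using that \<rho>(2)[of r] by (simp add: J_def)
  moreover have "0 \<le> \<rho>" using \<rho>(1) by (simp add: J_def)
  ultimately show thesis using that[of \<rho>] by blast
qed

lemma ray_integral_power:
  fixes D :: "'a::euclidean_space set"
  assumes "DIM('a) \<ge> 2" and "0 \<le> \<rho>" and "\<And>r. 0 \<le> r \<Longrightarrow> r *\<^sub>R x \<in> D \<longleftrightarrow> r \<le> \<rho>"
  shows "(\<integral>\<^sup>+r. indicator {0<..} r * ennreal (r ^ (DIM('a) - 1)) * indicator D (r *\<^sub>R x) \<partial>lborel)
       = ennreal (\<rho> ^ DIM('a) / DIM('a))"
proof -
  define d where "d = DIM('a)"
  have d: "d \<ge> 2" using assms by (simp add: d_def)
  have "(\<integral>\<^sup>+r. indicator {0<..} r * ennreal (r ^ (d - 1)) * indicator D (r *\<^sub>R x) \<partial>lborel)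
      = (\<integral>\<^sup>+r. ennreal (r ^ (d - 1)) * indicator {0..\<rho>} r \<partial>lborel)"
  proof (intro nn_integral_cong)
    fix r :: real
    show "indicator {0<..} r * ennreal (r ^ (d - 1)) * indicator D (r *\<^sub>R x)
       = ennreal (r ^ (d - 1)) * indicator {0..\<rho>} r"
      using d assms(3)[of r] by (cases "r = 0") (auto simp: indicator_def)
  qed
  also have "\<dots> = ennreal (\<rho> ^ d / d - 0 ^ d / d)"
  proof (rule nn_integral_FTC_Icc)
    fix r :: real assume "r \<in> {0..\<rho>}"
    show "DERIV (\<lambda>r. r ^ d / d) r :> r ^ (d - 1)"
      using d by (auto intro!: derivative_eq_intros)
  qed (use assms in auto)
  finally show ?thesis using d unfolding d_def by (simp add: power_0_left)
qed

text \<open>Let \<open>y \<le> x\<close>, \<open>X = x powr (d/2)\<close> and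
  \<open>Y = y powr (d/2)\<close>. Then \<open>x ^ d + y ^ d = (X - Y)^2 + 2 * X * Y\<close>. The
  geometric mean bounds \<open>X * Y\<close> by \<open>z ^ d\<close>, and Bernoulli's inequality
  gives \<open>X - Y \<le> d * \<kappa> * X\<close>, so the loss is quadratic in \<kappa>.\<close>

lemma power_sum_le_midpoint:
  fixes x y z \<kappa> :: real
  assumes nn: "0 \<le> x" "0 \<le> y" and z: "(x + y) / 2 \<le> z"
    and l: "0 \<le> \<kappa>" "\<kappa> \<le> 1" and xy: "(1 - \<kappa>) * x \<le> y" "(1 - \<kappa>) * y \<le> x"
  shows "x ^ d + y ^ d \<le> 2 * z ^ d + (real d)\<^sup>2 * \<kappa>\<^sup>2 * (x ^ d + y ^ d)"
proof -
  have key: "x ^ d + y ^ d \<le> 2 * z ^ d + (real d)\<^sup>2 * \<kappa>\<^sup>2 * (x ^ d + y ^ d)"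
    if nn: "0 \<le> y" "y \<le> x" and xy: "(1 - \<kappa>) * x \<le> y" and z: "(x + y) / 2 \<le> z" for x y :: real
  proof -
    define X Y where "X = sqrt (x ^ d)" and "Y = sqrt (y ^ d)"
    have X: "X \<ge> 0" "X\<^sup>2 = x ^ d" and Y: "Y \<ge> 0" "Y\<^sup>2 = y ^ d" using nn by (auto simp: X_def Y_def)
    have YX: "Y \<le> X" unfolding X_def Y_def using nn by (intro real_sqrt_le_mono power_mono)
    have "X * Y \<le> z ^ d"
    proof -
      have "X * Y = sqrt (x * y) ^ d" unfolding X_def Y_def real_sqrt_mult real_sqrt_power power_mult_distrib ..
      also have "sqrt (x * y) \<le> z" using arith_geo_mean_sqrt[of x y] nn z by simp
      then have "sqrt (x * y) ^ d \<le> z ^ d" using nn by (intro power_mono) auto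
      finally show ?thesis .
    qed
    moreover have "(X - Y)\<^sup>2 \<le> (real d * \<kappa> * X)\<^sup>2"
    proof -
      have "(1 - real d * \<kappa>) * x ^ d \<le> (1 - \<kappa>) ^ d * x ^ d"
        using Bernoulli_inequality[of "- \<kappa>" d] l nn by (intro mult_right_mono) auto
      also have "\<dots> = ((1 - \<kappa>) * x) ^ d" by (simp only: power_mult_distrib)
      also have "\<dots> \<le> y ^ d" using nn l by (intro power_mono xy) auto
      finally have "X\<^sup>2 - Y\<^sup>2 \<le> real d * \<kappa> * X\<^sup>2" using X Y by (simp add: algebra_simps)
      moreover have "(X - Y) * X \<le> X\<^sup>2 - Y\<^sup>2"
        using X Y YX mult_left_mono[OF YX Y(1)] by (simp add: power2_eq_square algebra_simps)
      ultimately have le: "(X - Y) * X \<le> (real d * \<kappa> * X) * X" by (simp add: power2_eq_square)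
      have "X - Y \<le> real d * \<kappa> * X"
      proof (cases "X = 0")
        case False
        with X(1) have "0 < X" by simp
        then show ?thesis by (rule mult_right_le_imp_le[OF le])
      qed (use Y YX in simp)
      then show ?thesis using YX by (intro power_mono) auto
    qed
    moreover have "x ^ d + y ^ d = (X - Y)\<^sup>2 + 2 * (X * Y)"
      unfolding power2_diff X(2) Y(2) by simp
    moreover have "(real d * \<kappa> * X)\<^sup>2 = (real d)\<^sup>2 * \<kappa>\<^sup>2 * x ^ d" unfolding power_mult_distrib X(2) ..
    moreover have "(real d)\<^sup>2 * \<kappa>\<^sup>2 * x ^ d \<le> (real d)\<^sup>2 * \<kappa>\<^sup>2 * (x ^ d + y ^ d)"
      using nn by (intro mult_left_mono) auto
    ultimately show ?thesis by linarith
  qed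
  show ?thesis
  proof (cases "y \<le> x")
    case True
    then show ?thesis using key[of y x] assms by blast
  next
    case False
    then have "y ^ d + x ^ d \<le> 2 * z ^ d + (real d)\<^sup>2 * \<kappa>\<^sup>2 * (y ^ d + x ^ d)"
      using assms by (intro key) auto
    then show ?thesis by (simp only: add.commute)
  qed
qed

text \<open>A perturbative Brunn--Minkowski inequality: two nearby sections lose only to second order.\<close>

lemma measure_midpoint_ge:
  fixes A B M :: "'a::euclidean_space set"
  assumes dim: "DIM('a) \<ge> 2"
    and A: "compact A" "convex A" "0 \<in> A" and B: "compact B" "convex B" "0 \<in> B"
    and M: "compact M" "convex M" "0 \<in> M"
    and l: "0 \<le> \<kappa>" "\<kappa> \<le> 1"
    and mid: "\<And>x r1 r2. 0 \<le> r1 \<Longrightarrow> 0 \<le> r2 \<Longrightarrow> r1 *\<^sub>R x \<in> A \<Longrightarrow> r2 *\<^sub>R x \<in> B \<Longrightarrow> ((r1 + r2) / 2) *\<^sub>R x \<in> M"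
    and AB: "\<And>x. x \<in> A \<Longrightarrow> (1 - \<kappa>) *\<^sub>R x \<in> B" and BA: "\<And>x. x \<in> B \<Longrightarrow> (1 - \<kappa>) *\<^sub>R x \<in> A"
  shows "measure lebesgue A + measure lebesgue B
     \<le> 2 * measure lebesgue M + (real DIM('a))\<^sup>2 * \<kappa>\<^sup>2 * (measure lebesgue A + measure lebesgue B)"
proof -
  define J where "J D x = (\<integral>\<^sup>+r. indicator {0<..} r * ennreal (r ^ (DIM('a) - 1)) * indicator D (r *\<^sub>R x) \<partial>lborel)"
    for D :: "'a set" and x
  define E where "E = {x::'a. 1 \<le> norm x \<and> norm x \<le> 2}"
  have E[measurable]: "E \<in> sets borel" unfolding E_def by measurable
  have [measurable]: "A \<in> sets borel" "B \<in> sets borel" "M \<in> sets borel"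
    using A B M by (auto intro: borel_compact)
  have Jm[measurable]: "J D \<in> borel_measurable borel" if [measurable]: "D \<in> sets borel" for D
    unfolding J_def by measurable
  define c where "c = (real DIM('a))\<^sup>2 * \<kappa>\<^sup>2"
  have c0: "0 \<le> c" by (simp add: c_def)
  \<comment> \<open>On a ray the three bodies are intervals \<open>[0, \<rho>]\<close> with ray
    integral \<open>\<rho> ^ d / d\<close>, so the claim becomes the scalar inequality for radial
    functions. The shell keeps \<open>x\<close> away from \<open>0\<close>.\<close>
  have pw: "indicator E x * J A x + indicator E x * J B x
     \<le> 2 * (indicator E x * J M x) + ennreal c * (indicator E x * J A x + indicator E x * J B x)" for x
  proof (cases "x \<in> E")
    case True
    then have x: "x \<noteq> 0" by (auto simp: E_def)
    obtain \<rho>A where a: "0 \<le> \<rho>A" "\<And>r. 0 \<le> r \<Longrightarrow> r *\<^sub>R x \<in> A \<longleftrightarrow> r \<le> \<rho>A" using ray_section_convex[OF A x] by blast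
    obtain \<rho>B where b: "0 \<le> \<rho>B" "\<And>r. 0 \<le> r \<Longrightarrow> r *\<^sub>R x \<in> B \<longleftrightarrow> r \<le> \<rho>B" using ray_section_convex[OF B x] by blast
    obtain \<rho>M where m: "0 \<le> \<rho>M" "\<And>r. 0 \<le> r \<Longrightarrow> r *\<^sub>R x \<in> M \<longleftrightarrow> r \<le> \<rho>M" using ray_section_convex[OF M x] by blast
    have "(\<rho>A + \<rho>B) / 2 \<le> \<rho>M" using mid[of \<rho>A \<rho>B x] a b m(2)[of "(\<rho>A + \<rho>B) / 2"] by simp
    moreover have "(1 - \<kappa>) * \<rho>A \<le> \<rho>B" using AB[of "\<rho>A *\<^sub>R x"] a b(2)[of "(1 - \<kappa>) * \<rho>A"] l by simp
    moreover have "(1 - \<kappa>) * \<rho>B \<le> \<rho>A" using BA[of "\<rho>B *\<^sub>R x"] b a(2)[of "(1 - \<kappa>) * \<rho>B"] l by simp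
    ultimately have "\<rho>A ^ DIM('a) + \<rho>B ^ DIM('a) \<le> 2 * \<rho>M ^ DIM('a) + c * (\<rho>A ^ DIM('a) + \<rho>B ^ DIM('a))"
      unfolding c_def using a(1) b(1) l by (intro power_sum_le_midpoint) auto
    then have "(\<rho>A ^ DIM('a) + \<rho>B ^ DIM('a)) / DIM('a)
      \<le> (2 * \<rho>M ^ DIM('a) + c * (\<rho>A ^ DIM('a) + \<rho>B ^ DIM('a))) / DIM('a)"
      by (intro divide_right_mono) auto
    then have "\<rho>A ^ DIM('a) / DIM('a) + \<rho>B ^ DIM('a) / DIM('a)
      \<le> 2 * (\<rho>M ^ DIM('a) / DIM('a)) + c * (\<rho>A ^ DIM('a) / DIM('a) + \<rho>B ^ DIM('a) / DIM('a))"
      by (simp add: add_divide_distrib distrib_left)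
    moreover define P Q R where "P = \<rho>A ^ DIM('a) / DIM('a)" and "Q = \<rho>B ^ DIM('a) / DIM('a)"
      and "R = \<rho>M ^ DIM('a) / DIM('a)"
    ultimately have le: "P + Q \<le> 2 * R + c * (P + Q)" by simp
    have nn: "0 \<le> P" "0 \<le> Q" "0 \<le> R" using a(1) b(1) m(1) by (auto simp: P_def Q_def R_def)
    have "ennreal P + ennreal Q = ennreal (P + Q)" using nn by simp
    also have "\<dots> \<le> ennreal (2 * R + c * (P + Q))" using le by (rule ennreal_leI)
    also have "\<dots> = 2 * ennreal R + ennreal c * (ennreal P + ennreal Q)"
      using nn c0 by (simp add: ennreal_mult)
    finally have "ennreal P + ennreal Q \<le> 2 * ennreal R + ennreal c * (ennreal P + ennreal Q)" .
    moreover have "J A x = ennreal P"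
      unfolding J_def P_def using dim a by (rule ray_integral_power)
    moreover have "J B x = ennreal Q"
      unfolding J_def Q_def using dim b by (rule ray_integral_power)
    moreover have "J M x = ennreal R"
      unfolding J_def R_def using dim m by (rule ray_integral_power)
    ultimately show ?thesis using True by simp
  qed simp
  have fin: "emeasure lborel D = ennreal (measure lebesgue D)" if "compact D" for D :: "'a set"
  proof -
    have "emeasure lborel D < \<infinity>" using emeasure_bounded_finite[OF compact_imp_bounded[OF that]] .
    then have "emeasure lborel D = ennreal (measure lborel D)"
      by (intro emeasure_eq_ennreal_measure) auto
    moreover have "measure lebesgue D = measure lborel D"
      using that borel_compact by (intro measure_completion) auto
    ultimately show ?thesis by simp
  qed
  have shell: "(\<integral>\<^sup>+x. indicator E x * J D x \<partial>lborel) = ennreal (ln 2 * measure lebesgue D)"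
    if "compact D" for D :: "'a set"
    using shell_average_of_ray_integrals[of D] borel_compact[OF that]
    by (simp add: J_def E_def fin[OF that] ennreal_mult')
  have "(\<integral>\<^sup>+x. indicator E x * J A x + indicator E x * J B x \<partial>lborel)
     \<le> (\<integral>\<^sup>+x. 2 * (indicator E x * J M x) + ennreal c * (indicator E x * J A x + indicator E x * J B x) \<partial>lborel)"
    by (intro nn_integral_mono pw)
  then have "ennreal (ln 2 * measure lebesgue A) + ennreal (ln 2 * measure lebesgue B)
     \<le> 2 * ennreal (ln 2 * measure lebesgue M) +
        ennreal c * (ennreal (ln 2 * measure lebesgue A) + ennreal (ln 2 * measure lebesgue B))"
    by (simp add: nn_integral_add nn_integral_cmult shell A B M)
  moreover define P Q R where "P = ln 2 * measure lebesgue A" and "Q = ln 2 * measure lebesgue B"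
    and "R = ln 2 * measure lebesgue M"
  ultimately have le: "ennreal P + ennreal Q \<le> 2 * ennreal R + ennreal c * (ennreal P + ennreal Q)"
    by simp
  have nn: "0 \<le> P" "0 \<le> Q" "0 \<le> R" by (auto simp: P_def Q_def R_def)
  have "ennreal (P + Q) = ennreal P + ennreal Q" using nn by simp
  also note le
  also have "2 * ennreal R + ennreal c * (ennreal P + ennreal Q) = ennreal (2 * R + c * (P + Q))"
    using nn c0 by (simp add: ennreal_mult)
  finally have "P + Q \<le> 2 * R + c * (P + Q)"
    using nn c0 by (subst (asm) ennreal_le_iff) auto
  then have "ln 2 * (measure lebesgue A + measure lebesgue B)
     \<le> ln 2 * (2 * measure lebesgue M + c * (measure lebesgue A + measure lebesgue B))"
    by (simp add: P_def Q_def R_def algebra_simps)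
  then show ?thesis unfolding c_def by (rule mult_left_le_imp_le) simp
qed

section \<open>Slabs and the second difference of their volumes\<close>

definition slab :: "'a::euclidean_space set \<Rightarrow> 'a \<Rightarrow> real \<Rightarrow> real \<Rightarrow> 'a set" where
  "slab K v h s = {x \<in> K. \<bar>x \<bullet> v - s\<bar> \<le> h / 2}"

lemma compact_slab:
  assumes "compact K"
  shows "compact (slab K v h s)"
proof -
  have "slab K v h s = K \<inter> {x. \<bar>x \<bullet> v - s\<bar> \<le> h / 2}" by (auto simp: slab_def)
  then show ?thesis using assms
    by (auto intro!: compact_Int_closed closed_Collect_le continuous_intros)
qed

lemma convex_slab:
  assumes "convex K"
  shows "convex (slab K v h s)"
proof -
  have "slab K v h s = K \<inter> ({x. v \<bullet> x \<ge> s - h / 2} \<inter> {x. v \<bullet> x \<le> s + h / 2})"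
    by (auto simp: slab_def inner_commute abs_le_iff field_simps) (smt (verit) inner_commute field_sum_of_halves)+
  then show ?thesis using assms
    by (auto intro!: convex_Int convex_halfspace_ge convex_halfspace_le)
qed

text \<open>Recentre the slabs at points of a chord from the lowest point \<open>p\<close> to the highest point
  \<open>q\<close>: contracting towards \<open>p\<close> or \<open>q\<close> then moves one recentred slab into the other.\<close>

lemma slab_second_difference:
  fixes K :: "'a::euclidean_space set"
  assumes dim: "DIM('a) \<ge> 2" and K: "compact K" "convex K"
    and p: "p \<in> K" "p \<bullet> v = a" and q: "q \<in> K" "q \<bullet> v = b"
    and h: "0 < h" and s: "a \<le> s - h" "s + h \<le> b"
    and \<mu>: "\<mu> \<le> s - a" "\<mu> \<le> b - s" "h \<le> \<mu>"
  shows "measure lebesgue (slab K v h (s - h)) + measure lebesgue (slab K v h (s + h))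
     \<le> 2 * measure lebesgue (slab K v h s) + (real DIM('a))\<^sup>2 * (2 * h / (\<mu> + h))\<^sup>2 *
        (measure lebesgue (slab K v h (s - h)) + measure lebesgue (slab K v h (s + h)))"
proof -
  have ab: "a < b" using h s by linarith
  define c where "c \<sigma> = p + ((\<sigma> - a) / (b - a)) *\<^sub>R (q - p)" for \<sigma>
  have cv: "c \<sigma> \<bullet> v = \<sigma>" for \<sigma>
    using ab p q by (simp add: c_def inner_add_left inner_diff_left)
  have caff: "(1 - u) *\<^sub>R c \<sigma> + u *\<^sub>R c \<tau> = c ((1 - u) * \<sigma> + u * \<tau>)" for u \<sigma> \<tau>
    using ab by (simp add: c_def algebra_simps add_divide_distrib diff_divide_distrib)
  have cb: "c b = q" and ca: "c a = p" using ab by (auto simp: c_def)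
  have cK: "c \<sigma> \<in> K" if "a \<le> \<sigma>" "\<sigma> \<le> b" for \<sigma>
  proof -
    define u where "u = (\<sigma> - a) / (b - a)"
    have "0 \<le> u" "u \<le> 1" using that ab by (auto simp: u_def field_simps)
    then have "(1 - u) *\<^sub>R p + u *\<^sub>R q \<in> K" using convexD_alt[OF K(2) p(1) q(1)] by blast
    then show ?thesis by (simp add: c_def u_def algebra_simps)
  qed
  define D where "D \<sigma> = (\<lambda>x. - c \<sigma> + x) ` slab K v h \<sigma>" for \<sigma>
  have memD: "x \<in> D \<sigma> \<longleftrightarrow> c \<sigma> + x \<in> K \<and> \<bar>x \<bullet> v\<bar> \<le> h / 2" for x \<sigma>
  proof -
    have "x \<in> D \<sigma> \<longleftrightarrow> c \<sigma> + x \<in> slab K v h \<sigma>"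
    proof
      assume "c \<sigma> + x \<in> slab K v h \<sigma>"
      then show "x \<in> D \<sigma>" unfolding D_def by (rule image_eqI[rotated]) simp
    qed (auto simp: D_def)
    then show ?thesis by (simp add: slab_def inner_add_left cv)
  qed
  have mD: "measure lebesgue (D \<sigma>) = measure lebesgue (slab K v h \<sigma>)" for \<sigma>
    unfolding D_def by (rule measure_translation)
  have cD: "compact (D \<sigma>)" and vD: "convex (D \<sigma>)" for \<sigma>
    unfolding D_def
    by (rule compact_translation[OF compact_slab[OF K(1)]], rule convex_translation[OF convex_slab[OF K(2)]])
  have zD: "0 \<in> D \<sigma>" if "a \<le> \<sigma>" "\<sigma> \<le> b" for \<sigma>
    using cK[OF that] h by (simp add: memD)
  \<comment> \<open>Contracting towards \<open>q\<close> from height \<open>s - h\<close> to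
    \<open>s + h\<close> has ratio \<open>2 * h / (b - (s - h))\<close>, and towards
    \<open>p\<close> in the opposite direction \<open>2 * h / (s + h - a)\<close>. Both denominators
    are at least \<open>\<mu> + h\<close>, so \<open>\<kappa>\<close> bounds both ratios.\<close>
  define \<kappa> where "\<kappa> = 2 * h / (\<mu> + h)"
  have \<kappa>: "0 \<le> \<kappa>" "\<kappa> \<le> 1" using h \<mu> by (auto simp: \<kappa>_def field_simps)
  \<comment> \<open>The actual ratio \<open>u\<close> may be smaller than the common
    \<open>\<kappa>\<close>; a further contraction towards \<open>0\<close> makes up the
    difference.\<close>
  have shrink: "(1 - \<kappa>) *\<^sub>R x \<in> D \<sigma>" if "(1 - u) *\<^sub>R x \<in> D \<sigma>" "0 \<in> D \<sigma>" "0 \<le> u" "u \<le> \<kappa>" for u x \<sigma>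
  proof (cases "u = 1")
    case True
    then have "\<kappa> = 1" using that \<kappa> by simp
    then show ?thesis using that by simp
  next
    case False
    then have u1: "u < 1" using that \<kappa> by simp
    define w where "w = (1 - \<kappa>) / (1 - u)"
    have w: "0 \<le> w" "w \<le> 1" using u1 \<kappa> that by (auto simp: w_def)
    have "(1 - w) *\<^sub>R 0 + w *\<^sub>R ((1 - u) *\<^sub>R x) \<in> D \<sigma>"
      using convexD_alt[OF vD that(2) that(1) w] .
    moreover have "w * (1 - u) = 1 - \<kappa>" using u1 by (simp add: w_def)
    ultimately show ?thesis by simp
  qed
  \<comment> \<open>A contraction towards a point of the chord maps the line of the chord into
    itself; in recentred coordinates it is therefore multiplication by \<open>1 - u\<close> together
    with a change of height.\<close>
  have move: "(1 - u) *\<^sub>R x \<in> D ((1 - u) * \<sigma> + u * \<tau>)"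
    if "x \<in> D \<sigma>" "c \<tau> \<in> K" "0 \<le> u" "u \<le> 1" for x \<sigma> \<tau> u
  proof -
    have "(1 - u) *\<^sub>R (c \<sigma> + x) + u *\<^sub>R c \<tau> \<in> K"
      using convexD_alt[OF K(2) _ that(2)] that by (simp add: memD)
    then have "c ((1 - u) * \<sigma> + u * \<tau>) + (1 - u) *\<^sub>R x \<in> K"
      unfolding caff[symmetric] by (simp add: scaleR_right_distrib algebra_simps)
    moreover have "\<bar>((1 - u) *\<^sub>R x) \<bullet> v\<bar> \<le> h / 2"
    proof -
      have "(1 - u) * \<bar>x \<bullet> v\<bar> \<le> 1 * \<bar>x \<bullet> v\<bar>" using that by (intro mult_right_mono) auto
      then show ?thesis using that by (simp add: memD abs_mult)
    qed
    ultimately show ?thesis by (simp add: memD)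
  qed
  have z: "0 \<in> D (s - h)" "0 \<in> D s" "0 \<in> D (s + h)" using s h by (auto intro!: zD)
  have "measure lebesgue (D (s - h)) + measure lebesgue (D (s + h))
     \<le> 2 * measure lebesgue (D s) + (real DIM('a))\<^sup>2 * \<kappa>\<^sup>2 *
        (measure lebesgue (D (s - h)) + measure lebesgue (D (s + h)))"
  proof (rule measure_midpoint_ge[OF dim cD vD z(1) cD vD z(3) cD vD z(2) \<kappa>])
    fix x r1 r2 assume r: "0 \<le> r1" "0 \<le> r2" and m: "r1 *\<^sub>R x \<in> D (s - h)" "r2 *\<^sub>R x \<in> D (s + h)"
    have "(1 - 1/2) *\<^sub>R (c (s - h) + r1 *\<^sub>R x) + (1/2) *\<^sub>R (c (s + h) + r2 *\<^sub>R x) \<in> K"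
      using m by (intro convexD_alt[OF K(2)]) (auto simp: memD)
    moreover have "(1 - 1/2) *\<^sub>R c (s - h) + (1/2) *\<^sub>R c (s + h) = c s"
      unfolding caff by (simp add: field_simps)
    ultimately have "c s + ((r1 + r2) / 2) *\<^sub>R x \<in> K"
      by (simp add: scaleR_right_distrib scaleR_left_distrib add_divide_distrib algebra_simps)
    moreover have "\<bar>((r1 + r2) / 2) *\<^sub>R x \<bullet> v\<bar> \<le> h / 2"
    proof -
      have "((r1 + r2) / 2) *\<^sub>R x \<bullet> v = (r1 *\<^sub>R x \<bullet> v + r2 *\<^sub>R x \<bullet> v) / 2"
        by (simp add: field_simps)
      moreover have "\<bar>r1 *\<^sub>R x \<bullet> v\<bar> \<le> h / 2" "\<bar>r2 *\<^sub>R x \<bullet> v\<bar> \<le> h / 2"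
        using m by (simp_all only: memD)
      moreover have "\<bar>(A + B) / 2\<bar> \<le> h / 2" if "\<bar>A\<bar> \<le> h / 2" "\<bar>B\<bar> \<le> h / 2" for A B :: real
        using that abs_triangle_ineq[of A B] by (simp add: field_simps)
      ultimately show ?thesis by presburger
    qed
    ultimately show "((r1 + r2) / 2) *\<^sub>R x \<in> D s" by (simp only: memD)
  next
    fix x assume x: "x \<in> D (s - h)"
    define u where "u = 2 * h / (b - (s - h))"
    have u: "0 \<le> u" "u \<le> \<kappa>"
      using h \<mu> unfolding u_def \<kappa>_def by (auto intro!: divide_left_mono mult_pos_pos)
    have "(1 - u) *\<^sub>R x \<in> D ((1 - u) * (s - h) + u * b)"
      using move[OF x, of b u] u \<kappa> q by (simp add: cb)
    moreover have "(1 - u) * (s - h) + u * b = s + h"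
    proof -
      have "u * (b - (s - h)) = 2 * h" using h s by (simp add: u_def)
      then show ?thesis by (simp add: algebra_simps)
    qed
    ultimately show "(1 - \<kappa>) *\<^sub>R x \<in> D (s + h)" using shrink z(3) u by simp
  next
    fix x assume x: "x \<in> D (s + h)"
    define u where "u = 2 * h / (s + h - a)"
    have u: "0 \<le> u" "u \<le> \<kappa>"
      using h \<mu> unfolding u_def \<kappa>_def by (auto intro!: divide_left_mono mult_pos_pos)
    have "(1 - u) *\<^sub>R x \<in> D ((1 - u) * (s + h) + u * a)"
      using move[OF x, of a u] u \<kappa> p by (simp add: ca)
    moreover have "(1 - u) * (s + h) + u * a = s - h"
    proof -
      have "u * (s + h - a) = 2 * h" using h s by (simp add: u_def)
      then show ?thesis by (simp add: algebra_simps)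
    qed
    ultimately show "(1 - \<kappa>) *\<^sub>R x \<in> D (s - h)" using shrink z(1) u by simp
  qed
  then show ?thesis by (simp only: mD \<kappa>_def)
qed

text \<open>Here \<open>x\<close> is the depth inside a supporting hyperplane in units of
  \<open>h\<close>. Up to depth \<open>1\<close> only the size of the slabs is used; beyond it, the
  size \<open>x powr \<alpha>\<close> is multiplied by the relative second difference
  \<open>x powr (- 2)\<close>. Below \<open>- 2\<close> the slabs at \<open>s - h\<close> and
  \<open>s + h\<close> both miss the body.\<close>

definition cap_profile :: "real \<Rightarrow> real \<Rightarrow> real" where
  "cap_profile \<alpha> x = (if x < -2 then 0 else if x \<le> 1 then 1 else x powr (\<alpha> - 2))"

lemma cap_profile_nonneg: "0 \<le> cap_profile \<alpha> x"
  by (simp add: cap_profile_def)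

text \<open>The tail \<open>x powr (\<alpha> - 2)\<close> is integrable because \<alpha> < 1 and
  contributes \<open>1 / (1 - \<alpha>)\<close>; the plateau has length \<open>3\<close>.\<close>

lemma has_bochner_integral_cap_profile:
  assumes "\<alpha> < 1"
  shows "has_bochner_integral lborel (cap_profile \<alpha>) (3 + 1 / (1 - \<alpha>))"
proof -
  have nn: "(\<integral>\<^sup>+x. ennreal (x powr (\<alpha> - 2) ) * indicator {1 ..} x \<partial>lborel)
      = ennreal (0 - 1 powr (\<alpha> - 1) / (\<alpha> - 1))"
  proof (rule nn_integral_FTC_atLeast[where F = "\<lambda>x. x powr (\<alpha> - 1) / (\<alpha> - 1)"])
    show "((\<lambda>x. x powr (\<alpha> - 1) / (\<alpha> - 1)) \<longlongrightarrow> 0) at_top"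
      using assms by (auto intro!: tendsto_divide_zero tendsto_neg_powr filterlim_ident)
    fix x :: real assume x: "1 \<le> x"
    have "((\<lambda>x. x powr (\<alpha> - 1) / (\<alpha> - 1)) has_real_derivative ((\<alpha> - 1) * x powr (\<alpha> - 1 - 1)) / (\<alpha> - 1)) (at x)"
      using x by (intro DERIV_cdivide has_real_derivative_powr) auto
    then show "((\<lambda>x. x powr (\<alpha> - 1) / (\<alpha> - 1)) has_real_derivative x powr (\<alpha> - 2)) (at x)"
      using assms by simp
  qed auto
  have "has_bochner_integral lborel (\<lambda>x. x powr (\<alpha> - 2) * indicator {1 ..} x) (1 / (1 - \<alpha>))"
  proof (rule has_bochner_integral_nn_integral)
    have "(\<integral>\<^sup>+x. ennreal (x powr (\<alpha> - 2) * indicator {1 ..} x) \<partial>lborel)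
       = (\<integral>\<^sup>+x. ennreal (x powr (\<alpha> - 2) ) * indicator {1 ..} x \<partial>lborel)"
      by (intro nn_integral_cong) (auto simp: indicator_def)
    also have "\<dots> = ennreal (1 / (1 - \<alpha>))" unfolding nn using assms
      by (simp add: field_simps)
    finally show "(\<integral>\<^sup>+x. ennreal (x powr (\<alpha> - 2) * indicator {1 ..} x) \<partial>lborel) = ennreal (1 / (1 - \<alpha>))" .
  qed (use assms in auto)
  moreover have "has_bochner_integral lborel (indicator {-2..<1} :: real \<Rightarrow> real) 3"
    using has_bochner_integral_real_indicator[of "{-2..<1::real}" lborel] by simp
  ultimately have "has_bochner_integral lborel
      (\<lambda>x. indicator {-2..<1} x + x powr (\<alpha> - 2) * indicator {1 ..} x) (3 + 1 / (1 - \<alpha>))"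
    by (intro has_bochner_integral_add)
  also have "(\<lambda>x. indicator {-2..<1} x + x powr (\<alpha> - 2) * indicator {1 ..} x) = cap_profile \<alpha>"
    by (auto simp: cap_profile_def indicator_def fun_eq_iff)
  finally show ?thesis .
qed

text \<open>Near either supporting hyperplane the cap bound alone suffices. In the middle, the
  relative bound \<open>(2 * h / (\<mu> + h))^2 \<le> 4 / y^2\<close> is multiplied by the cap bound
  at depth \<open>\<mu> = h * y\<close> below the nearer hyperplane. The constant \<open>20\<close>
  is this \<open>4\<close> times the \<open>5\<close> from two slabs with constant
  \<open>5/2\<close> each.\<close>

lemma slab_second_difference_le:
  fixes K :: "'a::euclidean_space set"
  assumes dim: "DIM('a) \<ge> 2" and K: "compact K" "convex K"
    and p: "p \<in> K" "p \<bullet> v = a" and q: "q \<in> K" "q \<bullet> v = b"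
    and low: "\<And>x. x \<in> K \<Longrightarrow> a \<le> x \<bullet> v" and high: "\<And>x. x \<in> K \<Longrightarrow> x \<bullet> v \<le> b"
    and h: "0 < h" and \<alpha>: "0 < \<alpha>" "\<alpha> < 1" and G: "0 \<le> G"
    and capL: "\<And>\<sigma> u. 0 < u \<Longrightarrow> \<sigma> + h / 2 \<le> a + u \<Longrightarrow>
       measure lebesgue (slab K v h \<sigma>) \<le> G * h * u powr \<alpha>"
    and capU: "\<And>\<sigma> u. 0 < u \<Longrightarrow> b - u \<le> \<sigma> - h / 2 \<Longrightarrow>
       measure lebesgue (slab K v h \<sigma>) \<le> G * h * u powr \<alpha>"
  defines "W \<equiv> \<lambda>\<sigma>. measure lebesgue (slab K v h \<sigma>)"
  shows "W (s - h) + W (s + h) - 2 * W s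
     \<le> 20 * (real DIM('a))\<^sup>2 * G * h powr (1 + \<alpha>) * (cap_profile \<alpha> ((s - a) / h) + cap_profile \<alpha> ((b - s) / h))"
proof -
  define d where "d = real DIM('a)"
  have d1: "1 \<le> d" using dim by (simp add: d_def)
  define H where "H = G * h powr (1 + \<alpha>)"
  have H0: "0 \<le> H" using G by (simp add: H_def)
  define P where "P = cap_profile \<alpha> ((s - a) / h)"
  define Q where "Q = cap_profile \<alpha> ((b - s) / h)"
  have PQ: "0 \<le> P" "0 \<le> Q" by (auto simp: P_def Q_def cap_profile_nonneg)
  have W0: "0 \<le> W \<sigma>" for \<sigma> by (simp add: W_def)
  have x52: "G * h * (h * y) powr \<alpha> = H * y powr \<alpha>" if "0 \<le> y" for y
    using h that by (simp add: H_def powr_mult powr_add)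
  have p52: "(5/2 * y) powr \<alpha> \<le> 5/2 * y powr \<alpha>" if "0 \<le> y" for y :: real
  proof -
    have "(5/2::real) powr \<alpha> \<le> (5/2) powr 1" using \<alpha> by (intro powr_mono) auto
    then have "(5/2) powr \<alpha> * y powr \<alpha> \<le> 5/2 * y powr \<alpha>" by (intro mult_right_mono) auto
    moreover have "(5/2 * y) powr \<alpha> = (5/2) powr \<alpha> * y powr \<alpha>"
      using powr_mult[of "5/2" y \<alpha>] that by simp
    ultimately show ?thesis by linarith
  qed
  have d2: "1 \<le> d\<^sup>2" using d1 by simp
  have fin: "20 * d\<^sup>2 * (H * R) \<le> 20 * d\<^sup>2 * (H * (P + Q))" if "R \<le> P + Q" for R
    using that H0 d1 by (intro mult_left_mono) auto
  have small: "5 * H \<le> 20 * d\<^sup>2 * (H * 1)"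
  proof -
    have "20 * d\<^sup>2 * (H * 1) = 20 * (d\<^sup>2 * H)" by simp
    then show ?thesis using mult_right_mono[OF d2 H0] H0 by linarith
  qed
  have main: "W (s - h) + W (s + h) - 2 * W s \<le> 20 * d\<^sup>2 * (H * (P + Q))"
  proof -
    consider (out) "s < a - 2 * h \<or> b + 2 * h < s" | (lo) "a - 2 * h \<le> s" "s \<le> a + h"
      | (hi) "b - h \<le> s" "s \<le> b + 2 * h" | (mid) "a + h < s" "s < b - h" by linarith
    then show ?thesis
    proof cases
      case out
      have "slab K v h (s - h) = {} \<and> slab K v h (s + h) = {}"
        using out low high h unfolding slab_def by fastforce
      then have "W (s - h) + W (s + h) - 2 * W s \<le> 0" using W0[of s] by (simp add: W_def)
      also have "\<dots> \<le> 20 * d\<^sup>2 * (H * (P + Q))" using H0 PQ by simp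
      finally show ?thesis .
    next
      case lo
      have "W \<sigma> \<le> G * h * (h * (5/2)) powr \<alpha>" if "\<sigma> \<le> s + h" for \<sigma>
        unfolding W_def using lo h that by (intro capL) auto
      moreover have "G * h * (h * (5/2)) powr \<alpha> = H * (5/2) powr \<alpha>" by (rule x52) simp
      moreover have "H * (5/2) powr \<alpha> \<le> H * (5/2)" using p52[of 1] H0 by (intro mult_left_mono) auto
      ultimately have "W \<sigma> \<le> H * (5/2)" if "\<sigma> \<le> s + h" for \<sigma> using that order_trans by metis
      then have "W (s - h) \<le> H * (5/2)" "W (s + h) \<le> H * (5/2)" using h by auto
      then have "W (s - h) + W (s + h) - 2 * W s \<le> 5 * H" using W0[of s] by linarith
      also note small
      also have "20 * d\<^sup>2 * (H * 1) \<le> 20 * d\<^sup>2 * (H * (P + Q))"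
        using lo h PQ by (intro fin) (simp add: P_def cap_profile_def field_simps)
      finally show ?thesis .
    next
      case hi
      have "W \<sigma> \<le> G * h * (h * (5/2)) powr \<alpha>" if "s - h \<le> \<sigma>" for \<sigma>
        unfolding W_def using hi h that by (intro capU) auto
      moreover have "G * h * (h * (5/2)) powr \<alpha> = H * (5/2) powr \<alpha>" by (rule x52) simp
      moreover have "H * (5/2) powr \<alpha> \<le> H * (5/2)" using p52[of 1] H0 by (intro mult_left_mono) auto
      ultimately have "W \<sigma> \<le> H * (5/2)" if "s - h \<le> \<sigma>" for \<sigma> using that order_trans by metis
      then have "W (s - h) \<le> H * (5/2)" "W (s + h) \<le> H * (5/2)" using h by auto
      then have "W (s - h) + W (s + h) - 2 * W s \<le> 5 * H" using W0[of s] by linarith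
      also note small
      also have "20 * d\<^sup>2 * (H * 1) \<le> 20 * d\<^sup>2 * (H * (P + Q))"
        using hi h PQ by (intro fin) (simp add: Q_def cap_profile_def field_simps)
      finally show ?thesis .
    next
      case mid
      define \<mu> where "\<mu> = min (s - a) (b - s)"
      define y where "y = \<mu> / h"
      have \<mu>: "\<mu> \<le> s - a" "\<mu> \<le> b - s" "h < \<mu>" using mid by (auto simp: \<mu>_def)
      have y: "1 < y" "\<mu> = h * y" using \<mu> h by (auto simp: y_def field_simps)
      \<comment> \<open>The far edge of a slab centred within \<open>h\<close> of \<open>s\<close>
        has depth at most \<open>\<mu> + 3/2 * h\<close>, which is at most
        \<open>5/2 * \<mu>\<close> because \<open>h < \<mu>\<close>.\<close>
      have Wb: "W \<sigma> \<le> H * (5/2 * y powr \<alpha>)" if "\<bar>\<sigma> - s\<bar> \<le> h" for \<sigma>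
      proof -
        have 1: "\<mu> + 3/2 * h \<le> h * (5/2 * y)" using y h \<mu> by simp
        have 2: "\<mu> = s - a \<or> \<mu> = b - s" by (auto simp: \<mu>_def)
        have "W \<sigma> \<le> G * h * (h * (5/2 * y)) powr \<alpha>"
        proof (cases "\<mu> = s - a")
          case True
          then show ?thesis unfolding W_def using y h that 1 by (intro capL) (auto simp: abs_le_iff)
        next
          case False
          then have "b - h * (5/2 * y) \<le> \<sigma> - h / 2" using 1 2 that by linarith
          then show ?thesis unfolding W_def using y h by (intro capU) auto
        qed
        also have "\<dots> = H * (5/2 * y) powr \<alpha>" using y by (intro x52) simp
        also have "\<dots> \<le> H * (5/2 * y powr \<alpha>)" using p52[of y] y H0 by (intro mult_left_mono) auto
        finally show ?thesis .
      qed
      have "W (s - h) + W (s + h) \<le> H * (5 * y powr \<alpha>)"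
        using Wb[of "s - h"] Wb[of "s + h"] h by simp
      moreover have "W (s - h) + W (s + h) - 2 * W s \<le> d\<^sup>2 * (2 * h / (\<mu> + h))\<^sup>2 * (W (s - h) + W (s + h))"
        using slab_second_difference[OF dim K p q h, of s \<mu>] mid \<mu> unfolding W_def d_def by simp
      moreover have "(2 * h / (\<mu> + h))\<^sup>2 \<le> 4 / y\<^sup>2"
      proof -
        have "2 * h / (\<mu> + h) \<le> 2 * h / \<mu>" using \<mu> h by (intro divide_left_mono) auto
        also have "\<dots> = 2 / y" using y h by simp
        finally have "2 * h / (\<mu> + h) \<le> 2 / y" .
        then have "(2 * h / (\<mu> + h))\<^sup>2 \<le> (2 / y)\<^sup>2" using \<mu> h by (intro power_mono) auto
        then show ?thesis by (simp add: power_divide)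
      qed
      ultimately have "W (s - h) + W (s + h) - 2 * W s \<le> d\<^sup>2 * (4 / y\<^sup>2) * (H * (5 * y powr \<alpha>))"
        using W0 H0 by (smt (verit) mult_mono mult_left_mono zero_le_power2 mult_nonneg_nonneg divide_nonneg_nonneg)
      also have "\<dots> = 20 * d\<^sup>2 * (H * (y powr \<alpha> / y\<^sup>2))" by simp
      also have "y powr \<alpha> / y\<^sup>2 = y powr (\<alpha> - 2)" using y by (simp add: powr_diff powr_numeral)
      also have "20 * d\<^sup>2 * (H * (y powr (\<alpha> - 2))) \<le> 20 * d\<^sup>2 * (H * (P + Q))"
      proof (rule fin)
        have "y = (s - a) / h \<or> y = (b - s) / h" by (auto simp: y_def \<mu>_def)
        then have "y powr (\<alpha> - 2) = P \<or> y powr (\<alpha> - 2) = Q"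
          using y(1) by (auto simp: P_def Q_def cap_profile_def)
        then show "y powr (\<alpha> - 2) \<le> P + Q" using PQ by auto
      qed
      finally show ?thesis .
    qed
  qed
  then show ?thesis by (simp add: H_def d_def P_def Q_def mult.assoc)
qed

subsection \<open>Decay of the Fourier transform\<close>

text \<open>For a fixed point of \<open>K\<close> the slabs containing it have centres
  \<open>s\<close> filling a window of length \<open>pi / t\<close>, half a period; integrating the
  cosine over that window returns \<open>2 / t\<close> times its value at the midpoint. Fubini over
  the region \<open>A\<close> then yields the Fourier integral without mention of section
  areas.\<close>

lemma
  fixes K :: "'a::euclidean_space set"
  assumes K: "compact K" and t: "0 < t"
  shows integrable_slab_cos: "integrable lborel (\<lambda>s. measure lebesgue (slab K v (pi / t) s) * cos (t * s + \<psi>))"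
    and integral_slab_cos: "(\<integral>s. measure lebesgue (slab K v (pi / t) s) * cos (t * s + \<psi>) \<partial>lborel)
       = 2 / t * (\<integral>x. indicator K x * cos (t * (x \<bullet> v) + \<psi>) \<partial>lborel)"
    and integrable_slab: "integrable lborel (\<lambda>s. measure lebesgue (slab K v (pi / t) s))"
proof -
  define h where "h = pi / t"
  have h: "0 < h" "t * h = pi" using t by (auto simp: h_def)
  define A where "A = {(s, x). x \<in> K \<and> \<bar>x \<bullet> v - s\<bar> \<le> h / 2}"
  have clK: "closed K" using K compact_imp_closed by auto
  have "A = {z. snd z \<in> K} \<inter> {z. \<bar>snd z \<bullet> v - fst z\<bar> \<le> h / 2}" by (auto simp: A_def)
  moreover have "closed {z :: real \<times> 'a. snd z \<in> K}"
    using closed_vimage[OF clK, of snd] by (simp add: vimage_def continuous_on_snd)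
  ultimately have clA: "closed A"
    by (auto intro!: closed_Int closed_Collect_le continuous_intros)
  obtain B where B: "\<And>x. x \<in> K \<Longrightarrow> norm x \<le> B"
    using compact_imp_bounded[OF K] unfolding bounded_iff by auto
  have "A \<subseteq> {- (B * norm v + h)..B * norm v + h} \<times> K"
  proof
    fix z assume "z \<in> A"
    then obtain s x where z: "z = (s, x)" "x \<in> K" "\<bar>x \<bullet> v - s\<bar> \<le> h / 2" by (auto simp: A_def)
    have "\<bar>x \<bullet> v\<bar> \<le> norm x * norm v" by (rule Cauchy_Schwarz_ineq2)
    also have "\<dots> \<le> B * norm v" using B[OF z(2)] by (intro mult_right_mono) auto
    finally have "\<bar>x \<bullet> v\<bar> \<le> B * norm v" .
    then have "- (B * norm v + h) \<le> s" "s \<le> B * norm v + h" using z(3) h(1) by linarith+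
    then show "z \<in> {- (B * norm v + h)..B * norm v + h} \<times> K" using z by simp
  qed
  moreover have "bounded ({- (B * norm v + h)..B * norm v + h} \<times> K)"
    using compact_imp_bounded[OF K] by (intro bounded_Times) auto
  ultimately have bA: "bounded A" using bounded_subset by blast
  have finA: "emeasure (lborel \<Otimes>\<^sub>M lborel) A < \<infinity>"
    unfolding lborel_prod using emeasure_bounded_finite[OF bA] .
  have mA: "A \<in> sets (lborel \<Otimes>\<^sub>M lborel)"
    unfolding lborel_prod using clA by simp
  have intA: "integrable (lborel \<Otimes>\<^sub>M lborel) (\<lambda>(s, x). indicator A (s, x) * g s)"
    if g[measurable]: "g \<in> borel_measurable borel" and gb: "\<And>s. \<bar>g s\<bar> \<le> 1" for g :: "real \<Rightarrow> real"
  proof -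
    have "integrable (lborel \<Otimes>\<^sub>M lborel) (\<lambda>z. indicator A z *\<^sub>R g (fst z))"
      using gb by (intro integrableI_bounded_set_indicator[OF mA _ finA, where B = 1]) auto
    then show ?thesis by (simp add: split_beta')
  qed
  have inner: "(\<integral>x. indicator A (s, x) * c \<partial>lborel) = measure lebesgue (slab K v h s) * c" for s c :: real
  proof -
    have "measure lebesgue (slab K v h s) = measure lborel (slab K v h s)"
      using compact_slab[OF K] by (intro measure_completion) (auto intro: borel_compact)
    moreover have "(\<lambda>x. indicator A (s, x) * c) = (\<lambda>x. indicator (slab K v h s) x * c)"
      by (auto simp: A_def slab_def indicator_def)
    ultimately show ?thesis by simp
  qed
  have ing: "integrable lborel (\<lambda>s. measure lebesgue (slab K v h s) * g s)"
    if g: "g \<in> borel_measurable borel" and gb: "\<And>s. \<bar>g s\<bar> \<le> 1" for g :: "real \<Rightarrow> real"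
    using lborel_pair.integrable_fst'[OF intA[OF g gb]] by (simp only: prod.case inner)
  show "integrable lborel (\<lambda>s. measure lebesgue (slab K v (pi / t) s) * cos (t * s + \<psi>))"
    using ing[of "\<lambda>s. cos (t * s + \<psi>)"] by (simp add: h_def)
  show "integrable lborel (\<lambda>s. measure lebesgue (slab K v (pi / t) s))"
    using ing[of "\<lambda>s. 1"] by (simp add: h_def)
  have line: "(\<integral>s. indicator A (s, x) * cos (t * s + \<psi>) \<partial>lborel)
      = indicator K x * (2 / t * cos (t * (x \<bullet> v) + \<psi>))" for x
  proof (cases "x \<in> K")
    case True
    define y where "y = x \<bullet> v"
    have "(\<integral>s. indicator A (s, x) * cos (t * s + \<psi>) \<partial>lborel)
        = (\<integral>s. cos (t * s + \<psi>) * indicator {y - h/2..y + h/2} s \<partial>lborel)"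
    proof (intro Bochner_Integration.integral_cong refl)
      fix s
      have "\<bar>y - s\<bar> \<le> h / 2 \<longleftrightarrow> s \<in> {y - h/2..y + h/2}"
        unfolding abs_diff_le_iff atLeastAtMost_iff by linarith
      then show "indicator A (s, x) * cos (t * s + \<psi>) = cos (t * s + \<psi>) * indicator {y - h/2..y + h/2} s"
        using True by (simp add: A_def y_def indicator_def)
    qed
    also have "\<dots> = sin (t * (y + h/2) + \<psi>) / t - sin (t * (y - h/2) + \<psi>) / t"
      using t h by (intro integral_FTC_Icc_real) (auto intro!: derivative_eq_intros continuous_intros)
    also have "sin (t * (y + h/2) + \<psi>) = cos (t * y + \<psi>)"
      using h(2) sin_add[of "t * y + \<psi>" "pi/2"] by (simp add: algebra_simps)
    also have "sin (t * (y - h/2) + \<psi>) = - cos (t * y + \<psi>)"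
      using h(2) sin_diff[of "t * y + \<psi>" "pi/2"] by (simp add: algebra_simps)
    finally show ?thesis using True by (simp add: y_def)
  qed (simp add: A_def)
  have "(\<integral>s. measure lebesgue (slab K v h s) * cos (t * s + \<psi>) \<partial>lborel)
     = (\<integral>s. (\<integral>x. indicator A (s, x) * cos (t * s + \<psi>) \<partial>lborel) \<partial>lborel)"
    by (simp only: inner)
  also have "\<dots> = (\<integral>x. (\<integral>s. indicator A (s, x) * cos (t * s + \<psi>) \<partial>lborel) \<partial>lborel)"
    using intA[of "\<lambda>s. cos (t * s + \<psi>)"] by (intro lborel_pair.Fubini_integral[symmetric]) auto
  also have "\<dots> = (\<integral>x. 2 / t * (indicator K x * cos (t * (x \<bullet> v) + \<psi>)) \<partial>lborel)"
    unfolding line by (intro Bochner_Integration.integral_cong) auto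
  finally show "(\<integral>s. measure lebesgue (slab K v (pi / t) s) * cos (t * s + \<psi>) \<partial>lborel)
       = 2 / t * (\<integral>x. indicator K x * cos (t * (x \<bullet> v) + \<psi>) \<partial>lborel)"
    unfolding h_def by simp
qed

text \<open>The shift by half a period flips the sign of the oscillating factor, and
  \<open>1 - cos \<ge> 0\<close>, so only an upper bound for the second difference of the slab volume is needed.\<close>

lemma integral_cos_convex_le:
  fixes K :: "'a::euclidean_space set"
  assumes dim: "DIM('a) \<ge> 2" and K: "compact K" "convex K"
    and p: "p \<in> K" "p \<bullet> v = a" and q: "q \<in> K" "q \<bullet> v = b"
    and low: "\<And>x. x \<in> K \<Longrightarrow> a \<le> x \<bullet> v" and high: "\<And>x. x \<in> K \<Longrightarrow> x \<bullet> v \<le> b"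
    and t: "0 < t" and \<alpha>: "0 < \<alpha>" "\<alpha> < 1" and G: "0 \<le> G"
    and capL: "\<And>\<sigma> u. 0 < u \<Longrightarrow> \<sigma> + pi / t / 2 \<le> a + u \<Longrightarrow>
       measure lebesgue (slab K v (pi / t) \<sigma>) \<le> G * (pi / t) * u powr \<alpha>"
    and capU: "\<And>\<sigma> u. 0 < u \<Longrightarrow> b - u \<le> \<sigma> - pi / t / 2 \<Longrightarrow>
       measure lebesgue (slab K v (pi / t) \<sigma>) \<le> G * (pi / t) * u powr \<alpha>"
  shows "(\<integral>x. indicator K x * cos (t * (x \<bullet> v) + \<psi>) \<partial>lborel)
     \<le> 10 * pi * (real DIM('a))\<^sup>2 * G * (3 + 1 / (1 - \<alpha>)) * (pi / t) powr (1 + \<alpha>)"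
proof -
  define h where "h = pi / t"
  have h: "0 < h" "t * h = pi" using t by (auto simp: h_def)
  define W where "W = (\<lambda>\<sigma>. measure lebesgue (slab K v h \<sigma>))"
  define H where "H = 20 * (real DIM('a))\<^sup>2 * G * h powr (1 + \<alpha>)"
  have H0: "0 \<le> H" using G by (simp add: H_def)
  define B where "B s = H * (cap_profile \<alpha> ((s - a) / h) + cap_profile \<alpha> ((b - s) / h))" for s
  have B0: "0 \<le> B s" for s using H0 by (simp add: B_def cap_profile_nonneg)
  have second: "W (s - h) + W (s + h) - 2 * W s \<le> B s" for s
    unfolding W_def B_def H_def using capL capU h(1)
    by (intro slab_second_difference_le[OF dim K p q low high _ \<alpha> G]) (auto simp: h_def)
  have hb: "has_bochner_integral lborel B (H * (2 * h * (3 + 1 / (1 - \<alpha>))))"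
  proof -
    have "has_bochner_integral lborel (\<lambda>s. cap_profile \<alpha> (- a / h + (1 / h) * s)) ((3 + 1 / (1 - \<alpha>)) /\<^sub>R \<bar>1 / h\<bar>)"
      using h has_bochner_integral_cap_profile[OF \<alpha>(2)]
      by (subst (asm) lborel_has_bochner_integral_real_affine_iff[of "1 / h" _ _ "- a / h"]) auto
    moreover have "has_bochner_integral lborel (\<lambda>s. cap_profile \<alpha> (b / h + (- 1 / h) * s)) ((3 + 1 / (1 - \<alpha>)) /\<^sub>R \<bar>- 1 / h\<bar>)"
      using h has_bochner_integral_cap_profile[OF \<alpha>(2)]
      by (subst (asm) lborel_has_bochner_integral_real_affine_iff[of "- 1 / h" _ _ "b / h"]) auto
    ultimately have "has_bochner_integral lborel
       (\<lambda>s. H * (cap_profile \<alpha> (- a / h + (1 / h) * s) + cap_profile \<alpha> (b / h + (- 1 / h) * s)))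
       (H * ((3 + 1 / (1 - \<alpha>)) /\<^sub>R \<bar>1 / h\<bar> + (3 + 1 / (1 - \<alpha>)) /\<^sub>R \<bar>- 1 / h\<bar>))"
      by (intro has_bochner_integral_mult_right has_bochner_integral_add)
    moreover have "(\<lambda>s. H * (cap_profile \<alpha> (- a / h + (1 / h) * s) + cap_profile \<alpha> (b / h + (- 1 / h) * s))) = B"
      by (auto simp: B_def fun_eq_iff diff_divide_distrib)
    moreover have "H * ((3 + 1 / (1 - \<alpha>)) /\<^sub>R \<bar>1 / h\<bar> + (3 + 1 / (1 - \<alpha>)) /\<^sub>R \<bar>- 1 / h\<bar>) = H * (2 * h * (3 + 1 / (1 - \<alpha>)))"
      using h by (simp add: algebra_simps)
    ultimately show ?thesis using h(1) by (simp add: mult.assoc)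
  qed
  define I where "I = (\<integral>s. W s * cos (t * s + \<psi>) \<partial>lborel)"
  have iW: "integrable lborel W" using integrable_slab[OF K(1) t] by (simp add: W_def h_def)
  have iWc: "integrable lborel (\<lambda>s. W s * cos (t * s + \<psi>))" for \<psi>
    using integrable_slab_cos[OF K(1) t] by (simp add: W_def h_def)
  have sh: "integrable lborel (\<lambda>s. W (s + e) * (1 - cos (t * s + \<psi>)))"
    "(\<integral>s. W (s + e) * (1 - cos (t * s + \<psi>)) \<partial>lborel)
       = (\<integral>s. W s \<partial>lborel) - (\<integral>s. W s * cos (t * s + (\<psi> - t * e)) \<partial>lborel)" for e
  proof -
    define f where "f s = W s - W s * cos (t * s + (\<psi> - t * e))" for s
    have f: "integrable lborel f" unfolding f_def by (intro Bochner_Integration.integrable_diff iW iWc)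
    have eq: "(\<lambda>s. W (s + e) * (1 - cos (t * s + \<psi>))) = (\<lambda>s. f (e + 1 * s))"
      by (auto simp: f_def fun_eq_iff algebra_simps)
    show "integrable lborel (\<lambda>s. W (s + e) * (1 - cos (t * s + \<psi>)))"
      unfolding eq by (rule lborel_integrable_real_affine[OF f]) simp
    have "(\<integral>s. f (e + 1 * s) \<partial>lborel) = (\<integral>s. f s \<partial>lborel)"
      using lborel_integral_real_affine[of 1 f e] by simp
    also have "\<dots> = (\<integral>s. W s \<partial>lborel) - (\<integral>s. W s * cos (t * s + (\<psi> - t * e)) \<partial>lborel)"
      unfolding f_def by (intro Bochner_Integration.integral_diff iW iWc)
    finally show "(\<integral>s. W (s + e) * (1 - cos (t * s + \<psi>)) \<partial>lborel)
       = (\<integral>s. W s \<partial>lborel) - (\<integral>s. W s * cos (t * s + (\<psi> - t * e)) \<partial>lborel)" unfolding eq .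
  qed
  have flip: "(\<integral>s. W s * cos (t * s + (\<psi> - e)) \<partial>lborel) = - I" if "e = pi \<or> e = - pi" for e
  proof -
    have "cos (t * s + (\<psi> - e)) = - cos (t * s + \<psi>)" for s
    proof -
      have "cos (t * s + (\<psi> - e)) = cos ((t * s + \<psi>) - e)" by (simp add: algebra_simps)
      then show ?thesis using that by (auto simp: cos_diff cos_add)
    qed
    then show ?thesis by (simp add: I_def)
  qed
  have shm: "integrable lborel (\<lambda>s. W (s - h) * (1 - cos (t * s + \<psi>)))"
    "(\<integral>s. W (s - h) * (1 - cos (t * s + \<psi>)) \<partial>lborel) = (\<integral>s. W s \<partial>lborel) + I"
    using sh[of "- h"] flip[of "- pi"] h by simp_all
  have shp: "integrable lborel (\<lambda>s. W (s + h) * (1 - cos (t * s + \<psi>)))"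
    "(\<integral>s. W (s + h) * (1 - cos (t * s + \<psi>)) \<partial>lborel) = (\<integral>s. W s \<partial>lborel) + I"
    using sh[of "h"] flip[of "pi"] h by simp_all
  have sh0: "integrable lborel (\<lambda>s. W s * (1 - cos (t * s + \<psi>)))"
    "(\<integral>s. W s * (1 - cos (t * s + \<psi>)) \<partial>lborel) = (\<integral>s. W s \<partial>lborel) - I"
    using sh[of 0] by (simp_all add: I_def)
  \<comment> \<open>With \<open>J\<close> the integral of \<open>W\<close>, the two shifted
    integrals are \<open>J + I\<close> and the middle one is \<open>J - I\<close>, so the
    combination is \<open>(J + I) + (J + I) - 2 * (J - I) = 4 * I\<close>.\<close>
  have "4 * I = (\<integral>s. W (s - h) * (1 - cos (t * s + \<psi>)) + W (s + h) * (1 - cos (t * s + \<psi>))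
       - 2 * (W s * (1 - cos (t * s + \<psi>))) \<partial>lborel)"
    using shm shp sh0 by simp
  also have "\<dots> \<le> (\<integral>s. 2 * B s \<partial>lborel)"
  proof (rule integral_mono)
    show "integrable lborel (\<lambda>s. W (s - h) * (1 - cos (t * s + \<psi>)) + W (s + h) * (1 - cos (t * s + \<psi>))
       - 2 * (W s * (1 - cos (t * s + \<psi>))))"
      using shm shp sh0 by simp
    show "integrable lborel (\<lambda>s. 2 * B s)" using hb by (simp add: has_bochner_integral_iff)
    fix s :: real
    have c: "0 \<le> 1 - cos (t * s + \<psi>)" "1 - cos (t * s + \<psi>) \<le> 2"
      using cos_le_one[of "t * s + \<psi>"] cos_ge_minus_one[of "t * s + \<psi>"] by linarith+
    have "(W (s - h) + W (s + h) - 2 * W s) * (1 - cos (t * s + \<psi>)) \<le> B s * (1 - cos (t * s + \<psi>))"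
      using second c by (intro mult_right_mono) auto
    also have "\<dots> \<le> B s * 2" using B0 c by (intro mult_left_mono) auto
    finally show "W (s - h) * (1 - cos (t * s + \<psi>)) + W (s + h) * (1 - cos (t * s + \<psi>))
       - 2 * (W s * (1 - cos (t * s + \<psi>))) \<le> 2 * B s"
      by (simp add: algebra_simps)
  qed
  also have "\<dots> = 2 * (H * (2 * h * (3 + 1 / (1 - \<alpha>))))"
    using hb by (simp add: has_bochner_integral_iff)
  finally have "I \<le> H * h * (3 + 1 / (1 - \<alpha>))" by simp
  moreover have "I = 2 / t * (\<integral>x. indicator K x * cos (t * (x \<bullet> v) + \<psi>) \<partial>lborel)"
    unfolding I_def W_def h_def by (rule integral_slab_cos[OF K(1) t])
  ultimately have "(\<integral>x. indicator K x * cos (t * (x \<bullet> v) + \<psi>) \<partial>lborel) \<le> t / 2 * (H * h * (3 + 1 / (1 - \<alpha>)))"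
    using t by (simp add: field_simps)
  also have "\<dots> = (t * h) / 2 * H * (3 + 1 / (1 - \<alpha>))" by simp
  also have "\<dots> = 10 * pi * (real DIM('a))\<^sup>2 * G * (3 + 1 / (1 - \<alpha>)) * h powr (1 + \<alpha>)"
    unfolding h(2) H_def by simp
  finally show ?thesis by (simp add: h_def)
qed

section \<open>Decay uniform over directions, dilates and translates\<close>

lemma measure_lebesgue_le_of_emeasure:
  fixes T :: "'a::euclidean_space set"
  assumes "T \<in> sets borel" "emeasure lborel T \<le> ennreal r" "0 \<le> r"
  shows "measure lebesgue T \<le> r"
proof -
  have "measure lebesgue T = measure lborel T" using assms(1) by (intro measure_completion) auto
  also have "\<dots> \<le> r" unfolding measure_def using assms by (intro enn2real_leI)
  finally show ?thesis .
qed

text \<open>The cap bound at the upper supporting hyperplane is the lower one for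
  \<open>- v\<close>, and a lower bound for the integral is the upper bound with phase
  \<open>\<psi> + pi\<close>. Keeping the phase free makes these real integrals as informative as
  the complex transform.\<close>

lemma fourier_decay_unit:
  fixes K :: "'a::euclidean_space set"
  assumes dim: "DIM('a) \<ge> 2" and K: "compact K" "convex K" "K \<noteq> {}"
    and \<alpha>: "0 < \<alpha>" "\<alpha> < 1" and C: "0 \<le> C"
    and cap: "\<And>v s u. norm v = 1 \<Longrightarrow> 0 < u \<Longrightarrow>
       surface_measure {x \<in> frontier K. s \<le> x \<bullet> v \<and> x \<bullet> v \<le> s + u} \<le> ennreal (C * u powr \<alpha>)"
  obtains C1 where "0 \<le> C1"
    "\<And>v t \<psi>. norm v = 1 \<Longrightarrow> 0 < t \<Longrightarrow>
       \<bar>\<integral>x. indicator K x * cos (t * (x \<bullet> v) + \<psi>) \<partial>lborel\<bar> \<le> C1 * t powr (- 1 - \<alpha>)"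
proof -
  define G where "G = 2 * real DIM('a) * 4 ^ (DIM('a) - 1) / unit_ball_vol (real (DIM('a) - 1)) * C"
  have G: "0 \<le> G" unfolding G_def using C by simp
  have slabL: "measure lebesgue (slab K v h \<sigma>) \<le> G * h * u powr \<alpha>"
    if v: "norm v = 1" and low: "\<And>x. x \<in> K \<Longrightarrow> a \<le> x \<bullet> v"
      and h: "0 < h" and u: "0 < u" "\<sigma> + h / 2 \<le> a + u" for v h \<sigma> u a
  proof (rule measure_lebesgue_le_of_emeasure)
    show "slab K v h \<sigma> \<in> sets borel" using compact_slab[OF K(1)] by (rule borel_compact)
    show "0 \<le> G * h * u powr \<alpha>" using G h by simp
    have "emeasure lborel (slab K v h \<sigma>) \<le> ennreal (2 * real DIM('a) * 4 ^ (DIM('a) - 1)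
           / unit_ball_vol (real (DIM('a) - 1)) * h * (C * u powr \<alpha>))"
    proof (rule slab_volume_le_cap_measure[OF K(1) v low cap[OF v u(1)]])
      show "slab K v h \<sigma> \<in> sets borel" using compact_slab[OF K(1)] by (rule borel_compact)
      fix x assume "x \<in> slab K v h \<sigma>"
      then have x: "\<bar>x \<bullet> v - \<sigma>\<bar> \<le> h / 2" by (simp add: slab_def)
      show "\<bar>x \<bullet> v - \<sigma>\<bar> \<le> h / 2" by (fact x)
      show "x \<bullet> v \<le> a + u" using x u by linarith
    qed (use C h dim in \<open>auto simp: slab_def\<close>)
    then show "emeasure lborel (slab K v h \<sigma>) \<le> ennreal (G * h * u powr \<alpha>)"
      by (simp add: G_def mult_ac)
  qed
  define C0 where "C0 = 10 * pi * (real DIM('a))\<^sup>2 * G * (3 + 1 / (1 - \<alpha>)) * pi powr (1 + \<alpha>)"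
  have bound: "(\<integral>x. indicator K x * cos (t * (x \<bullet> v) + \<psi>) \<partial>lborel) \<le> C0 * t powr (- 1 - \<alpha>)"
    if v: "norm v = 1" and t: "0 < t" for v :: 'a and t \<psi>
  proof -
    have cont: "continuous_on K (\<lambda>x. x \<bullet> v)" by (intro continuous_intros)
    obtain p where p: "p \<in> K" "\<And>x. x \<in> K \<Longrightarrow> p \<bullet> v \<le> x \<bullet> v"
      using continuous_attains_inf[OF K(1) K(3) cont] by blast
    obtain q where q: "q \<in> K" "\<And>x. x \<in> K \<Longrightarrow> x \<bullet> v \<le> q \<bullet> v"
      using continuous_attains_sup[OF K(1) K(3) cont] by blast
    have pt: "0 < pi / t" using t by simp
    have "(\<integral>x. indicator K x * cos (t * (x \<bullet> v) + \<psi>) \<partial>lborel)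
      \<le> 10 * pi * (real DIM('a))\<^sup>2 * G * (3 + 1 / (1 - \<alpha>)) * (pi / t) powr (1 + \<alpha>)"
    proof (rule integral_cos_convex_le[OF dim K(1,2) p(1) refl q(1) refl p(2) q(2) t \<alpha> G])
      fix \<sigma> u :: real assume "0 < u" "\<sigma> + pi / t / 2 \<le> p \<bullet> v + u"
      then show "measure lebesgue (slab K v (pi / t) \<sigma>) \<le> G * (pi / t) * u powr \<alpha>"
        using v p(2) pt by (intro slabL)
    next
      fix \<sigma> u :: real assume u: "0 < u" "q \<bullet> v - u \<le> \<sigma> - pi / t / 2"
      have "measure lebesgue (slab K (- v) (pi / t) (- \<sigma>)) \<le> G * (pi / t) * u powr \<alpha>"
      proof (rule slabL)
        show "norm (- v) = 1" using v by simp
        show "- (q \<bullet> v) \<le> x \<bullet> - v" if "x \<in> K" for x using q(2)[OF that] by simp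
        show "- \<sigma> + pi / t / 2 \<le> - (q \<bullet> v) + u" using u(2) by linarith
      qed (use u pt in auto)
      moreover have "slab K (- v) (pi / t) (- \<sigma>) = slab K v (pi / t) \<sigma>"
        by (auto simp: slab_def abs_minus_commute)
      ultimately show "measure lebesgue (slab K v (pi / t) \<sigma>) \<le> G * (pi / t) * u powr \<alpha>" by simp
    qed
    also have "(pi / t) powr (1 + \<alpha>) = pi powr (1 + \<alpha>) * t powr (- 1 - \<alpha>)"
      using t by (simp add: powr_divide powr_minus_divide[symmetric] powr_diff powr_add powr_minus field_simps)
    finally show ?thesis by (simp add: C0_def mult_ac)
  qed
  have "\<bar>\<integral>x. indicator K x * cos (t * (x \<bullet> v) + \<psi>) \<partial>lborel\<bar> \<le> C0 * t powr (- 1 - \<alpha>)"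
    if v: "norm v = 1" and t: "0 < t" for v :: 'a and t \<psi>
  proof -
    have "(\<integral>x. indicator K x * cos (t * (x \<bullet> v) + (\<psi> + pi)) \<partial>lborel)
       = (\<integral>x. - (indicator K x * cos (t * (x \<bullet> v) + \<psi>)) \<partial>lborel)"
    proof (intro Bochner_Integration.integral_cong refl)
      fix x :: 'a
      have "cos (t * (x \<bullet> v) + (\<psi> + pi)) = - cos (t * (x \<bullet> v) + \<psi>)"
        using cos_periodic_pi[of "t * (x \<bullet> v) + \<psi>"] by (simp add: add.assoc)
      then show "indicator K x * cos (t * (x \<bullet> v) + (\<psi> + pi)) = - (indicator K x * cos (t * (x \<bullet> v) + \<psi>))"
        by simp
    qed
    then have "- (\<integral>x. indicator K x * cos (t * (x \<bullet> v) + \<psi>) \<partial>lborel) \<le> C0 * t powr (- 1 - \<alpha>)"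
      using bound[OF v t, of "\<psi> + pi"] by simp
    then show ?thesis using bound[OF v t, of \<psi>] by linarith
  qed
  moreover have "0 \<le> C0" using G \<alpha> by (simp add: C0_def)
  ultimately show thesis using that by blast
qed

lemma integral_scaled_shifted_cos:
  fixes K :: "'a::euclidean_space set"
  assumes K: "K \<in> sets borel" and k: "0 < k"
  shows "(\<integral>x. indicator ((*\<^sub>R) k ` K) (y + x) * cos (m \<bullet> x + \<psi>) \<partial>lborel)
      = k ^ DIM('a) * (\<integral>x. indicator K x * cos (k * (x \<bullet> m) + (\<psi> - m \<bullet> y)) \<partial>lborel)"
proof -
  have [measurable]: "K \<in> sets borel" by fact
  have mem: "y + x \<in> (*\<^sub>R) k ` K \<longleftrightarrow> (1 / k) *\<^sub>R (y + x) \<in> K" for x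
    using k by (force simp: image_iff intro: exI[of _ "(1 / k) *\<^sub>R (y + x)"])
  define f where "f x = indicator K ((1 / k) *\<^sub>R (y + x)) * cos (m \<bullet> x + \<psi>)" for x
  have [measurable]: "f \<in> borel_measurable borel" unfolding f_def by measurable
  have "(\<integral>x. f x \<partial>lborel)
     = (\<integral>x. f x \<partial>(density (distr lborel borel (\<lambda>x. - y + k *\<^sub>R x)) (\<lambda>_. ennreal (\<bar>k\<bar> ^ DIM('a)))))"
    using k by (subst lborel_affine[of k "- y"]) auto
  also have "\<dots> = k ^ DIM('a) * (\<integral>x. f (- y + k *\<^sub>R x) \<partial>lborel)"
    using k by (subst integral_density) (auto simp: integral_distr)
  also have "(\<lambda>x. f (- y + k *\<^sub>R x)) = (\<lambda>x. indicator K x * cos (k * (x \<bullet> m) + (\<psi> - m \<bullet> y)))"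
    using k by (auto simp: f_def fun_eq_iff inner_add_right inner_diff_right inner_commute algebra_simps)
  finally show ?thesis by (simp add: f_def indicator_def mem)
qed

text \<open>Dilation contributes \<open>k ^ d\<close> and multiplies the frequency by
  \<open>k\<close>; translation by \<open>y\<close> only shifts the phase. As the assumed decay is
  uniform in \<psi>, the bound does not depend on \<open>y\<close>.\<close>

lemma fourier_decay_scaled:
  fixes K :: "'a::euclidean_space set"
  assumes K: "compact K" and k: "0 < k" and m: "m \<noteq> 0"
    and bound: "\<And>v t \<psi>. norm v = 1 \<Longrightarrow> 0 < t \<Longrightarrow>
       \<bar>\<integral>x. indicator K x * cos (t * (x \<bullet> v) + \<psi>) \<partial>lborel\<bar> \<le> C1 * t powr (- 1 - \<alpha>)"
  shows "\<bar>\<integral>x. indicator ((*\<^sub>R) k ` K) (y + x) * cos (m \<bullet> x + \<psi>) \<partial>lborel\<bar>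
      \<le> C1 * k powr (real DIM('a) - 1 - \<alpha>) * norm m powr (- 1 - \<alpha>)"
proof -
  define v where "v = (1 / norm m) *\<^sub>R m"
  have v: "norm v = 1" using m by (simp add: v_def)
  have t: "0 < k * norm m" using k m by simp
  have "k * (x \<bullet> m) = (k * norm m) * (x \<bullet> v)" for x using m by (simp add: v_def)
  then have "\<bar>\<integral>x. indicator K x * cos (k * (x \<bullet> m) + (\<psi> - m \<bullet> y)) \<partial>lborel\<bar> \<le> C1 * (k * norm m) powr (- 1 - \<alpha>)"
    using bound[OF v t] by presburger
  then have "k ^ DIM('a) * \<bar>\<integral>x. indicator K x * cos (k * (x \<bullet> m) + (\<psi> - m \<bullet> y)) \<partial>lborel\<bar>
     \<le> k ^ DIM('a) * (C1 * (k * norm m) powr (- 1 - \<alpha>))"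
    using k by (intro mult_left_mono) auto
  also have "\<dots> = C1 * (k powr DIM('a) * k powr (- 1 - \<alpha>)) * norm m powr (- 1 - \<alpha>)"
    using k by (simp add: powr_mult powr_realpow)
  also have "k powr DIM('a) * k powr (- 1 - \<alpha>) = k powr (real DIM('a) - 1 - \<alpha>)"
    by (simp add: powr_add[symmetric] algebra_simps)
  finally show ?thesis
    using k by (subst integral_scaled_shifted_cos) (auto simp: borel_compact[OF K] abs_mult)
qed

subsection \<open>A concentrated trigonometric kernel\<close>

text \<open>The kernel is the squared modulus of \<open>\<Sum> a\<^sub>j e(j u)\<close>; the weights
  \<open>a\<^sub>j = sin (j \<theta>)\<close>, \<open>\<theta> = pi / (L + 1)\<close>, form the top eigenvector of the path graph, so
  that the first moment \<open>1 - cos \<theta>\<close> is of order \<open>1 / L\<^sup>2\<close>.\<close>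

lemma exists_concentrated_kernel:
  fixes L :: nat
  assumes L: "1 \<le> L"
  obtains c :: "int \<Rightarrow> real" where
    "c 0 = 1" "\<And>l. 0 \<le> c l" "\<And>l. c l \<le> 1" "\<And>l. c (- l) = c l" "c 1 = cos (pi / (real L + 1))"
    "\<And>l. \<bar>l\<bar> \<ge> int L \<Longrightarrow> c l = 0"
    "\<And>u. 0 \<le> (\<Sum>l\<in>{- int L..int L}. c l * cos (2 * pi * of_int l * u))"
proof -
  define \<theta> where "\<theta> = pi / (real L + 1)"
  define a where "a j = sin (of_int j * \<theta>)" for j :: int
  define J where "J = {1..int L}"
  have fin: "finite J" by (simp add: J_def)
  define A where "A = (\<Sum>j\<in>J. (a j)\<^sup>2)"
  have apos: "0 < a j" if "j \<in> J" for j
  proof -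
    have j: "1 \<le> real_of_int j" "real_of_int j < real L + 1" using that by (auto simp: J_def)
    have "real_of_int j * \<theta> < (real L + 1) * \<theta>" using j by (intro mult_strict_right_mono) (auto simp: \<theta>_def)
    also have "(real L + 1) * \<theta> = pi" by (simp add: \<theta>_def add_nonneg_eq_0_iff)
    finally have "real_of_int j * \<theta> < pi" .
    moreover have "0 < real_of_int j * \<theta>" using j by (simp add: \<theta>_def)
    ultimately show ?thesis unfolding a_def by (intro sin_gt_zero)
  qed
  have "0 < (a j)\<^sup>2" if "j \<in> J" for j using apos[OF that] by simp
  moreover have "J \<noteq> {}" using L by (simp add: J_def)
  ultimately have Apos: "0 < A" unfolding A_def by (intro sum_pos fin)
  \<comment> \<open>The coefficient \<open>c l\<close> will be the autocorrelation of the weights at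
    lag \<open>l\<close>, normalised by \<open>A\<close> so that \<open>c 0 = 1\<close>.\<close>
  define P where "P l = {p \<in> J \<times> J. fst p - snd p = l}" for l
  have finP: "finite (P l)" for l unfolding P_def using fin by simp
  define c where "c l = (\<Sum>p\<in>P l. a (fst p) * a (snd p)) / A" for l
  have c0: "c 0 = 1"
  proof -
    have "(\<Sum>p\<in>P 0. a (fst p) * a (snd p)) = (\<Sum>j\<in>J. a j * a j)"
      by (rule sum.reindex_bij_witness[of _ "\<lambda>j. (j, j)" fst]) (auto simp: P_def)
    then show ?thesis using Apos by (simp add: c_def A_def power2_eq_square)
  qed
  have cnn: "0 \<le> c l" for l
    unfolding c_def using Apos apos
    by (intro divide_nonneg_pos sum_nonneg mult_nonneg_nonneg) (auto simp: P_def less_imp_le)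
  have cle: "c l \<le> 1" for l
  proof -
    have "(\<Sum>p\<in>P l. a (fst p) * a (snd p)) \<le> (\<Sum>p\<in>P l. (a (fst p))\<^sup>2 / 2 + (a (snd p))\<^sup>2 / 2)"
    proof (intro sum_mono)
      fix p :: "int \<times> int"
      show "a (fst p) * a (snd p) \<le> (a (fst p))\<^sup>2 / 2 + (a (snd p))\<^sup>2 / 2"
        using sum_squares_bound[of "a (fst p)" "a (snd p)"] by simp
    qed
    also have "\<dots> = (\<Sum>p\<in>P l. (a (fst p))\<^sup>2) / 2 + (\<Sum>p\<in>P l. (a (snd p))\<^sup>2) / 2"
      by (simp add: sum.distrib sum_divide_distrib)
    also have "(\<Sum>p\<in>P l. (a (fst p))\<^sup>2) = (\<Sum>j\<in>fst ` P l. (a j)\<^sup>2)"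
      by (subst sum.reindex) (auto simp: P_def inj_on_def)
    also have "\<dots> \<le> A" unfolding A_def by (intro sum_mono2 fin) (auto simp: P_def)
    also have "(\<Sum>p\<in>P l. (a (snd p))\<^sup>2) = (\<Sum>j\<in>snd ` P l. (a j)\<^sup>2)"
      by (subst sum.reindex) (auto simp: P_def inj_on_def)
    also have "\<dots> \<le> A" unfolding A_def by (intro sum_mono2 fin) (auto simp: P_def)
    finally show ?thesis using Apos by (simp add: c_def)
  qed
  have csym: "c (- l) = c l" for l
  proof -
    have "(\<Sum>p\<in>P (- l). a (fst p) * a (snd p)) = (\<Sum>p\<in>P l. a (fst p) * a (snd p))"
      by (rule sum.reindex_bij_witness[of _ prod.swap prod.swap]) (auto simp: P_def)
    then show ?thesis by (simp add: c_def)
  qed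
  \<comment> \<open>The weights vanish at \<open>0\<close> and at \<open>L + 1\<close>, so both
    shifted sums for \<open>c 1\<close> extend to all of \<open>J\<close>.\<close>
  have a0: "a 0 = 0" by (simp add: a_def)
  have aL: "a (int L + 1) = 0"
  proof -
    have "(real L + 1) * \<theta> = pi" by (simp add: \<theta>_def add_nonneg_eq_0_iff)
    then show ?thesis by (simp add: a_def)
  qed
  have c1: "c 1 = cos \<theta>"
  proof -
    have "(\<Sum>p\<in>P 1. a (fst p) * a (snd p)) = (\<Sum>j\<in>{2..int L}. a j * a (j - 1))"
      by (rule sum.reindex_bij_witness[of _ "\<lambda>j. (j, j - 1)" fst]) (auto simp: P_def J_def diff_eq_eq)
    also have "\<dots> = (\<Sum>j\<in>J. a j * a (j - 1))"
    proof -
      have Z: "a j * a (j - 1) = 0" if "j \<in> J - {2..int L}" for j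
      proof -
        have "j = 1" using that by (auto simp: J_def)
        then show ?thesis using a0 by simp
      qed
      show ?thesis by (intro sum.mono_neutral_left ballI Z) (auto simp: J_def)
    qed
    finally have e1: "(\<Sum>p\<in>P 1. a (fst p) * a (snd p)) = (\<Sum>j\<in>J. a j * a (j - 1))" .
    have "(\<Sum>p\<in>P 1. a (fst p) * a (snd p)) = (\<Sum>j\<in>{1..int L - 1}. a j * a (j + 1))"
      by (rule sum.reindex_bij_witness[of _ "\<lambda>j. (j + 1, j)" snd])
         (auto simp: P_def J_def diff_eq_eq add.commute mult.commute)
    also have "\<dots> = (\<Sum>j\<in>J. a j * a (j + 1))"
    proof -
      have Z: "a j * a (j + 1) = 0" if "j \<in> J - {1..int L - 1}" for j
      proof -
        have "j = int L" using that by (auto simp: J_def)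
        then show ?thesis using aL by (simp add: add.commute)
      qed
      show ?thesis by (intro sum.mono_neutral_left ballI Z) (auto simp: J_def)
    qed
    finally have e2: "(\<Sum>p\<in>P 1. a (fst p) * a (snd p)) = (\<Sum>j\<in>J. a j * a (j + 1))" .
    \<comment> \<open>Adding the two forms lets both neighbours of \<open>j\<close> appear, and
      \<open>a (j - 1) + a (j + 1) = 2 * cos \<theta> * a j\<close> is the eigenvector
      equation.\<close>
    have "2 * (\<Sum>p\<in>P 1. a (fst p) * a (snd p)) = (\<Sum>j\<in>J. a j * a (j - 1)) + (\<Sum>j\<in>J. a j * a (j + 1))"
      using e1 e2 by simp
    also have "\<dots> = (\<Sum>j\<in>J. a j * (a (j - 1) + a (j + 1)))" by (simp add: sum.distrib distrib_left)
    also have "\<dots> = (\<Sum>j\<in>J. 2 * cos \<theta> * (a j)\<^sup>2)"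
    proof (intro sum.cong refl)
      fix j
      have "a (j - 1) + a (j + 1) = 2 * cos \<theta> * a j"
        by (simp add: a_def left_diff_distrib distrib_right sin_diff sin_add)
      then show "a j * (a (j - 1) + a (j + 1)) = 2 * cos \<theta> * (a j)\<^sup>2" by (simp add: power2_eq_square)
    qed
    also have "\<dots> = 2 * cos \<theta> * A" by (simp add: A_def sum_distrib_left)
    finally show ?thesis using Apos by (simp add: c_def)
  qed
  have cvan: "c l = 0" if "\<bar>l\<bar> \<ge> int L" for l
  proof -
    have "P l = {}" using that by (auto simp: P_def J_def)
    then show ?thesis by (simp add: c_def)
  qed
  have nonneg: "0 \<le> (\<Sum>l\<in>{- int L..int L}. c l * cos (2 * pi * of_int l * u))" for u
  proof -
    define w where "w j = 2 * pi * of_int j * u" for j :: int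
    have "(\<Sum>l\<in>{- int L..int L}. c l * cos (w l))
        = (\<Sum>l\<in>{- int L..int L}. \<Sum>p\<in>P l. a (fst p) * a (snd p) * cos (w (fst p) - w (snd p))) / A"
      unfolding sum_divide_distrib
    proof (intro sum.cong refl)
      fix l
      have "(\<Sum>p\<in>P l. a (fst p) * a (snd p) * cos (w (fst p) - w (snd p))) = (\<Sum>p\<in>P l. a (fst p) * a (snd p) * cos (w l))"
        by (intro sum.cong refl) (auto simp: P_def w_def algebra_simps)
      then show "c l * cos (w l) = (\<Sum>p\<in>P l. a (fst p) * a (snd p) * cos (w (fst p) - w (snd p)) / A)"
        by (simp add: c_def sum_distrib_right[symmetric] sum_divide_distrib[symmetric])
    qed
    also have "(\<Sum>l\<in>{- int L..int L}. \<Sum>p\<in>P l. a (fst p) * a (snd p) * cos (w (fst p) - w (snd p)))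
       = (\<Sum>p\<in>J \<times> J. a (fst p) * a (snd p) * cos (w (fst p) - w (snd p)))"
      unfolding P_def using fin by (intro sum.group) (auto simp: J_def)
    also have "\<dots> = (\<Sum>i\<in>J. \<Sum>j\<in>J. a i * a j * (cos (w i) * cos (w j) + sin (w i) * sin (w j)))"
      by (simp add: sum.cartesian_product split_beta cos_diff)
    also have "\<dots> = (\<Sum>j\<in>J. a j * cos (w j))\<^sup>2 + (\<Sum>j\<in>J. a j * sin (w j))\<^sup>2"
      by (simp add: power2_eq_square sum_product sum.distrib[symmetric] algebra_simps)
    finally show ?thesis using Apos by (simp add: w_def)
  qed
  show thesis
    using that[of c] c0 cnn cle csym c1 cvan nonneg unfolding \<theta>_def by blast
qed

text \<open>Concavity puts the sine above its chord from \<open>0\<close> to \<open>pi / 2\<close>,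
  hence \<open>sin (pi * |u|) \<ge> 2 * |u|\<close>; the double-angle formula produces the
  \<open>8\<close>.\<close>

lemma one_minus_cos_ge_square:
  fixes u :: real
  assumes "\<bar>u\<bar> \<le> 1/2"
  shows "8 * u\<^sup>2 \<le> 1 - cos (2 * pi * u)"
proof -
  have conc: "concave_on {0..pi} sin"
  proof (rule f''_le0_imp_concave)
    show "(sin has_real_derivative cos x) (at x)" for x by (rule DERIV_sin)
    show "(cos has_real_derivative - sin x) (at x)" for x by (rule DERIV_cos)
  qed (auto intro!: sin_ge_zero)
  have "2 * \<bar>u\<bar> \<le> sin (pi * \<bar>u\<bar>)"
  proof -
    have "(1 - 2 * \<bar>u\<bar>) * sin 0 + (2 * \<bar>u\<bar>) * sin (pi / 2)
        \<le> sin ((1 - 2 * \<bar>u\<bar>) *\<^sub>R 0 + (2 * \<bar>u\<bar>) *\<^sub>R (pi / 2))"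
      using assms by (intro concave_onD[OF conc]) auto
    then show ?thesis by (simp add: mult.commute)
  qed
  then have "(2 * \<bar>u\<bar>)\<^sup>2 \<le> (sin (pi * \<bar>u\<bar>))\<^sup>2" by (intro power_mono) auto
  moreover have "cos (2 * pi * u) = 1 - 2 * (sin (pi * \<bar>u\<bar>))\<^sup>2"
    using cos_double_sin[of "pi * u"] by (cases "u \<ge> 0") (auto simp: mult_ac)
  ultimately show ?thesis by (simp add: power_mult_distrib)
qed

text \<open>Lebesgue measure on a Euclidean space is the image of a product measure indexed by
  \<open>Basis\<close>; the bijection \<open>e\<close> from coordinates to axis vectors transports
  Fubini for that product to an integrand written with \<open>$\<close>.\<close>

lemma integral_lborel_prod_vec:
  fixes f :: "'n::finite \<Rightarrow> real \<Rightarrow> real"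
  assumes f: "\<And>i. integrable lborel (f i)"
  shows "(\<integral>x. (\<Prod>i\<in>UNIV. f i (x $ i)) \<partial>lborel) = (\<Prod>i\<in>UNIV. integral\<^sup>L lborel (f i))"
proof -
  interpret product_sigma_finite "\<lambda>_::real^'n. lborel::real measure" by standard
  define e where "e i = axis i (1::real)" for i :: 'n
  have inj: "inj e" by (auto simp: e_def inj_def axis_eq_axis)
  have B: "(Basis :: (real^'n) set) = range e" by (auto simp: Basis_vec_def e_def)
  have [measurable]: "f i \<in> borel_measurable borel" for i
    using borel_measurable_integrable[OF f] by simp
  have comp: "(\<Sum>b\<in>Basis. F b *\<^sub>R b) $ i = F (e i)" for F :: "real^'n \<Rightarrow> real" and i
  proof -
    have "(\<Sum>b\<in>Basis. F b *\<^sub>R b) $ i = (\<Sum>b\<in>Basis. F b *\<^sub>R b) \<bullet> e i"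
      by (simp add: e_def inner_axis)
    also have "\<dots> = F (e i)" using B by (intro inner_sum_left_Basis) auto
    finally show ?thesis .
  qed
  have pr: "(\<Prod>b\<in>Basis. f (inv e b) (F b)) = (\<Prod>i\<in>UNIV. f i (F (e i)))" for F :: "real^'n \<Rightarrow> real"
    by (simp add: B prod.reindex[OF inj] inv_f_f[OF inj])
  have [measurable]: "(\<lambda>f. \<Sum>b\<in>Basis. f b *\<^sub>R b) \<in> (\<Pi>\<^sub>M b\<in>(Basis::(real^'n) set). lborel) \<rightarrow>\<^sub>M borel"
    by measurable
  have "(\<integral>x. (\<Prod>i\<in>UNIV. f i (x $ i)) \<partial>lborel)
      = (\<integral>F. (\<Prod>i\<in>UNIV. f i ((\<Sum>b\<in>Basis. F b *\<^sub>R b) $ i)) \<partial>(\<Pi>\<^sub>M b\<in>(Basis::(real^'n) set). lborel))"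
    by (subst lborel_eq, subst integral_distr) simp_all
  also have "\<dots> = (\<integral>F. (\<Prod>b\<in>Basis. f (inv e b) (F b)) \<partial>(\<Pi>\<^sub>M b\<in>(Basis::(real^'n) set). lborel))"
    by (simp only: comp pr)
  also have "\<dots> = (\<Prod>b\<in>Basis. integral\<^sup>L lborel (f (inv e b)))"
    by (intro product_integral_prod f) simp
  also have "\<dots> = (\<Prod>i\<in>UNIV. integral\<^sup>L lborel (f i))"
    unfolding B by (simp add: prod.reindex[OF inj] inv_f_f[OF inj])
  finally show ?thesis .
qed

lemma integral_cos_period:
  fixes l :: int
  shows "has_bochner_integral lborel (\<lambda>u. cos (2 * pi * of_int l * u) * indicator {-1/2..<1/2} u)
           (if l = 0 then 1 else 0)"
proof -
  \<comment> \<open>The cube is half open so that its integer translates partition space, whereas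
    the antiderivative rule works on a closed interval; the end point \<open>1/2\<close> is a null
    set.\<close>
  have ae: "AE u in lborel. cos (2 * pi * of_int l * u) * indicator {-1/2..1/2} u
      = cos (2 * pi * of_int l * u) * indicator {-1/2..<1/2} (u::real)"
    using AE_lborel_singleton[of "1/2::real"] by eventually_elim (auto simp: indicator_def)
  have "has_bochner_integral lborel (\<lambda>u. cos (2 * pi * of_int l * u) * indicator {-1/2..1/2} u)
           (if l = 0 then 1 else 0)"
  proof (cases "l = 0")
    case True
    then show ?thesis
      using has_bochner_integral_real_indicator[of "{-1/2..1/2::real}" lborel] by simp
  next
    case False
    define w where "w = 2 * pi * real_of_int l"
    have w: "w \<noteq> 0" using False by (simp add: w_def)
    have "has_bochner_integral lborel (\<lambda>u. cos (w * u) * indicator {-1/2..1/2} u)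
       (sin (w * (1/2)) / w - sin (w * (-1/2)) / w)"
      using w by (intro has_bochner_integral_FTC_Icc_real) (auto intro!: derivative_eq_intros continuous_intros)
    moreover have "sin (w * (1/2)) = 0"
      using sin_integer_2pi[of "of_int l"] by (simp add: w_def sin_zero_iff_int2 mult.commute)
    ultimately show ?thesis using False by (simp add: w_def)
  qed
  then show ?thesis
    using ae by (subst has_bochner_integral_cong_AE[symmetric, OF _ _ ae]) auto
qed

section \<open>Integer vectors, the unit cube and the kernel in several variables\<close>

definition lattice_vec :: "('n::finite \<Rightarrow> int) \<Rightarrow> real ^ 'n" where
  "lattice_vec m = (\<chi> i. of_int (m i))"

definition unit_cube :: "(real ^ 'n::finite) set" where
  "unit_cube = {x. \<forall>i. x $ i \<in> {-1/2..<1/2}}"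

lemma unit_cube_borel [measurable]: "unit_cube \<in> sets borel"
proof -
  have eq: "unit_cube = (\<Inter>i. {x::real^'n. -1/2 \<le> x $ i} \<inter> {x. x $ i < 1/2})"
    by (auto simp: unit_cube_def)
  have m: "{x::real^'n. -1/2 \<le> x $ i} \<inter> {x. x $ i < 1/2} \<in> sets borel" for i
    by (intro sets.Int borel_closed closed_Collect_le borel_open open_Collect_less continuous_intros)
  show ?thesis unfolding eq by (intro sets.countable_INT'' m) auto
qed

lemma unit_cube_abs_le: "x \<in> unit_cube \<Longrightarrow> \<bar>x $ i\<bar> \<le> 1/2"
proof -
  assume "x \<in> unit_cube"
  then have "x $ i \<in> {-1/2..<1/2}" by (simp add: unit_cube_def)
  then show ?thesis unfolding atLeastLessThan_iff by linarith
qed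

lemma indicator_unit_cube: "indicator unit_cube x = (\<Prod>i\<in>UNIV. indicator {-1/2..<1/2} (x $ i) :: real)"
  by (auto simp: unit_cube_def indicator_def prod_zero_iff)

lemma bounded_unit_cube: "bounded (unit_cube :: (real ^ 'n::finite) set)"
proof -
  have "norm x \<le> real CARD('n)" if "x \<in> unit_cube" for x :: "real ^ 'n"
  proof -
    have "norm x \<le> (\<Sum>i\<in>UNIV. \<bar>x $ i\<bar>)" by (rule norm_le_l1_cart)
    also have "\<dots> \<le> (\<Sum>i\<in>(UNIV::'n set). 1)"
    proof (intro sum_mono)
      fix i
      show "\<bar>x $ i\<bar> \<le> 1" using unit_cube_abs_le[OF that, of i] by linarith
    qed
    finally show ?thesis by simp
  qed
  then show ?thesis unfolding bounded_iff by blast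
qed

text \<open>One box with two uses: the frequencies of the kernel, and a finite range for the lattice
  translates that can meet a bounded set.\<close>

definition lattice_box :: "nat \<Rightarrow> ('n::finite \<Rightarrow> int) set" where
  "lattice_box L = {m. \<forall>i. \<bar>m i\<bar> \<le> int L}"

lemma lattice_box_eq_PiE: "lattice_box L = PiE UNIV (\<lambda>_. {- int L..int L})"
  by (auto simp: lattice_box_def PiE_def Pi_def abs_le_iff) (smt (verit))+

lemma finite_lattice_box [simp]: "finite (lattice_box L :: ('n::finite \<Rightarrow> int) set)"
  unfolding lattice_box_eq_PiE by (intro finite_PiE) auto

text \<open>A tensor product of the one-variable kernel. Integrals over the cube factor, so the mass
  is \<open>1\<close>, and in the moment of coordinate \<open>i\<close> all other coordinates
  contribute their mass \<open>1\<close>.\<close>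

lemma exists_cube_kernel:
  fixes L :: nat
  assumes L: "1 \<le> L"
  obtains c :: "('n::finite \<Rightarrow> int) \<Rightarrow> real" and \<Phi> :: "real ^ 'n \<Rightarrow> real" where
    "\<And>x. \<Phi> x = (\<Sum>m\<in>lattice_box L. c m * cos (2 * pi * (lattice_vec m \<bullet> x)))"
    "\<And>x. 0 \<le> \<Phi> x" "c (\<lambda>_. 0) = 1" "\<And>m. \<bar>c m\<bar> \<le> 1"
    "(\<integral>x. indicator unit_cube x * \<Phi> x \<partial>lborel) = 1"
    "\<And>i. (\<integral>x. indicator unit_cube x * (\<Phi> x * (1 - cos (2 * pi * x $ i))) \<partial>lborel) = 1 - cos (pi / (real L + 1))"
proof -
  obtain c :: "int \<Rightarrow> real" where c: "c 0 = 1" "\<And>l. 0 \<le> c l" "\<And>l. c l \<le> 1" "\<And>l. c (- l) = c l"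
    "c 1 = cos (pi / (real L + 1))" "\<And>l. \<bar>l\<bar> \<ge> int L \<Longrightarrow> c l = 0"
    "\<And>u. 0 \<le> (\<Sum>l\<in>{- int L..int L}. c l * cos (2 * pi * of_int l * u))"
    using exists_concentrated_kernel[OF L] by blast
  define k where "k u = (\<Sum>l\<in>{- int L..int L}. c l * cos (2 * pi * of_int l * u))" for u
  define \<Phi> where "\<Phi> x = (\<Prod>i\<in>UNIV. k (x $ i))" for x :: "real ^ 'n"
  define cc where "cc m = (\<Prod>i\<in>UNIV. c (m i))" for m :: "'n \<Rightarrow> int"
  \<comment> \<open>Exponentials are used because a product of them is again a single exponential;
    evenness of \<open>c\<close> cancels the sine part.\<close>
  have kc: "complex_of_real (k u) = (\<Sum>l\<in>{- int L..int L}. of_real (c l) * cis (2 * pi * of_int l * u))" for u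
  proof -
    define w where "w = (\<Sum>l\<in>{- int L..int L}. c l * sin (2 * pi * of_int l * u))"
    have "w = (\<Sum>l\<in>{- int L..int L}. c (- l) * sin (2 * pi * of_int (- l) * u))"
      unfolding w_def by (rule sum.reindex_bij_witness[of _ uminus uminus]) auto
    also have "\<dots> = - w" by (simp add: w_def c(4) sum_negf)
    finally have "w = 0" by simp
    then show ?thesis by (simp add: complex_eq_iff k_def w_def)
  qed
  have cisprod: "(\<Prod>i\<in>UNIV. cis (f i)) = cis (\<Sum>i\<in>UNIV. f i)" for f :: "'n \<Rightarrow> real"
    by (simp add: cis_conv_exp exp_sum sum_distrib_left)
  have e: "\<Phi> x = (\<Sum>m\<in>lattice_box L. cc m * cos (2 * pi * (lattice_vec m \<bullet> x)))" for x
  proof -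
    have "complex_of_real (\<Phi> x) = (\<Prod>i\<in>UNIV. \<Sum>l\<in>{- int L..int L}. of_real (c l) * cis (2 * pi * of_int l * x $ i))"
      by (simp add: \<Phi>_def kc)
    also have "\<dots> = (\<Sum>m\<in>lattice_box L. \<Prod>i\<in>UNIV. of_real (c (m i)) * cis (2 * pi * of_int (m i) * x $ i))"
      unfolding lattice_box_eq_PiE by (intro prod_sum_PiE) auto
    also have "\<dots> = (\<Sum>m\<in>lattice_box L. of_real (cc m) * cis (2 * pi * (lattice_vec m \<bullet> x)))"
      by (simp add: prod.distrib cisprod cc_def lattice_vec_def inner_vec_def sum_distrib_left mult.assoc)
    finally have "Re (complex_of_real (\<Phi> x)) = Re (\<Sum>m\<in>lattice_box L. of_real (cc m) * cis (2 * pi * (lattice_vec m \<bullet> x)))"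
      by simp
    then show ?thesis by (simp add: Re_sum)
  qed
  have nn: "0 \<le> \<Phi> x" for x
    unfolding \<Phi>_def using c(7) by (intro prod_nonneg) (simp add: k_def)
  have c0: "cc (\<lambda>_. 0) = 1" by (simp add: cc_def c(1))
  have cle: "\<bar>cc m\<bar> \<le> 1" for m
    unfolding cc_def abs_prod using c(2,3) by (intro prod_le_1) auto
  have hk: "has_bochner_integral lborel (\<lambda>u. indicator {-1/2..<1/2} u * k u) 1"
  proof -
    have "has_bochner_integral lborel
        (\<lambda>u. \<Sum>l\<in>{- int L..int L}. c l * (cos (2 * pi * of_int l * u) * indicator {-1/2..<1/2} u))
        (\<Sum>l\<in>{- int L..int L}. c l * (if l = 0 then 1 else 0))"
      by (intro has_bochner_integral_sum has_bochner_integral_mult_right integral_cos_period)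
    moreover have "(\<Sum>l\<in>{- int L..int L}. c l * (if l = 0 then 1 else 0)) = 1"
      by (simp add: if_distrib[of "\<lambda>x. c _ * x"] sum.delta c(1) cong: if_cong)
    ultimately show ?thesis by (simp add: k_def sum_distrib_left mult_ac)
  qed
  \<comment> \<open>Multiplication by \<open>cos (2 * pi * u)\<close> shifts frequencies by one, so
    the constant term becomes the mean of \<open>c (- 1)\<close> and \<open>c 1\<close>, which is
    \<open>c 1\<close>.\<close>
  have hk1: "has_bochner_integral lborel (\<lambda>u. indicator {-1/2..<1/2} u * (k u * (1 - cos (2 * pi * u)))) (1 - c 1)"
  proof -
    have "has_bochner_integral lborel
        (\<lambda>u. \<Sum>l\<in>{- int L..int L}. c l / 2 * (cos (2 * pi * of_int (l + 1) * u) * indicator {-1/2..<1/2} u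
            + cos (2 * pi * of_int (l - 1) * u) * indicator {-1/2..<1/2} u))
        (\<Sum>l\<in>{- int L..int L}. c l / 2 * ((if l + 1 = 0 then 1 else 0) + (if l - 1 = 0 then 1 else 0)))"
      by (intro has_bochner_integral_sum has_bochner_integral_mult_right has_bochner_integral_add integral_cos_period)
    moreover have "(\<lambda>u. \<Sum>l\<in>{- int L..int L}. c l / 2 * (cos (2 * pi * of_int (l + 1) * u) * indicator {-1/2..<1/2} u
            + cos (2 * pi * of_int (l - 1) * u) * indicator {-1/2..<1/2} u))
        = (\<lambda>u. indicator {-1/2..<1/2} u * (k u * cos (2 * pi * u)))" (is "?f = ?g")
    proof
      fix u
      have trm: "c l / 2 * (cos (2 * pi * of_int (l + 1) * u) * indicator {-1/2..<1/2} u
            + cos (2 * pi * of_int (l - 1) * u) * indicator {-1/2..<1/2} u)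
         = indicator {-1/2..<1/2} u * (c l * cos (2 * pi * of_int l * u) * cos (2 * pi * u))" for l
      proof -
        have "cos (2 * pi * of_int (l + 1) * u) + cos (2 * pi * of_int (l - 1) * u)
           = 2 * (cos (2 * pi * of_int l * u) * cos (2 * pi * u))"
          by (simp add: algebra_simps cos_add cos_diff)
        then show ?thesis by (simp add: indicator_def)
      qed
      have "?f u = (\<Sum>l\<in>{- int L..int L}. indicator {-1/2..<1/2} u * (c l * cos (2 * pi * of_int l * u) * cos (2 * pi * u)))"
        by (intro sum.cong refl trm)
      then show "?f u = ?g u" by (simp only: k_def sum_distrib_left sum_distrib_right)
    qed
    moreover have "(\<Sum>l\<in>{- int L..int L}. c l / 2 * ((if l + 1 = 0 then 1 else 0) + (if l - 1 = 0 then 1 else 0))) = c 1"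
    proof -
      have trm: "c l / 2 * ((if l + 1 = 0 then 1 else 0) + (if l - 1 = 0 then 1 else 0))
         = (if l = -1 then c (-1) / 2 else 0) + (if l = 1 then c 1 / 2 else 0)" for l
        by auto
      have "(\<Sum>l\<in>{- int L..int L}. c l / 2 * ((if l + 1 = 0 then 1 else 0) + (if l - 1 = 0 then 1 else 0)))
         = (\<Sum>l\<in>{- int L..int L}. if l = -1 then c (-1) / 2 else 0) + (\<Sum>l\<in>{- int L..int L}. if l = 1 then c 1 / 2 else 0)"
        by (simp only: trm sum.distrib)
      also have "\<dots> = c 1" using L c(4)[of 1] by simp
      finally show ?thesis .
    qed
    ultimately have "has_bochner_integral lborel (\<lambda>u. indicator {-1/2..<1/2} u * (k u * cos (2 * pi * u))) (c 1)"
      by simp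
    from has_bochner_integral_diff[OF hk this] show ?thesis by (simp add: algebra_simps)
  qed
  have mass: "(\<integral>x. indicator unit_cube x * \<Phi> x \<partial>lborel) = 1"
  proof -
    have "(\<integral>x. indicator unit_cube x * \<Phi> x \<partial>lborel)
       = (\<integral>x. (\<Prod>i\<in>UNIV. indicator {-1/2..<1/2} (x $ i) * k (x $ i)) \<partial>(lborel :: (real^'n) measure))"
      by (simp add: indicator_unit_cube \<Phi>_def prod.distrib)
    also have "\<dots> = (\<Prod>i\<in>(UNIV::'n set). integral\<^sup>L lborel (\<lambda>u. indicator {-1/2..<1/2} u * k u))"
      using hk by (intro integral_lborel_prod_vec) (auto simp: has_bochner_integral_iff)
    finally show ?thesis using hk by (simp add: has_bochner_integral_iff)
  qed
  have mom: "(\<integral>x. indicator unit_cube x * (\<Phi> x * (1 - cos (2 * pi * x $ i))) \<partial>lborel) = 1 - cos (pi / (real L + 1))" for i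
  proof -
    define g where "g = (\<lambda>j u. indicator {-1/2..<1/2} u * (k u * (if j = i then 1 - cos (2 * pi * u) else 1)))"
    have g: "has_bochner_integral lborel (g j) (if j = i then 1 - c 1 else 1)" for j
      using hk hk1 by (simp add: g_def)
    have "(\<integral>x. indicator unit_cube x * (\<Phi> x * (1 - cos (2 * pi * x $ i))) \<partial>lborel)
       = (\<integral>x. (\<Prod>j\<in>UNIV. g j (x $ j)) \<partial>(lborel :: (real^'n) measure))"
      by (simp add: indicator_unit_cube \<Phi>_def g_def prod.distrib prod.delta)
    also have "\<dots> = (\<Prod>j\<in>UNIV. integral\<^sup>L lborel (g j))"
      using g by (intro integral_lborel_prod_vec) (auto simp: has_bochner_integral_iff)
    also have "\<dots> = (\<Prod>j\<in>UNIV. if j = i then 1 - c 1 else 1)"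
      using g by (simp add: has_bochner_integral_iff)
    finally show ?thesis by (simp add: prod.delta c(5))
  qed
  show thesis using that[OF e nn c0 cle mass mom] .
qed

text \<open>Chebyshev's inequality with \<open>1 - cos\<close> in the role of the square: on the
  cube its sum over the coordinates is at least \<open>8 * (norm x)^2\<close>, and its kernel
  average is given by \<open>mom\<close>.\<close>

lemma kernel_tail_le:
  fixes \<Phi> :: "real ^ 'n \<Rightarrow> real"
  assumes nn: "\<And>x. 0 \<le> \<Phi> x" and meas[measurable]: "\<Phi> \<in> borel_measurable borel"
    and bdd: "\<And>x. \<Phi> x \<le> B"
    and mom: "\<And>i. (\<integral>x. indicator unit_cube x * (\<Phi> x * (1 - cos (2 * pi * x $ i))) \<partial>lborel) = \<mu>"
    and r: "0 < r"
  shows "(\<integral>x. indicator (unit_cube \<inter> {x. r < norm x}) x * \<Phi> x \<partial>lborel) \<le> real CARD('n) * \<mu> / (8 * r\<^sup>2)"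
proof -
  have fin: "emeasure lborel (unit_cube :: (real^'n) set) < \<infinity>"
    by (rule emeasure_bounded_finite[OF bounded_unit_cube])
  have int: "integrable lborel (\<lambda>x. indicator unit_cube x * (\<Phi> x * (1 - cos (2 * pi * x $ i))))" for i
  proof -
    have "integrable lborel (\<lambda>x. indicator unit_cube x *\<^sub>R (\<Phi> x * (1 - cos (2 * pi * x $ i))))"
    proof (rule integrableI_bounded_set_indicator[where B = "B * 2"])
      show "AE x in lborel. x \<in> unit_cube \<longrightarrow> norm (\<Phi> x * (1 - cos (2 * pi * x $ i))) \<le> B * 2"
      proof (intro AE_I2 impI)
        fix x :: "real ^ 'n"
        have "\<bar>1 - cos (2 * pi * x $ i)\<bar> \<le> 2"
          using cos_le_one[of "2 * pi * x $ i"] cos_ge_minus_one[of "2 * pi * x $ i"] by linarith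
        then show "norm (\<Phi> x * (1 - cos (2 * pi * x $ i))) \<le> B * 2"
          using nn[of x] bdd[of x] by (simp add: abs_mult mult_mono)
      qed
    qed (use fin in auto)
    then show ?thesis by simp
  qed
  have "(\<integral>x. indicator (unit_cube \<inter> {x. r < norm x}) x * \<Phi> x \<partial>lborel)
     \<le> (\<integral>x. (\<Sum>i\<in>UNIV. indicator unit_cube x * (\<Phi> x * (1 - cos (2 * pi * x $ i)))) / (8 * r\<^sup>2) \<partial>lborel)"
  proof (rule integral_mono_AE')
    show "integrable lborel (\<lambda>x. (\<Sum>i\<in>UNIV. indicator unit_cube x * (\<Phi> x * (1 - cos (2 * pi * x $ i)))) / (8 * r\<^sup>2))"
      by (intro integrable_divide_zero Bochner_Integration.integrable_sum int)
    show "AE x in lborel. indicator (unit_cube \<inter> {x. r < norm x}) x * \<Phi> x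
       \<le> (\<Sum>i\<in>UNIV. indicator unit_cube x * (\<Phi> x * (1 - cos (2 * pi * x $ i)))) / (8 * r\<^sup>2)"
    proof (intro AE_I2)
      fix x :: "real ^ 'n"
      show "indicator (unit_cube \<inter> {x. r < norm x}) x * \<Phi> x
       \<le> (\<Sum>i\<in>UNIV. indicator unit_cube x * (\<Phi> x * (1 - cos (2 * pi * x $ i)))) / (8 * r\<^sup>2)"
      proof (cases "x \<in> unit_cube \<and> r < norm x")
        case True
        have "r\<^sup>2 \<le> (norm x)\<^sup>2" using True r by (intro power_mono) auto
        also have "\<dots> = (\<Sum>i\<in>UNIV. (x $ i)\<^sup>2)"
          by (simp add: norm_vec_def L2_set_def sum_nonneg)
        finally have "8 * r\<^sup>2 \<le> (\<Sum>i\<in>UNIV. 8 * (x $ i)\<^sup>2)" by (simp add: sum_distrib_left[symmetric])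
        also have "\<dots> \<le> (\<Sum>i\<in>UNIV. 1 - cos (2 * pi * x $ i))"
          using True by (intro sum_mono one_minus_cos_ge_square unit_cube_abs_le) simp
        finally have "\<Phi> x * (8 * r\<^sup>2) \<le> \<Phi> x * (\<Sum>i\<in>UNIV. 1 - cos (2 * pi * x $ i))"
          by (intro mult_left_mono nn)
        then show ?thesis using True r by (simp add: sum_distrib_left field_simps)
      next
        case False
        have "0 \<le> (\<Sum>i\<in>UNIV. indicator unit_cube x * (\<Phi> x * (1 - cos (2 * pi * x $ i)))) / (8 * r\<^sup>2)"
          using nn by (intro divide_nonneg_nonneg sum_nonneg mult_nonneg_nonneg) auto
        then show ?thesis using False by (auto simp: indicator_def)
      qed
    qed
    show "AE x in lborel. 0 \<le> (\<Sum>i\<in>UNIV. indicator unit_cube x * (\<Phi> x * (1 - cos (2 * pi * x $ i)))) / (8 * r\<^sup>2)"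
      using nn by (intro AE_I2 divide_nonneg_nonneg sum_nonneg mult_nonneg_nonneg) auto
  qed
  also have "\<dots> = (\<integral>x. (\<Sum>i\<in>UNIV. indicator unit_cube x * (\<Phi> x * (1 - cos (2 * pi * x $ i)))) \<partial>lborel) / (8 * r\<^sup>2)"
    by (rule integral_divide_zero)
  also have "\<dots> = (\<Sum>i\<in>(UNIV::'n set). \<mu>) / (8 * r\<^sup>2)"
    by (subst Bochner_Integration.integral_sum[OF int]) (simp only: mom)
  finally show ?thesis by simp
qed

subsection \<open>Averages of lattice point counts\<close>

text \<open>For bounded \<open>S\<close> this is the periodisation of its indicator, evaluated at
  \<open>x\<close>.\<close>

definition point_count :: "(real ^ 'n::finite) set \<Rightarrow> real ^ 'n \<Rightarrow> nat" where
  "point_count S x = card {m. lattice_vec m + x \<in> S}"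

lemma lattice_vec_nth [simp]: "lattice_vec m $ i = of_int (m i)"
  by (simp add: lattice_vec_def)

lemma lattice_translates_subset_box:
  fixes S :: "(real ^ 'n::finite) set"
  assumes "\<And>z. z \<in> S \<Longrightarrow> norm z \<le> R" and "R + 1 \<le> real M" and "x \<in> unit_cube"
  shows "{m. lattice_vec m + x \<in> S} \<subseteq> lattice_box M"
proof
  fix m assume "m \<in> {m. lattice_vec m + x \<in> S}"
  then have n: "norm (lattice_vec m + x) \<le> R" using assms by auto
  have "\<bar>m i\<bar> \<le> int M" for i
  proof -
    have "\<bar>(lattice_vec m + x) $ i\<bar> \<le> R" using component_le_norm_cart n order_trans by blast
    then have "\<bar>real_of_int (m i) + x $ i\<bar> \<le> R" by simp
    then have "\<bar>real_of_int (m i)\<bar> \<le> real M" using unit_cube_abs_le[OF assms(3), of i] assms(2) by linarith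
    then show ?thesis by linarith
  qed
  then show "m \<in> lattice_box M" by (simp add: lattice_box_def)
qed

lemma point_count_eq_sum:
  fixes S :: "(real ^ 'n::finite) set"
  assumes "\<And>z. z \<in> S \<Longrightarrow> norm z \<le> R" and "R + 1 \<le> real M" and "x \<in> unit_cube"
  shows "real (point_count S x) = (\<Sum>m\<in>lattice_box M. indicator S (lattice_vec m + x))"
proof -
  have "{m. lattice_vec m + x \<in> S} = lattice_box M \<inter> {m. lattice_vec m + x \<in> S}"
    using lattice_translates_subset_box[OF assms] by blast
  then have "real (point_count S x) = real (card (lattice_box M \<inter> {m. lattice_vec m + x \<in> S}))"
    by (simp only: point_count_def)
  also have "\<dots> = (\<Sum>m\<in>lattice_box M. indicator {m. lattice_vec m + x \<in> S} m)"
    by (simp add: indicator_def sum.If_cases Int_def)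
  finally show ?thesis by (simp add: indicator_def)
qed

text \<open>Rounding each coordinate to \<open>floor (z $ i + 1/2)\<close> gives the only lattice
  point whose cube contains \<open>z\<close>; the bound on \<open>norm z\<close> keeps that point
  inside the finite box.\<close>

lemma cube_translate_unique:
  fixes z :: "real ^ 'n::finite"
  assumes "norm z \<le> R" "R + 1 \<le> real M"
  shows "(\<Sum>m\<in>lattice_box M. indicator unit_cube (- lattice_vec m + z)) = (1 :: real)"
proof -
  define m0 where "m0 i = \<lfloor>z $ i + 1/2\<rfloor>" for i
  have iff: "- lattice_vec m + z \<in> unit_cube \<longleftrightarrow> m = m0" for m
  proof -
    have "- lattice_vec m + z \<in> unit_cube \<longleftrightarrow> (\<forall>i. m i = \<lfloor>z $ i + 1/2\<rfloor>)"
      unfolding unit_cube_def mem_Collect_eq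
    proof (intro all_cong1)
      fix i
      show "(- lattice_vec m + z) $ i \<in> {- 1 / 2..<1 / 2} \<longleftrightarrow> m i = \<lfloor>z $ i + 1/2\<rfloor>"
        by (simp add: eq_commute[of "m i"] floor_eq_iff) linarith
    qed
    then show ?thesis by (auto simp: m0_def fun_eq_iff)
  qed
  have "m0 \<in> lattice_box M"
  proof -
    have "\<bar>m0 i\<bar> \<le> int M" for i
    proof -
      have "\<bar>z $ i\<bar> \<le> R" using component_le_norm_cart assms(1) order_trans by blast
      then show ?thesis using assms(2) unfolding m0_def by linarith
    qed
    then show ?thesis by (simp add: lattice_box_def)
  qed
  then have "(\<Sum>m\<in>lattice_box M. indicator unit_cube (- lattice_vec m + z))
     = (\<Sum>m\<in>lattice_box M. if m = m0 then 1 else (0::real))"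
    by (intro sum.cong refl) (simp only: indicator_def of_bool_def iff)
  also have "\<dots> = 1" using \<open>m0 \<in> lattice_box M\<close> by simp
  finally show ?thesis .
qed

lemma cos_lattice_periodic:
  "cos (2 * pi * (lattice_vec \<mu> \<bullet> (lattice_vec m + x))) = cos (2 * pi * (lattice_vec \<mu> \<bullet> x))"
proof -
  define j where "j = (\<Sum>i\<in>UNIV. \<mu> i * m i)"
  have "lattice_vec \<mu> \<bullet> lattice_vec m = of_int j"
    by (simp add: inner_vec_def j_def)
  then have "2 * pi * (lattice_vec \<mu> \<bullet> (lattice_vec m + x)) = 2 * pi * (lattice_vec \<mu> \<bullet> x) + 2 * pi * of_int j"
    by (simp add: inner_add_right algebra_simps)
  then show ?thesis
    using sin_int_2pin[of j] cos_int_2pin[of j] by (simp add: cos_add mult_ac)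
qed

lemma integral_lborel_translate:
  fixes f :: "'a::euclidean_space \<Rightarrow> real"
  assumes [measurable]: "f \<in> borel_measurable borel"
  shows "(\<integral>x. f (c + x) \<partial>lborel) = (\<integral>x. f x \<partial>lborel)"
proof -
  have "(\<integral>x. f x \<partial>lborel) = (\<integral>x. f x \<partial>(distr lborel borel ((+) c)))"
    by (simp only: lborel_distr_plus)
  also have "\<dots> = (\<integral>x. f (c + x) \<partial>lborel)" by (intro integral_distr) auto
  finally show ?thesis by simp
qed

lemma integrable_bounded_on:
  fixes f :: "real ^ 'n::finite \<Rightarrow> real"
  assumes "A \<in> sets borel" "bounded A" "f \<in> borel_measurable borel" "\<And>x. x \<in> A \<Longrightarrow> \<bar>f x\<bar> \<le> B"
  shows "integrable lborel (\<lambda>x. indicator A x * f x)"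
proof -
  have "integrable lborel (\<lambda>x. indicator A x *\<^sub>R f x)"
    using assms emeasure_bounded_finite[OF assms(2)]
    by (intro integrableI_bounded_set_indicator[where B = B]) auto
  then show ?thesis by simp
qed

text \<open>Unfolding: the cosine is invariant under integer translations, so the pieces of
  \<open>S\<close> cut out by the translated cubes reassemble. Boundedness of \<open>S\<close> makes
  the lattice sum finite, and no convergence question arises.\<close>

lemma
  fixes S :: "(real ^ 'n::finite) set"
  assumes S[measurable]: "S \<in> sets borel" and bS: "bounded S"
  shows integral_cos_point_count:
      "(\<integral>x. indicator unit_cube x * (cos (2 * pi * (lattice_vec \<mu> \<bullet> x)) * real (point_count S x)) \<partial>lborel)
         = (\<integral>x. indicator S x * cos (2 * pi * (lattice_vec \<mu> \<bullet> x)) \<partial>lborel)"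
    and integrable_point_count: "f \<in> borel_measurable borel \<Longrightarrow> (\<And>x. \<bar>f x\<bar> \<le> B) \<Longrightarrow>
       integrable lborel (\<lambda>x. indicator unit_cube x * (f x * real (point_count S x)))"
proof -
  obtain R where R: "\<And>z. z \<in> S \<Longrightarrow> norm z \<le> R" using bS unfolding bounded_iff by auto
  obtain M :: nat where M: "R + 1 \<le> real M" using real_arch_simple by blast
  have eq: "indicator unit_cube x * (f x * real (point_count S x))
      = (\<Sum>m\<in>lattice_box M. indicator unit_cube x * (f x * indicator S (lattice_vec m + x)))" for f :: "real ^ 'n \<Rightarrow> real" and x
  proof (cases "x \<in> unit_cube")
    case True
    have "real (point_count S x) = (\<Sum>m\<in>lattice_box M. indicator S (lattice_vec m + x))"
      using R M True by (rule point_count_eq_sum)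
    then show ?thesis by (simp only: sum_distrib_left)
  qed simp
  have int: "integrable lborel (\<lambda>x. indicator unit_cube x * (f x * indicator S (lattice_vec m + x)))"
    if [measurable]: "f \<in> borel_measurable borel" and fB: "\<And>x. \<bar>f x\<bar> \<le> B" for f :: "real ^ 'n \<Rightarrow> real" and m B
  proof (rule integrable_bounded_on[OF unit_cube_borel bounded_unit_cube, where B = B])
    show "\<bar>f x * indicator S (lattice_vec m + x)\<bar> \<le> B" for x
      using fB[of x] by (auto simp: indicator_def)
  qed measurable
  show "integrable lborel (\<lambda>x. indicator unit_cube x * (f x * real (point_count S x)))"
    if "f \<in> borel_measurable borel" "\<And>x. \<bar>f x\<bar> \<le> B"
    unfolding eq using that by (intro Bochner_Integration.integrable_sum int)
  define g where "g = (\<lambda>z::real^'n. indicator S z * cos (2 * pi * (lattice_vec \<mu> \<bullet> z)))"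
  have [measurable]: "g \<in> borel_measurable borel" unfolding g_def by measurable
  have gi: "integrable lborel (\<lambda>z. indicator unit_cube (- lattice_vec m + z) * g z)" for m
  proof -
    have "integrable lborel (\<lambda>z. indicator S z * (indicator unit_cube (- lattice_vec m + z) * cos (2 * pi * (lattice_vec \<mu> \<bullet> z))))"
      by (intro integrable_bounded_on[OF S bS, where B = 1]) (auto simp: indicator_def)
    then show ?thesis by (simp add: g_def mult_ac)
  qed
  have "(\<integral>x. indicator unit_cube x * (cos (2 * pi * (lattice_vec \<mu> \<bullet> x)) * real (point_count S x)) \<partial>lborel)
     = (\<Sum>m\<in>lattice_box M. \<integral>x. indicator unit_cube x *
          (cos (2 * pi * (lattice_vec \<mu> \<bullet> x)) * indicator S (lattice_vec m + x)) \<partial>lborel)"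
    unfolding eq[where f = "\<lambda>x. cos (2 * pi * (lattice_vec \<mu> \<bullet> x))"]
    by (intro Bochner_Integration.integral_sum int[where B = 1]) auto
  also have "\<dots> = (\<Sum>m\<in>lattice_box M. \<integral>z. indicator unit_cube (- lattice_vec m + z) * g z \<partial>lborel)"
  proof (intro sum.cong refl)
    fix m :: "'n \<Rightarrow> int"
    have "(\<integral>x. indicator unit_cube x * (cos (2 * pi * (lattice_vec \<mu> \<bullet> x)) * indicator S (lattice_vec m + x)) \<partial>lborel)
      = (\<integral>x. (\<lambda>z. indicator unit_cube (- lattice_vec m + z) * g z) (lattice_vec m + x) \<partial>lborel)"
      by (simp only: g_def cos_lattice_periodic minus_add_cancel mult.commute[of "indicator S _"])
    also have "\<dots> = (\<integral>z. indicator unit_cube (- lattice_vec m + z) * g z \<partial>lborel)"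
      by (rule integral_lborel_translate) measurable
    finally show "(\<integral>x. indicator unit_cube x * (cos (2 * pi * (lattice_vec \<mu> \<bullet> x)) * indicator S (lattice_vec m + x)) \<partial>lborel)
      = (\<integral>z. indicator unit_cube (- lattice_vec m + z) * g z \<partial>lborel)" .
  qed
  also have "\<dots> = (\<integral>z. (\<Sum>m\<in>lattice_box M. indicator unit_cube (- lattice_vec m + z) * g z) \<partial>lborel)"
    by (intro Bochner_Integration.integral_sum[symmetric] gi)
  also have "\<dots> = (\<integral>z. g z \<partial>lborel)"
  proof (intro Bochner_Integration.integral_cong refl)
    fix z :: "real ^ 'n"
    show "(\<Sum>m\<in>lattice_box M. indicator unit_cube (- lattice_vec m + z) * g z) = g z"
    proof (cases "z \<in> S")
      case True
      show ?thesis unfolding sum_distrib_right[symmetric] cube_translate_unique[OF R[OF True] M] by simp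
    qed (simp add: g_def)
  qed
  finally show "(\<integral>x. indicator unit_cube x * (cos (2 * pi * (lattice_vec \<mu> \<bullet> x)) * real (point_count S x)) \<partial>lborel)
         = (\<integral>x. indicator S x * cos (2 * pi * (lattice_vec \<mu> \<bullet> x)) \<partial>lborel)"
    by (simp only: g_def)
qed

text \<open>Frequency \<open>0\<close> has coefficient \<open>1\<close> and produces the volume;
  every other frequency is error, weighted by a coefficient of modulus at most \<open>1\<close>. The
  average is a finite sum over frequencies, so this is an exact identity followed by the triangle
  inequality.\<close>

lemma kernel_average_point_count:
  fixes S :: "(real ^ 'n::finite) set"
  assumes S: "S \<in> sets borel" "bounded S"
    and \<Phi>: "\<And>x. \<Phi> x = (\<Sum>m\<in>lattice_box L. c m * cos (2 * pi * (lattice_vec m \<bullet> x)))"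
    and c: "c (\<lambda>_. 0) = 1" "\<And>m. \<bar>c m\<bar> \<le> 1"
  shows "\<bar>(\<integral>x. indicator unit_cube x * (\<Phi> x * real (point_count S x)) \<partial>lborel) - measure lborel S\<bar>
     \<le> (\<Sum>m\<in>lattice_box L - {\<lambda>_. 0}. \<bar>\<integral>x. indicator S x * cos (2 * pi * (lattice_vec m \<bullet> x)) \<partial>lborel\<bar>)"
proof -
  define I where "I m = (\<integral>x. indicator S x * cos (2 * pi * (lattice_vec m \<bullet> x)) \<partial>lborel)" for m
  have "(\<integral>x. indicator unit_cube x * (\<Phi> x * real (point_count S x)) \<partial>lborel)
     = (\<integral>x. (\<Sum>m\<in>lattice_box L. c m * (indicator unit_cube x * (cos (2 * pi * (lattice_vec m \<bullet> x)) * real (point_count S x)))) \<partial>lborel)"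
    by (intro Bochner_Integration.integral_cong refl)
       (simp add: \<Phi> sum_distrib_left sum_distrib_right mult_ac del: indicator_simps)
  also have "\<dots> = (\<Sum>m\<in>lattice_box L. (\<integral>x. c m * (indicator unit_cube x * (cos (2 * pi * (lattice_vec m \<bullet> x)) * real (point_count S x))) \<partial>lborel))"
    by (intro Bochner_Integration.integral_sum integrable_mult_right integrable_point_count[OF S, where B = 1]) auto
  also have "\<dots> = (\<Sum>m\<in>lattice_box L. c m * I m)"
    by (simp only: integral_mult_right_zero integral_cos_point_count[OF S] I_def)
  also have "\<dots> = c (\<lambda>_. 0) * I (\<lambda>_. 0) + (\<Sum>m\<in>lattice_box L - {\<lambda>_. 0}. c m * I m)"
    by (intro sum.remove finite_lattice_box) (simp add: lattice_box_def)
  also have "I (\<lambda>_. 0) = measure lborel S"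
  proof -
    have "lattice_vec (\<lambda>_. 0) = (0 :: real^'n)" by (simp add: vec_eq_iff)
    then show ?thesis using S by (simp add: I_def)
  qed
  finally have "\<bar>(\<integral>x. indicator unit_cube x * (\<Phi> x * real (point_count S x)) \<partial>lborel) - measure lborel S\<bar>
     = \<bar>\<Sum>m\<in>lattice_box L - {\<lambda>_. 0}. c m * I m\<bar>" using c(1) by simp
  also have "\<dots> \<le> (\<Sum>m\<in>lattice_box L - {\<lambda>_. 0}. \<bar>c m * I m\<bar>)" by (rule sum_abs)
  also have "\<dots> \<le> (\<Sum>m\<in>lattice_box L - {\<lambda>_. 0}. \<bar>I m\<bar>)"
    using c(2) by (intro sum_mono) (simp add: abs_mult mult_left_le_one_le)
  finally show ?thesis by (simp only: I_def)
qed

section \<open>Power estimates and the sum over frequencies\<close>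

lemma power_diff_le:
  fixes a b :: real
  assumes "0 \<le> b" "b \<le> a" "1 \<le> d"
  shows "a ^ d - b ^ d \<le> real d * (a - b) * a ^ (d - 1)"
proof (cases "a = 0")
  case True then show ?thesis using assms by simp
next
  case False
  then have a: "0 < a" using assms by simp
  define q where "q = b / a - 1"
  have "1 + real d * q \<le> (1 + q) ^ d"
    using a assms unfolding q_def by (intro Bernoulli_inequality) simp
  then have "a ^ d * (1 + real d * q) \<le> a ^ d * (1 + q) ^ d" using a by (intro mult_left_mono) auto
  also have "a ^ d * (1 + q) ^ d = b ^ d" using a by (simp add: q_def power_divide)
  finally have "a ^ d + real d * (a ^ d * q) \<le> b ^ d" by (simp add: algebra_simps)
  moreover have "a ^ d * q = - ((a - b) * a ^ (d - 1))"
    using a assms(3) by (cases d) (auto simp: q_def field_simps)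
  ultimately show ?thesis by (simp add: mult.assoc)
qed

text \<open>A discrete form of integrating \<open>x powr (\<beta> - 1)\<close>, shaped to telescope.
  With \<open>t = 1 / x\<close> it reads
  \<open>(1 - t) powr \<beta> \<le> 1 - \<beta> / (1 + \<beta>) * t\<close>, which follows for
  \<open>t < 1\<close> from \<open>(1 - t) powr \<beta> \<le> exp (- \<beta> * t) \<le> 1 / (1 +
  \<beta> * t)\<close>. The constant serves \<beta> below and above \<open>1\<close>, and the end
  point \<open>x = 1\<close>.\<close>

lemma powr_diff_ge:
  fixes x \<beta> :: real
  assumes "1 \<le> x" "0 < \<beta>"
  shows "x powr (\<beta> - 1) \<le> (1 + \<beta>) / \<beta> * (x powr \<beta> - (x - 1) powr \<beta>)"
proof -
  define t where "t = 1 / x"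
  have t: "0 < t" "t \<le> 1" using assms by (auto simp: t_def)
  have "(1 - t) powr \<beta> \<le> 1 / (1 + \<beta> * t)"
  proof (cases "t = 1")
    case False
    then have t1: "t < 1" using t by simp
    have "(1 - t) powr \<beta> = exp (\<beta> * ln (1 - t))" using t1 by (simp add: powr_def)
    also have "\<dots> \<le> exp (\<beta> * (- t))"
      using assms ln_le_minus_one[of "1 - t"] t1 mult_left_mono[of "ln (1 - t)" "- t" \<beta>] by simp
    also have "\<dots> = 1 / exp (\<beta> * t)" by (simp add: exp_minus field_simps)
    also have "\<dots> \<le> 1 / (1 + \<beta> * t)"
      using assms t by (intro divide_left_mono exp_ge_add_one_self mult_pos_pos) (auto intro: add_pos_pos)
    finally show ?thesis .
  qed (use assms in simp)
  also have "1 / (1 + \<beta> * t) \<le> 1 - \<beta> / (1 + \<beta>) * t"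
  proof -
    have "0 < 1 + \<beta> * t" using assms t by (simp add: add_pos_pos)
    then have "1 - 1 / (1 + \<beta> * t) = \<beta> * t / (1 + \<beta> * t)" by (simp add: field_simps)
    also have "\<dots> \<ge> \<beta> * t / (1 + \<beta>)"
      using assms t by (intro divide_left_mono mult_pos_pos) (auto intro: add_pos_pos)
    finally show ?thesis by simp
  qed
  finally have le: "\<beta> / (1 + \<beta>) * t \<le> 1 - (1 - t) powr \<beta>" by simp
  have "x - 1 = x * (1 - t)" using assms by (simp add: t_def field_simps)
  then have "(x - 1) powr \<beta> = x powr \<beta> * (1 - t) powr \<beta>" using assms t by (simp add: powr_mult)
  then have "x powr \<beta> - (x - 1) powr \<beta> = x powr \<beta> * (1 - (1 - t) powr \<beta>)" by (simp add: algebra_simps)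
  also have "\<dots> \<ge> x powr \<beta> * (\<beta> / (1 + \<beta>) * t)" using le by (intro mult_left_mono) auto
  also have "x powr \<beta> * (\<beta> / (1 + \<beta>) * t) = \<beta> / (1 + \<beta>) * x powr (\<beta> - 1)"
    using assms by (simp add: t_def powr_diff)
  finally show ?thesis using assms by (simp add: field_simps)
qed

lemma card_lattice_box: "card (lattice_box L :: ('n::finite \<Rightarrow> int) set) = (2 * L + 1) ^ CARD('n)"
  unfolding lattice_box_eq_PiE by (subst card_PiE) (auto simp: nat_add_distrib nat_mult_distrib)

text \<open>Induction over shells of the maximum norm. The shell at \<open>x = L + 1\<close> has at
  most \<open>2 * d * (3 * x) ^ (d - 1)\<close> points, each of norm at least \<open>x\<close>; it
  contributes a multiple of \<open>x powr (\<beta> - 1)\<close>, which \<open>powr_diff_ge\<close>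
  turns into a telescoping difference.\<close>

lemma lattice_power_sum_le:
  fixes \<alpha> :: real
  assumes \<alpha>: "0 < \<alpha>" "\<alpha> < 1" and d: "CARD('n::finite) \<ge> 2"
  defines "\<beta> \<equiv> real CARD('n) - 1 - \<alpha>"
  shows "(\<Sum>m\<in>lattice_box L - {\<lambda>_. 0}. norm (lattice_vec m :: real^'n) powr (- 1 - \<alpha>))
     \<le> 2 * real CARD('n) * 3 ^ (CARD('n) - 1) * ((1 + \<beta>) / \<beta>) * real L powr \<beta>"
proof (induction L)
  case 0
  have "lattice_box 0 - {\<lambda>_. 0} = ({} :: ('n \<Rightarrow> int) set)" by (auto simp: lattice_box_def)
  then show ?case by (simp only:) simp
next
  case (Suc L)
  define d where "d = CARD('n)"
  have d2: "d \<ge> 2" using assms by (simp add: d_def)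
  have \<beta>0: "0 < \<beta>" using assms by simp
  define f where "f m = norm (lattice_vec m :: real^'n) powr (- 1 - \<alpha>)" for m
  define x where "x = real L + 1"
  have x1: "1 \<le> x" by (simp add: x_def)
  define N where "N = lattice_box (Suc L) - (lattice_box L :: ('n \<Rightarrow> int) set)"
  have sub: "lattice_box L \<subseteq> (lattice_box (Suc L) :: ('n \<Rightarrow> int) set)"
    unfolding lattice_box_def by (auto intro: order_trans)
  have z: "(\<lambda>_. 0) \<in> (lattice_box L :: ('n \<Rightarrow> int) set)" by (simp add: lattice_box_def)
  have "(\<Sum>m\<in>lattice_box (Suc L) - {\<lambda>_. 0}. f m) = (\<Sum>m\<in>lattice_box L - {\<lambda>_. 0}. f m) + (\<Sum>m\<in>N. f m)"
  proof -
    have "lattice_box (Suc L) - {\<lambda>_. 0} = (lattice_box L - {\<lambda>_. 0}) \<union> N" using sub z by (auto simp: N_def)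
    moreover have "(lattice_box L - {\<lambda>_. 0}) \<inter> N = {}" by (auto simp: N_def)
    ultimately show ?thesis by (simp add: sum.union_disjoint N_def)
  qed
  also have "(\<Sum>m\<in>N. f m) \<le> (\<Sum>m\<in>N. x powr (- 1 - \<alpha>))"
  proof (intro sum_mono)
    fix m assume "m \<in> N"
    then obtain i where "\<not> \<bar>m i\<bar> \<le> int L" by (auto simp: N_def lattice_box_def)
    then have "x \<le> \<bar>lattice_vec m $ i\<bar>" unfolding x_def lattice_vec_nth by linarith
    also have "\<dots> \<le> norm (lattice_vec m)" by (rule component_le_norm_cart)
    finally show "f m \<le> x powr (- 1 - \<alpha>)" unfolding f_def using x1 \<alpha> by (intro powr_mono2') auto
  qed
  also have "\<dots> = real (card N) * x powr (- 1 - \<alpha>)" by simp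
  also have "\<dots> \<le> (2 * real d * (3 * x) ^ (d - 1)) * x powr (- 1 - \<alpha>)"
  proof (intro mult_right_mono)
    define a b where "a = 2 * real L + 3" and "b = 2 * real L + 1"
    have ab: "0 < b" "b < a" "a \<le> 3 * x" by (auto simp: a_def b_def x_def)
    have "card N = (2 * L + 3) ^ d - (2 * L + 1) ^ d"
      unfolding N_def using sub by (subst card_Diff_subset) (auto simp: card_lattice_box d_def numeral_3_eq_3)
    then have "real (card N) = a ^ d - b ^ d"
      by (simp add: of_nat_diff power_mono a_def b_def add.commute)
    moreover have "a ^ d - b ^ d \<le> real d * (a - b) * a ^ (d - 1)"
      using ab d2 by (intro power_diff_le) auto
    moreover have "a - b = 2" by (simp add: a_def b_def)
    ultimately have "real (card N) \<le> 2 * real d * a ^ (d - 1)" by simp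
    also have "\<dots> \<le> 2 * real d * (3 * x) ^ (d - 1)" using ab by (intro mult_left_mono power_mono) auto
    finally show "real (card N) \<le> 2 * real d * (3 * x) ^ (d - 1)" .
  qed simp
  also have "\<dots> = 2 * real d * 3 ^ (d - 1) * x powr (\<beta> - 1)"
  proof -
    have "x ^ (d - 1) = x powr (real d - 1)" using x1 d2 by (simp add: powr_realpow[symmetric] of_nat_diff)
    then have "x ^ (d - 1) * x powr (- 1 - \<alpha>) = x powr (\<beta> - 1)"
      by (simp add: powr_add[symmetric] \<beta>_def d_def algebra_simps)
    then show ?thesis by (simp add: power_mult_distrib)
  qed
  also have "\<dots> \<le> 2 * real d * 3 ^ (d - 1) * ((1 + \<beta>) / \<beta> * (x powr \<beta> - (x - 1) powr \<beta>))"
    by (intro mult_left_mono powr_diff_ge x1 \<beta>0) auto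
  finally show ?case
    using Suc unfolding f_def d_def x_def by (simp add: algebra_simps)
qed

text \<open>The error on the tail of the kernel is absorbed with weight at most \<open>1/3\<close>, which is what
  makes the later iteration converge.\<close>

lemma kernel_average_compare:
  fixes \<Phi> p :: "real ^ 'n::finite \<Rightarrow> real"
  assumes nn: "\<And>x. 0 \<le> \<Phi> x" and mass: "(\<integral>x. indicator unit_cube x * \<Phi> x \<partial>lborel) = 1"
    and intT: "integrable lborel (\<lambda>x. indicator (unit_cube \<inter> {x. r < norm x}) x * \<Phi> x)"
    and tail: "(\<integral>x. indicator (unit_cube \<inter> {x. r < norm x}) x * \<Phi> x \<partial>lborel) \<le> 1/4"
    and intp: "integrable lborel (\<lambda>x. indicator unit_cube x * (\<Phi> x * p x))"
    and avg: "\<bar>(\<integral>x. indicator unit_cube x * (\<Phi> x * p x) \<partial>lborel) - A\<bar> \<le> E"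
    and e: "\<And>x. \<bar>p x - A\<bar> \<le> e"
    and N: "\<And>x. norm x \<le> r \<Longrightarrow> N \<le> p x"
  shows "N - A \<le> 4/3 * E + e / 3"
proof -
  define T where "T = unit_cube \<inter> {x::real^'n. r < norm x}"
  define \<tau> where "\<tau> = (\<integral>x. indicator T x * \<Phi> x \<partial>lborel)"
  have int1: "integrable lborel (\<lambda>x. indicator unit_cube x * \<Phi> x)"
    using mass not_integrable_integral_eq by fastforce
  have \<tau>: "0 \<le> \<tau>" "\<tau> \<le> 1/4"
    using tail nn unfolding \<tau>_def T_def by (auto intro!: Bochner_Integration.integral_nonneg)
  have e0: "0 \<le> e" using e[of 0] by linarith
  have E0: "0 \<le> E" using avg by linarith
  \<comment> \<open>A minorant of the averaged integrand: inside the cube it is the kernel times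
    \<open>N\<close> on the ball of radius \<open>r\<close>, and times \<open>A - e\<close> on the
    tail.\<close>
  define f where "f = (\<lambda>x. N * (indicator unit_cube x * \<Phi> x) + (A - e - N) * (indicator T x * \<Phi> x))"
  have fi: "integrable lborel f"
    unfolding f_def T_def by (intro Bochner_Integration.integrable_add integrable_mult_right int1 intT)
  have "(\<integral>x. f x \<partial>lborel) = N * 1 + (A - e - N) * \<tau>"
  proof -
    have "(\<integral>x. f x \<partial>lborel) = (\<integral>x. N * (indicator unit_cube x * \<Phi> x) \<partial>lborel)
       + (\<integral>x. (A - e - N) * (indicator T x * \<Phi> x) \<partial>lborel)"
      unfolding f_def T_def by (intro Bochner_Integration.integral_add integrable_mult_right int1 intT)
    then show ?thesis by (simp only: integral_mult_right_zero mass \<tau>_def)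
  qed
  moreover have "(\<integral>x. f x \<partial>lborel) \<le> (\<integral>x. indicator unit_cube x * (\<Phi> x * p x) \<partial>lborel)"
  proof (rule integral_mono[OF fi intp])
    fix x :: "real ^ 'n"
    show "f x \<le> indicator unit_cube x * (\<Phi> x * p x)"
    proof (cases "x \<in> unit_cube")
      case False
      then show ?thesis by (simp add: f_def T_def)
    next
      case True
      show ?thesis
      proof (cases "norm x \<le> r")
        case le: True
        then have "\<Phi> x * N \<le> \<Phi> x * p x" using N nn by (intro mult_left_mono) auto
        then show ?thesis using True le by (simp add: f_def T_def mult.commute)
      next
        case False
        have "A - e \<le> p x" using e[of x] by linarith
        then have "\<Phi> x * (A - e) \<le> \<Phi> x * p x" using nn by (intro mult_left_mono) auto
        then show ?thesis using True False by (simp add: f_def T_def algebra_simps)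
      qed
    qed
  qed
  moreover have "(\<integral>x. indicator unit_cube x * (\<Phi> x * p x) \<partial>lborel) \<le> A + E" using avg by linarith
  ultimately have le: "(N - A) * (1 - \<tau>) \<le> E + e * \<tau>" by (simp add: algebra_simps)
  have "N - A \<le> (E + e * \<tau>) / (1 - \<tau>)" using le \<tau> by (simp add: pos_le_divide_eq)
  \<comment> \<open>Tail mass at most \<open>1/4\<close> leaves a denominator of at least
    \<open>3/4\<close>; this is where \<open>4/3\<close> and \<open>1/3\<close> come from.\<close>
  also have "\<dots> \<le> (E + e * (1/4)) / (1 - 1/4)"
    using \<tau> e0 E0 by (intro frac_le add_mono mult_left_mono) auto
  finally show ?thesis by simp
qed

section \<open>Dilates and translates of the body\<close>

definition dilated :: "(real ^ 'n::finite) set \<Rightarrow> real \<Rightarrow> real ^ 'n \<Rightarrow> (real ^ 'n) set" where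
  "dilated K k y = {w. y + w \<in> (*\<^sub>R) k ` K}"

lemma dilated_eq_image: "dilated K k y = (\<lambda>x. - y + x) ` ((*\<^sub>R) k ` K)"
proof
  show "dilated K k y \<subseteq> (\<lambda>x. - y + x) ` ((*\<^sub>R) k ` K)"
  proof
    fix w assume "w \<in> dilated K k y"
    then have "y + w \<in> (*\<^sub>R) k ` K" by (simp add: dilated_def)
    then show "w \<in> (\<lambda>x. - y + x) ` ((*\<^sub>R) k ` K)" by (rule rev_image_eqI) simp
  qed
qed (auto simp: dilated_def)

lemma compact_dilated: "compact K \<Longrightarrow> compact (dilated K k y)"
  unfolding dilated_eq_image by (intro compact_translation compact_scaling)

lemma measure_dilated:
  assumes "compact K" "0 < k"
  shows "measure lborel (dilated K k y :: (real ^ 'n::finite) set) = k ^ CARD('n) * measure lebesgue K"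
proof -
  have K: "K \<in> sets borel" using assms(1) by (rule borel_compact)
  have D: "dilated K k y \<in> sets borel" using compact_dilated[OF assms(1)] by (rule borel_compact)
  have "measure lborel (dilated K k y) = (\<integral>x. indicator ((*\<^sub>R) k ` K) (y + x) \<partial>lborel)"
  proof -
    have "(\<lambda>x. indicator ((*\<^sub>R) k ` K) (y + x) :: real) = indicator (dilated K k y)"
      by (auto simp: dilated_def indicator_def fun_eq_iff)
    then show ?thesis using D by simp
  qed
  also have "\<dots> = k ^ DIM(real^'n) * (\<integral>x. indicator K x \<partial>lborel)"
    using integral_scaled_shifted_cos[OF K assms(2), of y 0 0] by simp
  also have "(\<integral>x. indicator K x \<partial>lborel) = measure lebesgue K"
    using K by (simp add: measure_completion)
  finally show ?thesis by simp
qed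

text \<open>Convexity gives \<open>k K + s K \<subseteq> (k + s) K\<close>, and the ball of radius
  \<open>r\<close> lies in \<open>s K\<close> for \<open>s = r / \<rho>\<close>; so a displacement
  of size \<open>r\<close> is absorbed by a slightly larger dilate.\<close>

lemma dilated_mono:
  assumes K: "convex K" "cball 0 \<rho> \<subseteq> K" and \<rho>: "0 < \<rho>" and k: "0 < k" and x: "norm x \<le> r"
    and w: "w \<in> dilated K k y"
  shows "w + x \<in> dilated K (k + r / \<rho>) y"
proof (cases "r = 0")
  case True then show ?thesis using x w by simp
next
  case False
  have r: "0 < r" using x False norm_ge_zero[of x] by linarith
  define s where "s = r / \<rho>"
  have s: "0 < s" using r \<rho> by (simp add: s_def)
  obtain a where a: "a \<in> K" "y + w = k *\<^sub>R a" using w by (auto simp: dilated_def)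
  have "norm ((1 / s) *\<^sub>R x) \<le> \<rho>" using x s r \<rho> by (simp add: s_def field_simps)
  then have b: "(1 / s) *\<^sub>R x \<in> K" using K(2) by (auto simp: dist_norm)
  have m1: "(k / (k + s)) *\<^sub>R a + (s / (k + s)) *\<^sub>R ((1 / s) *\<^sub>R x) \<in> K"
    using k s by (intro convexD[OF K(1) a(1) b]) (auto simp: add_divide_distrib[symmetric])
  have m2: "y + (w + x) = (k + s) *\<^sub>R ((k / (k + s)) *\<^sub>R a + (s / (k + s)) *\<^sub>R ((1 / s) *\<^sub>R x))"
    using k s a(2) by (simp add: scaleR_right_distrib add.assoc[symmetric])
  show ?thesis unfolding dilated_def mem_Collect_eq s_def[symmetric] m2 by (rule imageI[OF m1])
qed

text \<open>An interval of length \<open>2 * R * k\<close> holds at most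
  \<open>2 * R * k + 1\<close> integers wherever it lies, so the bound is uniform in
  \<open>x\<close> and \<open>y\<close>.\<close>

lemma
  fixes K :: "(real ^ 'n::finite) set"
  assumes R: "\<And>z. z \<in> K \<Longrightarrow> norm z \<le> R" "0 \<le> R" and k: "0 \<le> k"
  shows finite_lattice_dilated: "finite {m. lattice_vec m + x \<in> dilated K k y}"
    and point_count_dilated_le: "real (point_count (dilated K k y) x) \<le> (2 * R * k + 1) ^ CARD('n)"
proof -
  define J where "J i = {\<lceil>- (R * k) - y $ i - x $ i\<rceil>..\<lfloor>R * k - y $ i - x $ i\<rfloor>}" for i
  have sub: "{m. lattice_vec m + x \<in> dilated K k y} \<subseteq> PiE UNIV J"
  proof
    fix m assume "m \<in> {m. lattice_vec m + x \<in> dilated K k y}"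
    then obtain a where a: "a \<in> K" "y + (lattice_vec m + x) = k *\<^sub>R a" by (auto simp: dilated_def)
    have "m i \<in> J i" for i
    proof -
      have "\<bar>(y + (lattice_vec m + x)) $ i\<bar> \<le> norm (k *\<^sub>R a)"
        unfolding a(2) by (rule component_le_norm_cart)
      also have "\<dots> \<le> R * k" using mult_left_mono[OF R(1)[OF a(1)] k] k by (simp add: mult.commute)
      finally have "\<bar>y $ i + (real_of_int (m i) + x $ i)\<bar> \<le> R * k" by simp
      then have "- (R * k) - y $ i - x $ i \<le> real_of_int (m i)" "real_of_int (m i) \<le> R * k - y $ i - x $ i"
        by linarith+
      then show ?thesis by (simp add: J_def ceiling_le_iff le_floor_iff)
    qed
    then show "m \<in> PiE UNIV J" by auto
  qed
  have fin: "finite (PiE UNIV J)" by (intro finite_PiE) (auto simp: J_def)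
  then show "finite {m. lattice_vec m + x \<in> dilated K k y}" using sub finite_subset by blast
  have "real (point_count (dilated K k y) x) \<le> real (card (PiE UNIV J))"
    unfolding point_count_def using card_mono[OF fin sub] by simp
  also have "\<dots> = (\<Prod>i\<in>UNIV. real (card (J i)))" by (simp add: card_PiE)
  also have "\<dots> \<le> (\<Prod>i\<in>(UNIV::'n set). 2 * R * k + 1)"
  proof (intro prod_mono conjI)
    fix i
    have "0 \<le> R * k" using R k by simp
    then have "real (nat (\<lfloor>R * k - y $ i - x $ i\<rfloor> - \<lceil>- (R * k) - y $ i - x $ i\<rceil> + 1)) \<le> 2 * R * k + 1"
      by linarith
    then show "real (card (J i)) \<le> 2 * R * k + 1" by (simp add: J_def)
  qed simp
  finally show "real (point_count (dilated K k y) x) \<le> (2 * R * k + 1) ^ CARD('n)" by simp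
qed

lemma point_count_dilated_mono:
  fixes K :: "(real ^ 'n::finite) set"
  assumes K: "compact K" "convex K" "cball 0 \<rho> \<subseteq> K" and \<rho>: "0 < \<rho>" and k: "0 < k" and x: "norm x \<le> r"
  shows "point_count (dilated K k y) z \<le> point_count (dilated K (k + r / \<rho>) y) (z + x)"
proof -
  obtain R where R: "\<And>z. z \<in> K \<Longrightarrow> norm z \<le> R" "0 < R"
    using compact_imp_bounded[OF K(1)] unfolding bounded_pos by auto
  have r: "0 \<le> r / \<rho>" using x \<rho> norm_ge_zero[of x] by (intro divide_nonneg_pos) linarith+
  show ?thesis unfolding point_count_def
  proof (rule card_mono)
    show "finite {m. lattice_vec m + (z + x) \<in> dilated K (k + r / \<rho>) y}"
      using R r k by (intro finite_lattice_dilated[of K R]) auto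
    show "{m. lattice_vec m + z \<in> dilated K k y} \<subseteq> {m. lattice_vec m + (z + x) \<in> dilated K (k + r / \<rho>) y}"
      using dilated_mono[OF K(2,3) \<rho> k x] by (auto simp: add.assoc[symmetric])
  qed
qed

text \<open>Sampling at \<open>x\<close> amounts to translating the body further by
  \<open>x\<close>. This turns an error bound at \<open>0\<close> for all translates into the bound
  at all points that the kernel comparison asks for.\<close>

lemma point_count_dilated_shift: "point_count (dilated K k y) x = point_count (dilated K k (y + x)) 0"
  unfolding point_count_def dilated_def by (simp add: add_ac)

text \<open>For \<open>norm x \<le> r\<close> the count at dilation \<open>k\<close> is at most the
  one at \<open>k + r / \<rho>\<close> sampled at \<open>x\<close>, and at least the one at
  \<open>k - r / \<rho>\<close>; the kernel comparison is therefore applied at these two dilations.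
  There the Fourier decay, summed over the box of frequencies, bounds the deviation of the average
  from the volume.\<close>

lemma point_count_error_step:
  fixes K :: "(real ^ 'n::finite) set" and \<alpha> \<rho> :: real and L :: nat
  assumes K: "compact K" "convex K" "cball 0 \<rho> \<subseteq> K" and \<rho>: "0 < \<rho>" and d: "CARD('n) \<ge> 2"
    and \<alpha>: "0 < \<alpha>" "\<alpha> < 1" and C1: "0 \<le> C1"
    and decay: "\<And>(v :: real ^ 'n) t \<psi>. norm v = 1 \<Longrightarrow> 0 < t \<Longrightarrow>
       \<bar>\<integral>x. indicator K x * cos (t * (x \<bullet> v) + \<psi>) \<partial>lborel\<bar> \<le> C1 * t powr (- 1 - \<alpha>)"
    and L: "1 \<le> L"
  defines "\<beta> \<equiv> real CARD('n) - 1 - \<alpha>"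
  defines "C2 \<equiv> 2 * real CARD('n) * 3 ^ (CARD('n) - 1) * ((1 + \<beta>) / \<beta>)"
  defines "r \<equiv> 2 * real CARD('n) / (real L + 1)"
  defines "err \<equiv> \<lambda>k y. real (point_count (dilated K k y) 0) - k ^ CARD('n) * measure lebesgue K"
  shows "\<And>k y e. 0 < k \<Longrightarrow> (\<And>y. \<bar>err (k + r / \<rho>) y\<bar> \<le> e) \<Longrightarrow>
      real (point_count (dilated K k y) 0) - (k + r / \<rho>) ^ CARD('n) * measure lebesgue K
        \<le> 4/3 * (C1 * C2 * ((k + r / \<rho>) * real L) powr \<beta>) + e / 3"
    and "\<And>k y e. 0 < k - r / \<rho> \<Longrightarrow> (\<And>y. \<bar>err (k - r / \<rho>) y\<bar> \<le> e) \<Longrightarrow>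
      (k - r / \<rho>) ^ CARD('n) * measure lebesgue K - real (point_count (dilated K k y) 0)
        \<le> 4/3 * (C1 * C2 * ((k - r / \<rho>) * real L) powr \<beta>) + e / 3"
proof -
  define V where "V = measure lebesgue K"
  obtain c :: "('n \<Rightarrow> int) \<Rightarrow> real" and \<Phi> :: "real ^ 'n \<Rightarrow> real" where
    \<Phi>: "\<And>x. \<Phi> x = (\<Sum>m\<in>lattice_box L. c m * cos (2 * pi * (lattice_vec m \<bullet> x)))"
    and nn: "\<And>x. 0 \<le> \<Phi> x" and c: "c (\<lambda>_. 0) = 1" "\<And>m. \<bar>c m\<bar> \<le> 1"
    and mass: "(\<integral>x. indicator unit_cube x * \<Phi> x \<partial>lborel) = 1"
    and mom: "\<And>i. (\<integral>x. indicator unit_cube x * (\<Phi> x * (1 - cos (2 * pi * x $ i))) \<partial>lborel) = 1 - cos (pi / (real L + 1))"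
    by (rule exists_cube_kernel[OF L]) (rule that, assumption+)
  have meas: "\<Phi> \<in> borel_measurable borel"
    unfolding \<Phi>[abs_def] by measurable
  have abs\<Phi>: "\<bar>\<Phi> x\<bar> \<le> real (card (lattice_box L :: ('n \<Rightarrow> int) set))" for x
  proof -
    have "\<bar>\<Phi> x\<bar> \<le> (\<Sum>m\<in>lattice_box L. \<bar>c m * cos (2 * pi * (lattice_vec m \<bullet> x))\<bar>)"
      unfolding \<Phi> by (rule sum_abs)
    also have "\<dots> \<le> (\<Sum>m\<in>(lattice_box L :: ('n \<Rightarrow> int) set). 1)"
      using c(2) by (intro sum_mono) (simp add: abs_mult mult_le_one)
    finally show ?thesis by simp
  qed
  have r: "0 < r" using d by (simp add: r_def)
  define T where "T = unit_cube \<inter> {x::real^'n. r < norm x}"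
  have T: "T \<in> sets borel"
  proof -
    have "{x::real^'n. r < norm x} \<in> sets borel"
      by (intro borel_open open_Collect_less continuous_intros)
    then show ?thesis unfolding T_def by (intro sets.Int unit_cube_borel)
  qed
  have intT: "integrable lborel (\<lambda>x. indicator T x * \<Phi> x)"
    using bounded_unit_cube T_def abs\<Phi>
    by (intro integrable_bounded_on[OF T _ meas, where B = "real (card (lattice_box L :: ('n \<Rightarrow> int) set))"])
       (auto intro: bounded_subset)
  \<comment> \<open>The radius \<open>r = 2 * d / (L + 1)\<close> is matched to the moment
    \<open>1 - cos \<theta> \<le> \<theta>^2 / 2\<close> with
    \<open>\<theta> = pi / (L + 1)\<close>: the powers of \<open>L + 1\<close> cancel and
    \<open>pi^2 / (64 * d)\<close> remains.\<close>
  have tail: "(\<integral>x. indicator T x * \<Phi> x \<partial>lborel) \<le> 1/4"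
  proof -
    define \<theta> where "\<theta> = pi / (real L + 1)"
    have "(\<integral>x. indicator T x * \<Phi> x \<partial>lborel) \<le> real CARD('n) * (1 - cos \<theta>) / (8 * r\<^sup>2)"
      unfolding T_def \<theta>_def
    proof (rule kernel_tail_le[OF nn meas _ mom r])
      show "\<Phi> x \<le> real (card (lattice_box L :: ('n \<Rightarrow> int) set))" for x using abs\<Phi>[of x] by linarith
    qed
    also have "1 - cos \<theta> \<le> \<theta>\<^sup>2 / 2"
    proof -
      have "\<bar>sin (\<theta> / 2)\<bar> \<le> \<bar>\<theta> / 2\<bar>" by (rule abs_sin_x_le_abs_x)
      then have "(sin (\<theta> / 2))\<^sup>2 \<le> (\<theta> / 2)\<^sup>2" by (simp only: abs_le_square_iff)
      moreover have "cos \<theta> = 1 - 2 * (sin (\<theta> / 2))\<^sup>2" using cos_double_sin[of "\<theta> / 2"] by simp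
      ultimately show ?thesis by (simp add: power_divide)
    qed
    then have "real CARD('n) * (1 - cos \<theta>) / (8 * r\<^sup>2) \<le> real CARD('n) * (\<theta>\<^sup>2 / 2) / (8 * r\<^sup>2)"
      by (intro divide_right_mono mult_left_mono) auto
    also have "\<dots> = pi\<^sup>2 / (64 * real CARD('n))"
      using d unfolding \<theta>_def r_def by (simp add: power_divide power_mult_distrib power2_eq_square)
    also have "\<dots> \<le> 4\<^sup>2 / (64 * real CARD('n))"
      using pi_less_4 by (intro divide_right_mono power_mono) auto
    also have "\<dots> \<le> 1/4" using d by (simp add: field_simps)
    finally show ?thesis by simp
  qed
  have \<beta>0: "0 < \<beta>" using d \<alpha> by (simp add: \<beta>_def)
  have avg: "\<bar>(\<integral>x. indicator unit_cube x * (\<Phi> x * real (point_count (dilated K k y) x)) \<partial>lborel) - k ^ CARD('n) * V\<bar>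
     \<le> C1 * C2 * (k * real L) powr \<beta>" if k: "0 < k" for k y
  proof -
    have D: "dilated K k y \<in> sets borel" "bounded (dilated K k y)"
      using compact_dilated[OF K(1)] by (auto intro: borel_compact compact_imp_bounded)
    have "\<bar>(\<integral>x. indicator unit_cube x * (\<Phi> x * real (point_count (dilated K k y) x)) \<partial>lborel) - measure lborel (dilated K k y)\<bar>
      \<le> (\<Sum>m\<in>lattice_box L - {\<lambda>_. 0}. \<bar>\<integral>x. indicator (dilated K k y) x * cos (2 * pi * (lattice_vec m \<bullet> x)) \<partial>lborel\<bar>)"
      by (rule kernel_average_point_count[OF D \<Phi> c])
    also have "\<dots> \<le> (\<Sum>m\<in>lattice_box L - {\<lambda>_. 0}. C1 * k powr \<beta> * norm (lattice_vec m :: real^'n) powr (- 1 - \<alpha>))"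
    proof (intro sum_mono)
      fix m :: "'n \<Rightarrow> int" assume "m \<in> lattice_box L - {\<lambda>_. 0}"
      then have "m \<noteq> (\<lambda>_. 0)" by simp
      then have nz: "lattice_vec m \<noteq> (0 :: real^'n)" by (auto simp: vec_eq_iff fun_eq_iff)
      define w where "w = (2 * pi) *\<^sub>R (lattice_vec m :: real^'n)"
      have w: "w \<noteq> 0" using nz by (simp add: w_def)
      have "(\<integral>x. indicator (dilated K k y) x * cos (2 * pi * (lattice_vec m \<bullet> x)) \<partial>lborel)
          = (\<integral>x. indicator ((*\<^sub>R) k ` K) (y + x) * cos (w \<bullet> x + 0) \<partial>lborel)"
        by (simp add: w_def dilated_def indicator_def mult.assoc)
      then have "\<bar>\<integral>x. indicator (dilated K k y) x * cos (2 * pi * (lattice_vec m \<bullet> x)) \<partial>lborel\<bar>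
          \<le> C1 * k powr (real DIM(real^'n) - 1 - \<alpha>) * norm w powr (- 1 - \<alpha>)"
        using fourier_decay_scaled[OF K(1) k w decay, of y 0] by simp
      also have "\<dots> \<le> C1 * k powr \<beta> * norm (lattice_vec m :: real^'n) powr (- 1 - \<alpha>)"
      proof -
        have "1 * norm (lattice_vec m :: real^'n) \<le> (2 * pi) * norm (lattice_vec m :: real^'n)"
          using pi_ge_two by (intro mult_right_mono) auto
        then have "norm (lattice_vec m :: real^'n) \<le> norm w" by (simp add: w_def)
        then have "norm w powr (- 1 - \<alpha>) \<le> norm (lattice_vec m :: real^'n) powr (- 1 - \<alpha>)"
          using nz \<alpha> by (intro powr_mono2') auto
        then show ?thesis using C1 by (simp add: \<beta>_def mult_left_mono)
      qed
      finally show "\<bar>\<integral>x. indicator (dilated K k y) x * cos (2 * pi * (lattice_vec m \<bullet> x)) \<partial>lborel\<bar>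
          \<le> C1 * k powr \<beta> * norm (lattice_vec m :: real^'n) powr (- 1 - \<alpha>)" .
    qed
    also have "\<dots> = C1 * k powr \<beta> * (\<Sum>m\<in>lattice_box L - {\<lambda>_. 0}. norm (lattice_vec m :: real^'n) powr (- 1 - \<alpha>))"
      by (simp add: sum_distrib_left)
    also have "\<dots> \<le> C1 * k powr \<beta> * (C2 * real L powr \<beta>)"
      unfolding C2_def \<beta>_def using C1 by (intro mult_left_mono lattice_power_sum_le \<alpha> d) auto
    also have "\<dots> = C1 * C2 * (k * real L) powr \<beta>" using k by (simp add: powr_mult)
    finally show ?thesis by (simp add: measure_dilated[OF K(1) k] V_def)
  qed
  have intp: "integrable lborel (\<lambda>x. indicator unit_cube x * (\<Phi> x * real (point_count (dilated K k y) x)))" for k y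
    using compact_dilated[OF K(1)]
    by (intro integrable_point_count[OF _ _ meas abs\<Phi>]) (auto intro: borel_compact compact_imp_bounded)
  have rr: "0 < r / \<rho>" using r \<rho> by simp
  show "real (point_count (dilated K k y) 0) - (k + r / \<rho>) ^ CARD('n) * measure lebesgue K
        \<le> 4/3 * (C1 * C2 * ((k + r / \<rho>) * real L) powr \<beta>) + e / 3"
    if k: "0 < k" and e: "\<And>y. \<bar>err (k + r / \<rho>) y\<bar> \<le> e" for k y e
  proof -
    have k': "0 < k + r / \<rho>" using k rr by linarith
    show ?thesis
      unfolding V_def[symmetric]
    proof (rule kernel_average_compare[OF nn mass intT[unfolded T_def] tail[unfolded T_def] intp avg[OF k']])
      fix x :: "real ^ 'n"
      show "\<bar>real (point_count (dilated K (k + r / \<rho>) y) x) - (k + r / \<rho>) ^ CARD('n) * V\<bar> \<le> e"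
        using e[of "y + x"] unfolding err_def V_def point_count_dilated_shift[of K _ y x] .
      assume "norm x \<le> r"
      then show "real (point_count (dilated K k y) 0) \<le> real (point_count (dilated K (k + r / \<rho>) y) x)"
        using point_count_dilated_mono[OF K \<rho> k, of x r y 0] by simp
    qed
  qed
  show "(k - r / \<rho>) ^ CARD('n) * measure lebesgue K - real (point_count (dilated K k y) 0)
        \<le> 4/3 * (C1 * C2 * ((k - r / \<rho>) * real L) powr \<beta>) + e / 3"
    if k': "0 < k - r / \<rho>" and e: "\<And>y. \<bar>err (k - r / \<rho>) y\<bar> \<le> e" for k y e
  proof -
    define k2 where "k2 = k - r / \<rho>"
    have k2: "0 < k2" "k2 + r / \<rho> = k" using k' by (auto simp: k2_def)
    \<comment> \<open>The lower bound is the same one-sided comparison, applied to the negated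
      counts.\<close>
    have "- real (point_count (dilated K k y) 0) - (- (k2 ^ CARD('n) * V))
        \<le> 4/3 * (C1 * C2 * (k2 * real L) powr \<beta>) + e / 3"
    proof (rule kernel_average_compare[where p = "\<lambda>x. - real (point_count (dilated K k2 y) x)",
            OF nn mass intT[unfolded T_def] tail[unfolded T_def]])
      show "integrable lborel (\<lambda>x. indicator unit_cube x * (\<Phi> x * - real (point_count (dilated K k2 y) x)))"
        using intp[of k2 y] by simp
      show "\<bar>(\<integral>x. indicator unit_cube x * (\<Phi> x * - real (point_count (dilated K k2 y) x)) \<partial>lborel) - - (k2 ^ CARD('n) * V)\<bar>
          \<le> C1 * C2 * (k2 * real L) powr \<beta>"
        using avg[OF k2(1), of y] by simp
      fix x :: "real ^ 'n"
      show "\<bar>- real (point_count (dilated K k2 y) x) - - (k2 ^ CARD('n) * V)\<bar> \<le> e"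
        using e[of "y + x"] unfolding err_def V_def point_count_dilated_shift[of K _ y x] k2_def by linarith
      assume "norm x \<le> r"
      then show "- real (point_count (dilated K k y) 0) \<le> - real (point_count (dilated K k2 y) x)"
        using point_count_dilated_mono[OF K \<rho> k2(1), of "- x" r y x] k2(2) by simp
    qed
    then show ?thesis unfolding V_def k2_def by linarith
  qed
qed

text \<open>The estimate \<open>step\<close> bounds the error at \<open>k\<close> by
  \<open>C5 * k powr \<gamma>\<close> plus a third of any bound valid for all translates and all
  dilations from \<open>1\<close> to \<open>(1 + \<eta>) * k\<close>. Iteration starts from the
  trivial bound of order \<open>k ^ d\<close> and halves that part in every round, so at fixed
  \<open>k\<close> it disappears in the limit.\<close>

lemma point_count_error_le:
  fixes K :: "(real ^ 'n::finite) set" and \<alpha> \<rho> :: real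
  assumes K: "compact K" "convex K" "cball 0 \<rho> \<subseteq> K" and \<rho>: "0 < \<rho>" and d: "CARD('n) \<ge> 2"
    and \<alpha>: "0 < \<alpha>" "\<alpha> < 1" and C1: "0 \<le> C1"
    and decay: "\<And>(v :: real ^ 'n) t \<psi>. norm v = 1 \<Longrightarrow> 0 < t \<Longrightarrow>
       \<bar>\<integral>x. indicator K x * cos (t * (x \<bullet> v) + \<psi>) \<partial>lborel\<bar> \<le> C1 * t powr (- 1 - \<alpha>)"
  obtains B where "\<And>k. 1 \<le> k \<Longrightarrow>
    \<bar>real (point_count (dilated K k 0) 0) - k ^ CARD('n) * measure lebesgue K\<bar>
      \<le> B * k powr (real CARD('n) - 1 - \<alpha> / (real CARD('n) - \<alpha>))"
proof -
  define dr where "dr = real CARD('n)"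
  define V where "V = measure lebesgue K"
  define \<delta> where "\<delta> = \<alpha> / (dr - \<alpha>)"
  define \<beta> where "\<beta> = dr - 1 - \<alpha>"
  define \<gamma> where "\<gamma> = dr - 1 - \<delta>"
  define C2 where "C2 = 2 * dr * 3 ^ (CARD('n) - 1) * ((1 + \<beta>) / \<beta>)"
  define err where "err k y = real (point_count (dilated K k y) 0) - k ^ CARD('n) * V" for k y
  have dr: "2 \<le> dr" "1 \<le> CARD('n)" using d by (auto simp: dr_def)
  have V0: "0 \<le> V" by (simp add: V_def)
  have \<delta>: "0 < \<delta>" "\<delta> < 1" using dr \<alpha> by (auto simp: \<delta>_def field_simps)
  have \<beta>: "0 < \<beta>" using dr \<alpha> by (simp add: \<beta>_def)
  have C2: "0 \<le> C2" unfolding C2_def using dr \<beta> by simp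
  have \<gamma>: "0 < \<gamma>" "\<gamma> \<le> dr" using dr \<delta> by (auto simp: \<gamma>_def)
  have \<gamma>eq: "\<gamma> = \<beta> * (1 + \<delta>)"
  proof -
    have "dr - \<alpha> \<noteq> 0" using dr \<alpha> by simp
    then show ?thesis unfolding \<gamma>_def \<beta>_def \<delta>_def by (simp add: field_simps)
  qed
  \<comment> \<open>By Bernoulli this value gives \<open>(1 - \<eta>) ^ d \<ge> 2/3\<close>, hence
    \<open>(1 + \<eta>) ^ d \<le> 3/2\<close>; multiplied by the weight \<open>1/3\<close> this is
    the factor \<open>1/2\<close> of the iteration.\<close>
  define \<eta> where "\<eta> = 1 / (3 * dr)"
  have \<eta>: "0 < \<eta>" "\<eta> \<le> 1/3" using dr by (auto simp: \<eta>_def field_simps)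
  have \<eta>pow: "(1 + \<eta>) ^ CARD('n) \<le> 3/2"
  proof -
    have "1 + real CARD('n) * (- \<eta>) \<le> (1 + (- \<eta>)) ^ CARD('n)"
      using \<eta> by (intro Bernoulli_inequality) simp
    then have "2/3 \<le> (1 - \<eta>) ^ CARD('n)" using dr by (simp add: \<eta>_def dr_def)
    then have "(1 + \<eta>) ^ CARD('n) * (2/3) \<le> (1 + \<eta>) ^ CARD('n) * (1 - \<eta>) ^ CARD('n)"
      using \<eta> by (intro mult_left_mono) auto
    also have "\<dots> = ((1 + \<eta>) * (1 - \<eta>)) ^ CARD('n)" by (simp only: power_mult_distrib)
    also have "\<dots> \<le> 1"
    proof (rule power_le_one)
      show "0 \<le> (1 + \<eta>) * (1 - \<eta>)" using \<eta> by (intro mult_nonneg_nonneg) auto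
      show "(1 + \<eta>) * (1 - \<eta>) \<le> 1" by (simp add: algebra_simps)
    qed
    finally show ?thesis by simp
  qed
  have \<eta>powr: "(1 + \<eta>) powr \<gamma> \<le> 3/2"
  proof -
    have "(1 + \<eta>) powr \<gamma> \<le> (1 + \<eta>) powr dr" using \<eta> \<gamma> by (intro powr_mono) auto
    also have "\<dots> = (1 + \<eta>) ^ CARD('n)" using \<eta> unfolding dr_def by (subst powr_realpow) auto
    finally show ?thesis using \<eta>pow by linarith
  qed
  obtain R where R: "\<And>z. z \<in> K \<Longrightarrow> norm z \<le> R" "0 < R"
    using compact_imp_bounded[OF K(1)] unfolding bounded_pos by auto
  define C0 where "C0 = (2 * R + 1) ^ CARD('n) + V"
  have C0: "0 \<le> C0" using R V0 by (simp add: C0_def)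
  have trivial: "\<bar>err k y\<bar> \<le> C0 * k ^ CARD('n)" if k: "1 \<le> k" for k y
  proof -
    have "real (point_count (dilated K k y) 0) \<le> (2 * R * k + 1) ^ CARD('n)"
      using R k by (intro point_count_dilated_le) auto
    also have "\<dots> \<le> ((2 * R + 1) * k) ^ CARD('n)"
      using R k by (intro power_mono) (auto simp: algebra_simps)
    finally have "real (point_count (dilated K k y) 0) \<le> (2 * R + 1) ^ CARD('n) * k ^ CARD('n)"
      by (simp only: power_mult_distrib)
    moreover have "0 \<le> k ^ CARD('n) * V" using k V0 by simp
    ultimately show ?thesis unfolding err_def C0_def by (simp add: algebra_simps)
  qed
  \<comment> \<open>A minimal degree that forces the change of dilation \<open>s\<close> below
    \<open>\<eta>\<close> even when \<open>k powr \<delta>\<close> is small.\<close>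
  define L0 where "L0 = nat \<lceil>2 * dr / (\<rho> * \<eta>)\<rceil> + 1"
  define CE where "CE = C1 * C2 * (2 * (real L0 + 2)) powr \<beta>"
  define CV where "CV = V * dr * 2 ^ (CARD('n) - 1) * (2 * dr / \<rho>)"
  define C5 where "C5 = 4/3 * CE + CV"
  have CE0: "0 \<le> CE" using C1 C2 by (simp add: CE_def)
  have CV0: "0 \<le> CV" using V0 dr \<rho> by (simp add: CV_def)
  \<comment> \<open>The restriction \<open>2 \<le> k\<close> keeps \<open>k - s\<close> at least
    \<open>1\<close>, since \<open>s \<le> \<eta> \<le> 1/3\<close>; smaller \<open>k\<close> are
    left to \<open>trivial\<close>.\<close>
  have step: "\<bar>err k y\<bar> \<le> C5 * k powr \<gamma> + e / 3"
    if k: "2 \<le> k" and e: "\<And>k' y. 1 \<le> k' \<Longrightarrow> k' \<le> (1 + \<eta>) * k \<Longrightarrow> \<bar>err k' y\<bar> \<le> e" for k y e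
  proof -
    define L where "L = L0 + nat \<lceil>k powr \<delta>\<rceil>"
    define s where "s = 2 * dr / (real L + 1) / \<rho>"
    have L1: "1 \<le> L" by (simp add: L_def L0_def)
    have kd: "1 \<le> k powr \<delta>" using k \<delta> by (simp add: ge_one_powr_ge_zero)
    have Llow: "k powr \<delta> \<le> real L" unfolding L_def by linarith
    have Lup: "real L \<le> (real L0 + 2) * k powr \<delta>"
    proof -
      have "real L \<le> real L0 + (k powr \<delta> + 1)" unfolding L_def using kd by linarith
      also have "\<dots> \<le> real L0 * k powr \<delta> + (k powr \<delta> + k powr \<delta>)"
        using kd mult_left_mono[OF kd, of "real L0"] by simp
      finally show ?thesis by (simp add: algebra_simps)
    qed
    have s0: "0 < s" using dr \<rho> by (simp add: s_def)
    have s\<eta>: "s \<le> \<eta>"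
    proof -
      have "2 * dr / (\<rho> * \<eta>) \<le> real L + 1" unfolding L_def L0_def by linarith
      then have "2 * dr \<le> (real L + 1) * (\<rho> * \<eta>)" using \<rho> \<eta> by (simp add: pos_divide_le_eq)
      moreover have "0 < (real L + 1) * \<rho>" using \<rho> by (intro mult_pos_pos) auto
      ultimately show ?thesis
        unfolding s_def divide_divide_eq_left by (simp only: pos_divide_le_eq) (simp only: mult_ac)
    qed
    have sk: "s \<le> 2 * dr / \<rho> * k powr (- \<delta>)"
    proof -
      have "s \<le> 2 * dr / (k powr \<delta>) / \<rho>"
        unfolding s_def using Llow kd dr \<rho> by (intro divide_right_mono divide_left_mono mult_pos_pos) auto
      then show ?thesis using k by (simp add: powr_minus divide_inverse mult_ac)
    qed
    have \<eta>k: "\<eta> \<le> \<eta> * k" "(1 + \<eta>) * k = k + \<eta> * k" using k \<eta> by (auto simp: algebra_simps)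
    have lo: "0 < k - s" "1 \<le> k - s" "k - s \<le> (1 + \<eta>) * k" "k - s \<le> 2 * k"
      using k s0 s\<eta> \<eta> \<eta>k by linarith+
    have hi: "0 < k + s" "1 \<le> k + s" "k + s \<le> (1 + \<eta>) * k" "k + s \<le> 2 * k"
      using k s0 s\<eta> \<eta> \<eta>k by linarith+
    have E: "C1 * C2 * (k' * real L) powr \<beta> \<le> CE * k powr \<gamma>" if k': "0 < k'" "k' \<le> 2 * k" for k'
    proof -
      have "(k' * real L) powr \<beta> \<le> ((2 * k) * ((real L0 + 2) * k powr \<delta>)) powr \<beta>"
        using k' k Lup \<beta> by (intro powr_mono2 mult_mono) auto
      also have "(2 * k) * ((real L0 + 2) * k powr \<delta>) = (2 * (real L0 + 2)) * k powr (1 + \<delta>)"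
        using k by (simp add: powr_add)
      also have "\<dots> powr \<beta> = (2 * (real L0 + 2)) powr \<beta> * k powr \<gamma>"
        using k by (simp add: powr_mult powr_powr \<gamma>eq mult.commute)
      finally show ?thesis unfolding CE_def using C1 C2
        by (simp add: mult.assoc mult_left_mono)
    qed
    \<comment> \<open>Changing the dilation by \<open>s\<close> alters the volume by order at most
      \<open>s * k ^ (d - 1)\<close>, and \<open>s\<close> is at most of order
      \<open>k powr (- \<delta>)\<close>; this is the other half of the balance, next to
      \<open>E\<close>.\<close>
    have vol: "(a ^ CARD('n) - b ^ CARD('n)) * V \<le> CV * k powr \<gamma>"
      if ab: "0 \<le> b" "a - b = s" "a \<le> 2 * k" for a b
    proof -
      have a0: "0 \<le> a" "b \<le> a" using ab s0 by linarith+
      have "a ^ CARD('n) - b ^ CARD('n) \<le> dr * (a - b) * a ^ (CARD('n) - 1)"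
        unfolding dr_def using ab a0 dr by (intro power_diff_le) auto
      also have "\<dots> \<le> dr * (2 * dr / \<rho> * k powr (- \<delta>)) * (2 * k) ^ (CARD('n) - 1)"
        using ab a0 dr sk s0 \<rho> by (intro mult_mono power_mono) auto
      also have "(2 * k) ^ (CARD('n) - 1) = 2 ^ (CARD('n) - 1) * k powr (dr - 1)"
        using k dr by (simp add: power_mult_distrib powr_realpow[symmetric] dr_def of_nat_diff)
      also have "dr * (2 * dr / \<rho> * k powr (- \<delta>)) * (2 ^ (CARD('n) - 1) * k powr (dr - 1))
         = dr * 2 ^ (CARD('n) - 1) * (2 * dr / \<rho>) * (k powr (- \<delta>) * k powr (dr - 1))" by simp
      also have "k powr (- \<delta>) * k powr (dr - 1) = k powr \<gamma>"
        by (simp add: powr_add[symmetric] \<gamma>_def algebra_simps)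
      finally have "(a ^ CARD('n) - b ^ CARD('n)) * V
          \<le> dr * 2 ^ (CARD('n) - 1) * (2 * dr / \<rho>) * k powr \<gamma> * V"
        using V0 by (intro mult_right_mono)
      then show ?thesis by (simp add: CV_def mult_ac)
    qed
    have up: "real (point_count (dilated K k y) 0) - (k + s) ^ CARD('n) * V
        \<le> 4/3 * (C1 * C2 * ((k + s) * real L) powr \<beta>) + e / 3"
      unfolding s_def V_def \<beta>_def C2_def dr_def
    proof (rule point_count_error_step(1)[OF K \<rho> d \<alpha> C1 decay L1])
      show "0 < k" using k by simp
      show "\<bar>real (point_count (dilated K (k + 2 * real CARD('n) / (real L + 1) / \<rho>) y') 0)
          - (k + 2 * real CARD('n) / (real L + 1) / \<rho>) ^ CARD('n) * measure lebesgue K\<bar> \<le> e" for y'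
        using e[OF hi(2,3), of y'] unfolding err_def s_def dr_def V_def .
    qed
    have low: "(k - s) ^ CARD('n) * V - real (point_count (dilated K k y) 0)
        \<le> 4/3 * (C1 * C2 * ((k - s) * real L) powr \<beta>) + e / 3"
      unfolding s_def V_def \<beta>_def C2_def dr_def
    proof (rule point_count_error_step(2)[OF K \<rho> d \<alpha> C1 decay L1])
      show "0 < k - 2 * real CARD('n) / (real L + 1) / \<rho>" using lo(1) unfolding s_def dr_def .
      show "\<bar>real (point_count (dilated K (k - 2 * real CARD('n) / (real L + 1) / \<rho>) y') 0)
          - (k - 2 * real CARD('n) / (real L + 1) / \<rho>) ^ CARD('n) * measure lebesgue K\<bar> \<le> e" for y'
        using e[OF lo(2,3), of y'] unfolding err_def s_def dr_def V_def .
    qed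
    have "err k y \<le> C5 * k powr \<gamma> + e / 3"
      using up E[OF hi(1,4)] vol[of k "k + s"] k hi(4)
      unfolding err_def C5_def by (simp add: algebra_simps)
    moreover have "- err k y \<le> C5 * k powr \<gamma> + e / 3"
      using low E[OF lo(1,4)] vol[of "k - s" k] k lo(1)
      unfolding err_def C5_def by (simp add: algebra_simps)
    ultimately show ?thesis by linarith
  qed
  \<comment> \<open>The constant is chosen to reproduce itself, \<open>C5 + B / 2 \<le> B\<close>,
    and to dominate the trivial bound for \<open>k < 2\<close>.\<close>
  define B where "B = 2 * C5 + C0 * 2 ^ CARD('n)"
  have C5: "0 \<le> C5" using CE0 CV0 by (simp add: C5_def)
  have B0: "0 \<le> B" using C5 C0 by (simp add: B_def)
  have claim: "\<bar>err k y\<bar> \<le> B * k powr \<gamma> + C0 * (1/2) ^ j * k ^ CARD('n)" if "1 \<le> k" for j k y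
    using that
  proof (induction j arbitrary: k y)
    case 0
    have "0 \<le> B * k powr \<gamma>" using B0 by simp
    then show ?case using trivial[OF 0, of y] by simp
  next
    case (Suc j)
    have rest: "0 \<le> C0 * (1/2) ^ Suc j * k ^ CARD('n)" using C0 Suc.prems by simp
    show ?case
    proof (cases "k < 2")
      case True
      have "\<bar>err k y\<bar> \<le> C0 * k ^ CARD('n)" by (rule trivial[OF Suc.prems])
      also have "\<dots> \<le> C0 * 2 ^ CARD('n)" using True Suc.prems C0 by (intro mult_left_mono power_mono) auto
      also have "\<dots> \<le> B * 1" using C5 by (simp add: B_def)
      also have "\<dots> \<le> B * k powr \<gamma>"
        using B0 Suc.prems \<gamma> by (intro mult_left_mono ge_one_powr_ge_zero) auto
      finally show ?thesis using rest by linarith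
    next
      case False
      define e where "e = 3/2 * (B * k powr \<gamma> + C0 * (1/2) ^ j * k ^ CARD('n))"
      have "\<bar>err k' y'\<bar> \<le> e" if k': "1 \<le> k'" "k' \<le> (1 + \<eta>) * k" for k' y'
      proof -
        have "k' powr \<gamma> \<le> ((1 + \<eta>) * k) powr \<gamma>" using k' \<gamma> by (intro powr_mono2) auto
        also have "\<dots> = (1 + \<eta>) powr \<gamma> * k powr \<gamma>" using \<eta> Suc.prems by (simp add: powr_mult)
        also have "\<dots> \<le> 3/2 * k powr \<gamma>" using \<eta>powr by (intro mult_right_mono) auto
        finally have 1: "B * k' powr \<gamma> \<le> B * (3/2 * k powr \<gamma>)" using B0 by (intro mult_left_mono)
        have "k' ^ CARD('n) \<le> ((1 + \<eta>) * k) ^ CARD('n)" using k' by (intro power_mono) auto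
        also have "\<dots> = (1 + \<eta>) ^ CARD('n) * k ^ CARD('n)" by (simp only: power_mult_distrib)
        also have "\<dots> \<le> 3/2 * k ^ CARD('n)" using \<eta>pow Suc.prems by (intro mult_right_mono) auto
        finally have 2: "C0 * (1/2) ^ j * k' ^ CARD('n) \<le> C0 * (1/2) ^ j * (3/2 * k ^ CARD('n))"
          using C0 by (intro mult_left_mono) auto
        show ?thesis using Suc.IH[OF k'(1), of y'] 1 2 unfolding e_def by (simp add: algebra_simps)
      qed
      then have "\<bar>err k y\<bar> \<le> C5 * k powr \<gamma> + e / 3" using step[of k e y] False by simp
      also have "\<dots> = (C5 + B / 2) * k powr \<gamma> + C0 * (1/2) ^ Suc j * k ^ CARD('n)"
        unfolding e_def by (simp add: algebra_simps)
      also have "\<dots> \<le> B * k powr \<gamma> + C0 * (1/2) ^ Suc j * k ^ CARD('n)"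
        using C0 by (intro add_right_mono mult_right_mono) (auto simp: B_def)
      finally show ?thesis .
    qed
  qed
  have "\<bar>err k 0\<bar> \<le> B * k powr \<gamma>" if k: "1 \<le> k" for k
  proof (rule LIMSEQ_le_const)
    have "(\<lambda>j. B * k powr \<gamma> + C0 * (1/2) ^ j * k ^ CARD('n)) \<longlonglongrightarrow> B * k powr \<gamma> + C0 * 0 * k ^ CARD('n)"
      by (intro tendsto_intros LIMSEQ_power_zero) auto
    then show "(\<lambda>j. B * k powr \<gamma> + C0 * (1/2) ^ j * k ^ CARD('n)) \<longlonglongrightarrow> B * k powr \<gamma>" by simp
    show "\<exists>N. \<forall>j\<ge>N. \<bar>err k 0\<bar> \<le> B * k powr \<gamma> + C0 * (1/2) ^ j * k ^ CARD('n)"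
      using claim[OF k] by blast
  qed
  then show thesis
    using that unfolding err_def V_def \<gamma>_def \<delta>_def dr_def by blast
qed

theorem theorem2p1:
  fixes n :: nat and S S0 :: "(real ^ 'n) set" and \<alpha> C :: real
  assumes "n \<ge> 1"
    and "CARD('n) = n + 1"
    and "compact S"
    and "C2_hypersurface S"
    and "bounds_convex_domain S S0"
    and "0 \<in> S0"
    and "0 < \<alpha>" and "\<alpha> < 1"
    and "C > 0"
    and "\<And>(v :: real ^ 'n) t :: real. norm v = 1 \<Longrightarrow> t \<noteq> 0 \<Longrightarrow>
           max_slab_measure S v t \<le> ennreal (C * \<bar>t\<bar> powr (- \<alpha>))"
  shows "\<exists>C' :: real. \<forall>k :: real. k > 1 \<longrightarrow>
           \<bar>real (lattice_count S S0 k) - k ^ (n + 1) * measure lebesgue S0\<bar>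
             \<le> C' * k powr (real n - \<alpha> / (real n + 1 - \<alpha>))"
proof -
  have S0: "bounded S0" "open S0" "convex S0" "frontier S0 = S"
    using assms(5) by (auto simp: bounds_convex_domain_def)
  define K where "K = closure S0"
  have K: "compact K" "convex K"
    using S0 by (auto simp: K_def convex_closure)
  have un: "S0 \<union> S = K"
    unfolding K_def S0(4)[symmetric] using closure_subset by (auto simp: frontier_def interior_open[OF S0(2)])
  have fr: "frontier K = S"
    unfolding K_def frontier_def closure_closure convex_interior_closure[OF S0(3)]
    using S0(4) by (simp add: frontier_def)
  obtain \<rho> where \<rho>: "0 < \<rho>" "cball 0 \<rho> \<subseteq> S0"
    using S0(2) assms(6) open_contains_cball by blast
  then have \<rho>K: "cball 0 \<rho> \<subseteq> K" unfolding K_def using closure_subset by blast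
  have ne: "K \<noteq> {}" using \<rho>K \<rho>(1) by auto
  \<comment> \<open>The frontier of a convex set is negligible, so passing to the closed body leaves
    the volume unchanged.\<close>
  have meas: "measure lebesgue K = measure lebesgue S0"
  proof -
    have "S0 \<in> lmeasurable" using S0 by (intro bounded_set_imp_lmeasurable) auto
    moreover have "negligible (K - S0 \<union> (S0 - K))"
    proof (rule negligible_subset)
      show "negligible (frontier S0)" by (rule negligible_convex_frontier[OF S0(3)])
      show "K - S0 \<union> (S0 - K) \<subseteq> frontier S0" using un S0(4) by auto
    qed
    ultimately show ?thesis using measure_negligible_symdiff[of S0 K] by (simp add: Un_commute)
  qed
  have d: "CARD('n) \<ge> 2" using assms(1,2) by simp
  \<comment> \<open>A cap of height \<open>u\<close> is contained in the family of slabs of the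
    hypothesis, with \<open>t = 1 / u\<close>.\<close>
  have cap: "surface_measure {x \<in> frontier K. s \<le> x \<bullet> v \<and> x \<bullet> v \<le> s + u} \<le> ennreal (C * u powr \<alpha>)"
    if v: "norm v = 1" and u: "0 < u" for v s u
  proof -
    have "surface_measure {x \<in> S. s \<le> x \<bullet> v \<and> x \<bullet> v \<le> s + inverse \<bar>1 / u\<bar>} \<le> max_slab_measure S v (1 / u)"
      unfolding max_slab_measure_def by (rule SUP_upper) simp
    also have "\<dots> \<le> ennreal (C * \<bar>1 / u\<bar> powr (- \<alpha>))" using assms(10)[OF v, of "1 / u"] u by simp
    also have "\<bar>1 / u\<bar> powr (- \<alpha>) = u powr \<alpha>" using u by (simp add: powr_minus powr_divide)
    finally show ?thesis using u by (simp add: fr)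
  qed
  obtain C1 where C1: "0 \<le> C1" "\<And>(v :: real ^ 'n) t \<psi>. norm v = 1 \<Longrightarrow> 0 < t \<Longrightarrow>
       \<bar>\<integral>x. indicator K x * cos (t * (x \<bullet> v) + \<psi>) \<partial>lborel\<bar> \<le> C1 * t powr (- 1 - \<alpha>)"
    using fourier_decay_unit[OF _ K ne assms(7,8) _ cap] d assms(9) by auto
  obtain B where B: "\<And>k. 1 \<le> k \<Longrightarrow>
    \<bar>real (point_count (dilated K k 0) 0) - k ^ CARD('n) * measure lebesgue K\<bar>
      \<le> B * k powr (real CARD('n) - 1 - \<alpha> / (real CARD('n) - \<alpha>))"
    using point_count_error_le[OF K \<rho>K \<rho>(1) d assms(7,8) C1] by blast
  have count: "lattice_count S S0 k = point_count (dilated K k 0) 0" for k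
  proof -
    have "integer_lattice \<inter> (\<lambda>x. k *\<^sub>R x) ` (S0 \<union> S) = lattice_vec ` {m. lattice_vec m + 0 \<in> dilated K k 0}"
    proof
      show "integer_lattice \<inter> (\<lambda>x. k *\<^sub>R x) ` (S0 \<union> S) \<subseteq> lattice_vec ` {m. lattice_vec m + 0 \<in> dilated K k 0}"
      proof
        fix z assume z: "z \<in> integer_lattice \<inter> (\<lambda>x. k *\<^sub>R x) ` (S0 \<union> S)"
        then have zi: "z $ i = of_int \<lfloor>z $ i\<rfloor>" for i by (auto simp: integer_lattice_def elim!: Ints_cases)
        define m where "m i = \<lfloor>z $ i\<rfloor>" for i
        have "z = lattice_vec m" by (simp add: vec_eq_iff m_def zi[symmetric])
        then show "z \<in> lattice_vec ` {m. lattice_vec m + 0 \<in> dilated K k 0}"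
          using z unfolding un by (auto simp: dilated_def)
      qed
      show "lattice_vec ` {m. lattice_vec m + 0 \<in> dilated K k 0} \<subseteq> integer_lattice \<inter> (\<lambda>x. k *\<^sub>R x) ` (S0 \<union> S)"
      proof (rule image_subsetI)
        fix m :: "'n \<Rightarrow> int" assume "m \<in> {m. lattice_vec m + 0 \<in> dilated K k 0}"
        moreover have "lattice_vec m \<in> integer_lattice" by (simp add: integer_lattice_def)
        ultimately show "lattice_vec m \<in> integer_lattice \<inter> (\<lambda>x. k *\<^sub>R x) ` (S0 \<union> S)"
          by (simp add: dilated_def un)
      qed
    qed
    moreover have "inj_on lattice_vec {m. lattice_vec m + 0 \<in> dilated K k 0}"
      by (auto simp: inj_on_def vec_eq_iff fun_eq_iff)
    ultimately show ?thesis
      unfolding lattice_count_def point_count_def by (simp only: card_image)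
  qed
  show ?thesis
  proof (intro exI allI impI)
    fix k :: real assume "1 < k"
    then show "\<bar>real (lattice_count S S0 k) - k ^ (n + 1) * measure lebesgue S0\<bar>
             \<le> B * k powr (real n - \<alpha> / (real n + 1 - \<alpha>))"
      using B[of k] by (simp add: count assms(2) meas add.commute)
  qed
qed

end
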